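(* Let $\Omega\subset\mathbb{R}^n$ be a bounded, connected, open set, $v$ a weight on $\Omega$ with $v\in L^1(\Omega)$, and $Q$ a matrix function on $\Omega$ with $|Q(x)|_{\mathrm{op}}\le k\,v(x)$ for a.e. $x\in\Omega$ and some $k>0$. Let $N\in\mathbb{N}$, $f,F\in L^2(v,\Omega)$, $\mathbf G,\mathbf H,\mathbf g\in L^2(v,\Omega,\mathbb{R}^N)$, and let $\mathbf R,\mathbf S,\mathbf T$ be $N$-tuples of degenerate subunit vector fields. Suppose that $\int_\Omega(\mathbf G\cdot\mathbf S\varphi+F\varphi)\,v\,dx\ge0$ for every nonnegative $\varphi\in Q\mathrm{Lip}_0(v,\Omega)$. Let $A(t)=t^2\log(e+t)^\sigma$ for some $\sigma>0$, and suppose there is a constant $S(2,A)$ such that $\|\varphi\|_{L^A(v,\Omega)}\le S(2,A)\big(\int_\Omega|\sqrt Q\nabla\varphi|^2dx\big)^{1/2}$ for all $\varphi\in Q\mathrm{Lip}_0(v,\Omega)$. Suppose also that $\rho$ is an admissible quasimetric on $\Omega$ and that the local Poincaré inequality holds on $\Omega$ with respect to $\rho$. If for some $0<\lambda<1$, $\mathbf H,\mathbf G\in L^C(v,\Omega,\mathbb{R}^N)$ and $F\in L^D(v,\Omega)$, where $C(t)=\exp(t^{\frac2{\lambda\sigma}})-1$ and $D(t)=\exp(t^{\frac1{\lambda\sigma}})-1$, then the Dirichlet problem $$-v^{-1}\operatorname{div}(Q\nabla u)+\mathbf H\cdot\mathbf Ru+\mathbf S'\mathbf Gu+Fu=f+\mathbf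 T'\mathbf g\ \text{in }\Omega,\qquad u=0\ \text{on }\partial\Omega,$$ has a unique degenerate weak solution $u\in QH^{1,2}_0(v,\Omega)$.
   Context: A weight is a nonnegative measurable function $v$ with $0<v(x)<\infty$ a.e. A matrix function $Q$ on $\Omega$ is a map whose values are real, symmetric, positive semidefinite $n\times n$ matrices, with measurable entries finite a.e., and with $Q(x)$ invertible for a.e. $x$; $\sqrt Q$ is the positive semidefinite square root and $|\cdot|_{\mathrm{op}}$ the operator norm. Function spaces. $L^p(v,\Omega)$ has norm $(\int_\Omega|f|^pv\,dx)^{1/p}$; for $\Phi$ any of the functions $A(t)=t^2\log(e+t)^\sigma$, $C(t)=\exp(t^{\frac2{\lambda\sigma}})-1$, $D(t)=\exp(t^{\frac1{\lambda\sigma}})-1$ on $[0,\infty)$ (with $\sigma>0$ and $0<\lambda<1$), $L^\Phi(v,\Omega)$ is the set of measurable $f$ with $\|f\|_{L^\Phi(v,\Omega)}=\inf\{\lambda>0:\int_\Omega\Phi(|f|/\lambda)\,v\,dx\le1\}<\infty$. A vector function $\mathbf f$ is in $L^p(v,\Omega,\mathbb{R}^N)$ or $L^\Phi(v,\Omega,\mathbb{R}^N)$ if $|\mathbf f|$ is in the scalar space. $QL^2(\Omega)$ is the space of measurable $\mathbf f:\Omega\to\mathbb{R}^n$ with $\|\mathbf f\|_{QL^2(\Omega)}=(\int_\Omega|\sqrt Q\mathbf f|^2dx)^{1/2}<\infty$. $\mathrm{Lip}_{\mathrm{loc}}(\Omega)$: functions Lipschitz on compact subsets of $\Omega$; $\mathrm{Lip}_0(\Omega)$: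 Lipschitz functions with compact support in $\Omega$. $Q\mathrm{Lip}_{\mathrm{loc}}(v,\Omega)$ (resp. $Q\mathrm{Lip}_0(v,\Omega)$) is the set of $\varphi$ in $\mathrm{Lip}_{\mathrm{loc}}(\Omega)$ (resp. $\mathrm{Lip}_0(\Omega)$) with $\|\varphi\|_{QH^{1,2}(v,\Omega)}=\|\varphi\|_{L^2(v,\Omega)}+\|\nabla\varphi\|_{QL^2(\Omega)}<\infty$. $QH^{1,2}(v,\Omega)$ (resp. $QH^{1,2}_0(v,\Omega)$) is the closure of $\{(\varphi,\nabla\varphi)\}$, $\varphi\in Q\mathrm{Lip}_{\mathrm{loc}}(v,\Omega)$ (resp. $Q\mathrm{Lip}_0(v,\Omega)$), in $L^2(v,\Omega)\oplus QL^2(\Omega)$. Elements are pairs $(u,\mathbf g)$ with norm $\|u\|_{L^2(v,\Omega)}+\|\mathbf g\|_{QL^2(\Omega)}$; one writes $\nabla u:=\mathbf g$ by convention (it need not be a weak derivative nor be determined by $u$) and often just $u$ for the pair. Vector fields. A vector field is $V=\mathbf v\cdot\nabla$ with $\mathbf v:\Omega\to\mathbb{R}^n$ measurable, acting by $Vu=\mathbf v\cdot\nabla u$. It is degenerate subunit if there is a constant $C(V)$ with $\|Vu\|_{L^2(v,\Omega)}\le C(V)\|u\|_{QH^{1,2}(v,\Omega)}$ for all $u\in QH^{1,2}(v,\Omega)$. For $\mathbf R=(R_1,\dots,R_N)$, $\mathbf H\cdot\mathbf Ru=\sum_iH_iR_iu$; similarly $\mathbf G\cdot\mathbf S\varphi=\sum_iG_iS_i\varphi$,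 $\mathbf g\cdot\mathbf T\varphi=\sum_ig_iT_i\varphi$. With $S_i=\mathbf s_i\cdot\nabla$, the formal adjoint is $S_i'u=-v^{-1}\operatorname{div}(\mathbf s_iuv)$, and $\mathbf S'\mathbf Gu=\sum_iS_i'(G_iu)$; $\mathbf T'\mathbf g=\sum_iT_i'g_i$ likewise. Degenerate weak solution: a pair $(u,\nabla u)\in QH^{1,2}_0(v,\Omega)$ such that for all $\varphi\in Q\mathrm{Lip}_0(v,\Omega)$, $$\int_\Omega Q\nabla u\cdot\nabla\varphi\,dx+\int_\Omega\mathbf H\cdot\mathbf Ru\,\varphi\,v\,dx+\int_\Omega u\,\mathbf G\cdot\mathbf S\varphi\,v\,dx+\int_\Omega Fu\varphi\,v\,dx=\int_\Omega f\varphi\,v\,dx+\int_\Omega\mathbf g\cdot\mathbf T\varphi\,v\,dx.$$ Quasimetric. A quasimetric on $\Omega$ is $\rho:\Omega\times\Omega\to[0,\infty)$, symmetric, with $\rho(x,y)=0$ iff $x=y$, and $\rho(x,y)\le\kappa(\rho(x,z)+\rho(z,y))$ for some constant $\kappa>0$; $B_\rho(x,r)=\{y\in\Omega:\rho(x,y)<r\}$. Call it admissible if: (i) $\rho$-balls are open in the standard topology; (ii) for each $x\in\Omega$ there is $\delta(x)>0$ such that $\overline{B_\rho(x,r)}\subset\Omega$ for $0<r<\delta(x)$; (iii) there is a function $\mathcal G:(0,\infty)\to(0,\infty)$ such that for every compact $K\subset\Omega$ there is $\delta>0$ such that if $0<s<r<\delta$ and $x\in K$, there are at most $\mathcal G(r/s)$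 points $x_i\in B_\rho(x,r)$ such that the balls $B_\rho(x_i,s)$ are disjoint. Local Poincaré inequality on $\Omega$: there is $c\ge1$ such that for every compact $K\subset\Omega$ and $\epsilon>0$ there is $\delta>0$ so that for $0<r<\delta$, $x\in K$, and all $\varphi\in Q\mathrm{Lip}_0(v,\Omega)$, $$\Big(\int_{B_\rho(x,r)}|\varphi-\varphi_{v,B_\rho}|^2v\,dy\Big)^{\frac12}\le\epsilon\Big[\Big(\int_{B_\rho(x,cr)}|\sqrt Q\nabla\varphi|^2dy\Big)^{\frac12}+\Big(\int_{B_\rho(x,cr)}|\varphi|^2v\,dy\Big)^{\frac12}\Big],$$ where $\varphi_{v,B_\rho}=v(B)^{-1}\int_B\varphi\,v\,dy$, $B=B_\rho(x,r)$, $v(B)=\int_Bv\,dy$. *)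

theory Defs
  imports "HOL-Analysis.Analysis"
begin

text \<open>Functions on an open set \<open>\<Omega>\<close> are total functions of which only the values
  on \<open>\<Omega>\<close> matter. Elements of the function spaces are functions, not equivalence classes;
  identification almost everywhere is made explicit where it is needed.\<close>

subsection \<open>Weights and matrix functions\<close>

definition is_weight :: "(real^'n) set \<Rightarrow> (real^'n \<Rightarrow> real) \<Rightarrow> bool" where
  "is_weight \<Omega> v \<longleftrightarrow>
     v \<in> borel_measurable (lebesgue_on \<Omega>) \<and> (\<forall>x\<in>\<Omega>. 0 \<le> v x) \<and>
     (AE x in lebesgue_on \<Omega>. 0 < v x)"

definition psd_matrix :: "real^'n^'n \<Rightarrow> bool" where
  "psd_matrix M \<longleftrightarrow> transpose M = M \<and> (\<forall>x. 0 \<le> x \<bullet> (M *v x))"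

definition matrix_sqrt :: "real^'n^'n \<Rightarrow> real^'n^'n" where
  "matrix_sqrt M = (THE R. psd_matrix R \<and> R ** R = M)"

definition matrix_function :: "(real^'n) set \<Rightarrow> (real^'n \<Rightarrow> real^'n^'n) \<Rightarrow> bool" where
  "matrix_function \<Omega> Q \<longleftrightarrow>
     (\<forall>x\<in>\<Omega>. psd_matrix (Q x)) \<and>
     (\<forall>i j. (\<lambda>x. Q x $ i $ j) \<in> borel_measurable (lebesgue_on \<Omega>)) \<and>
     (AE x in lebesgue_on \<Omega>. invertible (Q x))"

subsection \<open>Weighted Lebesgue and Orlicz spaces\<close>

text \<open>\<open>Lp_norm\<close> and \<open>QL2_norm\<close> are meaningful only on members of the corresponding space
  (a Bochner integral is 0 on a non-integrable function); \<open>orlicz_norm\<close> takes the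
  value \<open>\<infinity>\<close> outside the Orlicz space.\<close>

definition Lp_space ::
    "real \<Rightarrow> (real^'n \<Rightarrow> real) \<Rightarrow> (real^'n) set \<Rightarrow> (real^'n \<Rightarrow> 'b::euclidean_space) set" where
  "Lp_space p v \<Omega> =
     {f. f \<in> borel_measurable (lebesgue_on \<Omega>) \<and>
         integrable (lebesgue_on \<Omega>) (\<lambda>x. norm (f x) powr p * v x)}"

definition Lp_norm ::
    "real \<Rightarrow> (real^'n \<Rightarrow> real) \<Rightarrow> (real^'n) set \<Rightarrow> (real^'n \<Rightarrow> 'b::euclidean_space) \<Rightarrow> real" where
  "Lp_norm p v \<Omega> f = (LINT x|lebesgue_on \<Omega>. norm (f x) powr p * v x) powr (1 / p)"

definition orlicz_norm ::
    "(real \<Rightarrow> real) \<Rightarrow> (real^'n \<Rightarrow> real) \<Rightarrow> (real^'n) set \<Rightarrow> (real^'n \<Rightarrow> 'b::euclidean_space) \<Rightarrow> ennreal" where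
  "orlicz_norm \<Phi> v \<Omega> f =
     Inf {ennreal l | l. 0 < l \<and>
            (\<integral>\<^sup>+x. ennreal (\<Phi> (norm (f x) / l) * v x) \<partial>lebesgue_on \<Omega>) \<le> 1}"

definition orlicz_space ::
    "(real \<Rightarrow> real) \<Rightarrow> (real^'n \<Rightarrow> real) \<Rightarrow> (real^'n) set \<Rightarrow> (real^'n \<Rightarrow> 'b::euclidean_space) set" where
  "orlicz_space \<Phi> v \<Omega> =
     {f. f \<in> borel_measurable (lebesgue_on \<Omega>) \<and> orlicz_norm \<Phi> v \<Omega> f < \<infinity>}"

definition young_A :: "real \<Rightarrow> real \<Rightarrow> real" where
  "young_A \<sigma> t = t\<^sup>2 * ln (exp 1 + t) powr \<sigma>"

definition young_C :: "real \<Rightarrow> real \<Rightarrow> real \<Rightarrow> real" where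
  "young_C lam \<sigma> t = exp (t powr (2 / (lam * \<sigma>))) - 1"

definition young_D :: "real \<Rightarrow> real \<Rightarrow> real \<Rightarrow> real" where
  "young_D lam \<sigma> t = exp (t powr (1 / (lam * \<sigma>))) - 1"

definition QL2_space ::
    "(real^'n \<Rightarrow> real^'n^'n) \<Rightarrow> (real^'n) set \<Rightarrow> (real^'n \<Rightarrow> real^'n) set" where
  "QL2_space Q \<Omega> =
     {g. g \<in> borel_measurable (lebesgue_on \<Omega>) \<and>
         integrable (lebesgue_on \<Omega>) (\<lambda>x. (norm (matrix_sqrt (Q x) *v g x))\<^sup>2)}"

definition QL2_norm ::
    "(real^'n \<Rightarrow> real^'n^'n) \<Rightarrow> (real^'n) set \<Rightarrow> (real^'n \<Rightarrow> real^'n) \<Rightarrow> real" where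
  "QL2_norm Q \<Omega> g = sqrt (LINT x|lebesgue_on \<Omega>. (norm (matrix_sqrt (Q x) *v g x))\<^sup>2)"

subsection \<open>Lipschitz functions and degenerate Sobolev spaces\<close>

text \<open>Partial derivatives of a locally Lipschitz function exist almost everywhere (Rademacher);
  on the exceptional null set \<open>deriv\<close> is an arbitrary value.\<close>

definition grad :: "(real^'n \<Rightarrow> real) \<Rightarrow> real^'n \<Rightarrow> real^'n" where
  "grad \<phi> x = (\<chi> i. deriv (\<lambda>t. \<phi> (x + t *\<^sub>R axis i 1)) 0)"

definition Lip_loc :: "(real^'n) set \<Rightarrow> (real^'n \<Rightarrow> real) set" where
  "Lip_loc \<Omega> = {\<phi>. \<forall>K. compact K \<and> K \<subseteq> \<Omega> \<longrightarrow> (\<exists>L. L-lipschitz_on K \<phi>)}"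

definition Lip_0 :: "(real^'n) set \<Rightarrow> (real^'n \<Rightarrow> real) set" where
  "Lip_0 \<Omega> = {\<phi>. (\<exists>L. L-lipschitz_on \<Omega> \<phi>) \<and>
                  compact (closure {x\<in>\<Omega>. \<phi> x \<noteq> 0}) \<and> closure {x\<in>\<Omega>. \<phi> x \<noteq> 0} \<subseteq> \<Omega>}"

definition QLip_loc ::
    "(real^'n \<Rightarrow> real^'n^'n) \<Rightarrow> (real^'n \<Rightarrow> real) \<Rightarrow> (real^'n) set \<Rightarrow> (real^'n \<Rightarrow> real) set" where
  "QLip_loc Q v \<Omega> = {\<phi>\<in>Lip_loc \<Omega>. \<phi> \<in> Lp_space 2 v \<Omega> \<and> grad \<phi> \<in> QL2_space Q \<Omega>}"

definition QLip_0 ::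
    "(real^'n \<Rightarrow> real^'n^'n) \<Rightarrow> (real^'n \<Rightarrow> real) \<Rightarrow> (real^'n) set \<Rightarrow> (real^'n \<Rightarrow> real) set" where
  "QLip_0 Q v \<Omega> = {\<phi>\<in>Lip_0 \<Omega>. \<phi> \<in> Lp_space 2 v \<Omega> \<and> grad \<phi> \<in> QL2_space Q \<Omega>}"

definition QH_norm ::
    "(real^'n \<Rightarrow> real^'n^'n) \<Rightarrow> (real^'n \<Rightarrow> real) \<Rightarrow> (real^'n) set \<Rightarrow>
     (real^'n \<Rightarrow> real) \<times> (real^'n \<Rightarrow> real^'n) \<Rightarrow> real" where
  "QH_norm Q v \<Omega> = (\<lambda>(u, g). Lp_norm 2 v \<Omega> u + QL2_norm Q \<Omega> g)"

text \<open>The closure of \<open>{(\<phi>, \<nabla>\<phi>) | \<phi> \<in> \<L>}\<close> in \<open>L\<^sup>2(v,\<Omega>) \<oplus> QL\<^sup>2(\<Omega>)\<close>.\<close>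

definition QH_closure ::
    "(real^'n \<Rightarrow> real^'n^'n) \<Rightarrow> (real^'n \<Rightarrow> real) \<Rightarrow> (real^'n) set \<Rightarrow> (real^'n \<Rightarrow> real) set \<Rightarrow>
     ((real^'n \<Rightarrow> real) \<times> (real^'n \<Rightarrow> real^'n)) set" where
  "QH_closure Q v \<Omega> \<L> =
     {(u, g). u \<in> Lp_space 2 v \<Omega> \<and> g \<in> QL2_space Q \<Omega> \<and>
        (\<forall>\<epsilon>>0. \<exists>\<phi>\<in>\<L>. QH_norm Q v \<Omega> (\<lambda>x. u x - \<phi> x, \<lambda>x. g x - grad \<phi> x) < \<epsilon>)}"

definition QH12 ::
    "(real^'n \<Rightarrow> real^'n^'n) \<Rightarrow> (real^'n \<Rightarrow> real) \<Rightarrow> (real^'n) set \<Rightarrow>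
     ((real^'n \<Rightarrow> real) \<times> (real^'n \<Rightarrow> real^'n)) set" where
  "QH12 Q v \<Omega> = QH_closure Q v \<Omega> (QLip_loc Q v \<Omega>)"

definition QH12_0 ::
    "(real^'n \<Rightarrow> real^'n^'n) \<Rightarrow> (real^'n \<Rightarrow> real) \<Rightarrow> (real^'n) set \<Rightarrow>
     ((real^'n \<Rightarrow> real) \<times> (real^'n \<Rightarrow> real^'n)) set" where
  "QH12_0 Q v \<Omega> = QH_closure Q v \<Omega> (QLip_0 Q v \<Omega>)"

subsection \<open>Vector fields and weak solutions\<close>

text \<open>A vector field is given by its coefficient function \<open>V\<close>; on a pair \<open>(u, \<nabla>u)\<close> it acts
  through the second component. An \<open>N\<close>-tuple of fields is a function on a finite index type.\<close>

definition degenerate_subunit ::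
    "(real^'n \<Rightarrow> real^'n^'n) \<Rightarrow> (real^'n \<Rightarrow> real) \<Rightarrow> (real^'n) set \<Rightarrow> (real^'n \<Rightarrow> real^'n) \<Rightarrow> bool" where
  "degenerate_subunit Q v \<Omega> V \<longleftrightarrow>
     V \<in> borel_measurable (lebesgue_on \<Omega>) \<and>
     (\<exists>C. \<forall>(u, du)\<in>QH12 Q v \<Omega>.
        (\<lambda>x. V x \<bullet> du x) \<in> Lp_space 2 v \<Omega> \<and>
        Lp_norm 2 v \<Omega> (\<lambda>x. V x \<bullet> du x) \<le> C * QH_norm Q v \<Omega> (u, du))"

definition dot_fields ::
    "(real^'n \<Rightarrow> real^'N) \<Rightarrow> ('N \<Rightarrow> real^'n \<Rightarrow> real^'n) \<Rightarrow> (real^'n \<Rightarrow> real^'n) \<Rightarrow> real^'n \<Rightarrow> real" where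
  "dot_fields H R du x = (\<Sum>i\<in>UNIV. H x $ i * (R i x \<bullet> du x))"

text \<open>Degenerate weak solution of
  \<open>-v\<^sup>-\<^sup>1 div (Q\<nabla>u) + H\<cdot>Ru + S'Gu + Fu = f + T'g\<close> in \<open>\<Omega>\<close>, \<open>u = 0\<close> on the boundary, where
  \<open>du\<close> stands for \<open>\<nabla>u\<close>.\<close>

definition degenerate_weak_solution ::
    "(real^'n) set \<Rightarrow> (real^'n \<Rightarrow> real) \<Rightarrow> (real^'n \<Rightarrow> real^'n^'n) \<Rightarrow>
     (real^'n \<Rightarrow> real^'N) \<Rightarrow> ('N \<Rightarrow> real^'n \<Rightarrow> real^'n) \<Rightarrow>
     (real^'n \<Rightarrow> real^'N) \<Rightarrow> ('N \<Rightarrow> real^'n \<Rightarrow> real^'n) \<Rightarrow> (real^'n \<Rightarrow> real) \<Rightarrow>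
     (real^'n \<Rightarrow> real) \<Rightarrow> (real^'n \<Rightarrow> real^'N) \<Rightarrow> ('N \<Rightarrow> real^'n \<Rightarrow> real^'n) \<Rightarrow>
     (real^'n \<Rightarrow> real) \<times> (real^'n \<Rightarrow> real^'n) \<Rightarrow> bool" where
  "degenerate_weak_solution \<Omega> v Q H R G S F f g T = (\<lambda>(u, du).
     (u, du) \<in> QH12_0 Q v \<Omega> \<and>
     (\<forall>\<phi>\<in>QLip_0 Q v \<Omega>.
        (LINT x|lebesgue_on \<Omega>. (Q x *v du x) \<bullet> grad \<phi> x)
        + (LINT x|lebesgue_on \<Omega>. dot_fields H R du x * \<phi> x * v x)
        + (LINT x|lebesgue_on \<Omega>. u x * dot_fields G S (grad \<phi>) x * v x)
        + (LINT x|lebesgue_on \<Omega>. F x * u x * \<phi> x * v x)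
        = (LINT x|lebesgue_on \<Omega>. f x * \<phi> x * v x)
        + (LINT x|lebesgue_on \<Omega>. dot_fields g T (grad \<phi>) x * v x)))"

subsection \<open>Quasimetrics and the local Poincare inequality\<close>

definition quasimetric_on :: "'a set \<Rightarrow> ('a \<Rightarrow> 'a \<Rightarrow> real) \<Rightarrow> bool" where
  "quasimetric_on \<Omega> \<rho> \<longleftrightarrow>
     (\<forall>x\<in>\<Omega>. \<forall>y\<in>\<Omega>. 0 \<le> \<rho> x y \<and> \<rho> x y = \<rho> y x \<and> (\<rho> x y = 0 \<longleftrightarrow> x = y)) \<and>
     (\<exists>\<kappa>>0. \<forall>x\<in>\<Omega>. \<forall>y\<in>\<Omega>. \<forall>z\<in>\<Omega>. \<rho> x y \<le> \<kappa> * (\<rho> x z + \<rho> z y))"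

definition qball :: "'a set \<Rightarrow> ('a \<Rightarrow> 'a \<Rightarrow> real) \<Rightarrow> 'a \<Rightarrow> real \<Rightarrow> 'a set" where
  "qball \<Omega> \<rho> x r = {y\<in>\<Omega>. \<rho> x y < r}"

definition admissible_quasimetric ::
    "(real^'n) set \<Rightarrow> (real^'n \<Rightarrow> real^'n \<Rightarrow> real) \<Rightarrow> bool" where
  "admissible_quasimetric \<Omega> \<rho> \<longleftrightarrow>
     quasimetric_on \<Omega> \<rho> \<and>
     (\<forall>x\<in>\<Omega>. \<forall>r>0. open (qball \<Omega> \<rho> x r)) \<and>
     (\<forall>x\<in>\<Omega>. \<exists>\<delta>>0. \<forall>r. 0 < r \<and> r < \<delta> \<longrightarrow> closure (qball \<Omega> \<rho> x r) \<subseteq> \<Omega>) \<and>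
     (\<exists>\<G> :: real \<Rightarrow> real. (\<forall>t>0. 0 < \<G> t) \<and>
        (\<forall>K. compact K \<and> K \<subseteq> \<Omega> \<longrightarrow>
           (\<exists>\<delta>>0. \<forall>s r x. 0 < s \<and> s < r \<and> r < \<delta> \<and> x \<in> K \<longrightarrow>
              (\<forall>X. X \<subseteq> qball \<Omega> \<rho> x r \<and> disjoint_family_on (\<lambda>z. qball \<Omega> \<rho> z s) X \<longrightarrow>
                 finite X \<and> real (card X) \<le> \<G> (r / s)))))"

definition weighted_average ::
    "(real^'n \<Rightarrow> real) \<Rightarrow> (real^'n) set \<Rightarrow> (real^'n \<Rightarrow> real) \<Rightarrow> real" where
  "weighted_average v B \<phi> =
     (LINT y|lebesgue_on B. \<phi> y * v y) / (LINT y|lebesgue_on B. v y)"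

definition local_Poincare ::
    "(real^'n \<Rightarrow> real^'n^'n) \<Rightarrow> (real^'n \<Rightarrow> real) \<Rightarrow> (real^'n) set \<Rightarrow>
     (real^'n \<Rightarrow> real^'n \<Rightarrow> real) \<Rightarrow> bool" where
  "local_Poincare Q v \<Omega> \<rho> \<longleftrightarrow>
     (\<exists>c\<ge>1. \<forall>K \<epsilon>. compact K \<and> K \<subseteq> \<Omega> \<and> 0 < \<epsilon> \<longrightarrow>
        (\<exists>\<delta>>0. \<forall>r x. 0 < r \<and> r < \<delta> \<and> x \<in> K \<longrightarrow>
           (\<forall>\<phi>\<in>QLip_0 Q v \<Omega>.
              sqrt (LINT y|lebesgue_on (qball \<Omega> \<rho> x r).
                      \<bar>\<phi> y - weighted_average v (qball \<Omega> \<rho> x r) \<phi>\<bar>\<^sup>2 * v y)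
              \<le> \<epsilon> * (sqrt (LINT y|lebesgue_on (qball \<Omega> \<rho> x (c * r)).
                              (norm (matrix_sqrt (Q y) *v grad \<phi> y))\<^sup>2)
                      + sqrt (LINT y|lebesgue_on (qball \<Omega> \<rho> x (c * r)).
                              \<bar>\<phi> y\<bar>\<^sup>2 * v y)))))"

end

theory Submission
  imports Defs "HOL-Library.Function_Algebras"
begin

text \<open>Let \<open>a(p, q) = \<langle>p, q\<rangle> + B(p, q)\<close> be the bilinear form of the equation on pairs
\<open>p = (u, \<nabla>u)\<close> in \<open>W = QH\<^sub>0\<^sup>1\<^sup>,\<^sup>2(v, \<Omega>)\<close>, where \<open>\<langle>p, q\<rangle>\<close> is the integral of \<open>Q\<nabla>u \<bullet> \<nabla>\<phi>\<close> and
\<open>B\<close> collects the terms with \<open>H\<close>, \<open>G\<close> and \<open>F\<close>. By the Sobolev inequality the energy norm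
\<open>|p| = \<langle>p, p\<rangle>\<^sup>1\<^sup>/\<^sup>2\<close> controls \<open>u\<close> in \<open>L\<^sup>2(v)\<close>; hence \<open>W\<close> is complete for it, and a pair of
energy zero vanishes almost everywhere because \<open>Q\<close> is invertible almost everywhere.

The heart of the proof is an a priori estimate for the adjoint problem, uniform along the
homotopy \<open>a\<^sub>t = \<langle>p, q\<rangle> + t B(p, q)\<close>, \<open>0 \<le> t \<le> 1\<close>: if \<open>|a\<^sub>t(q, w)| \<le> m |q|\<close> for all \<open>q\<close>, then
\<open>|w| \<le> C m\<close>. By density \<open>w\<close> may be taken Lipschitz with compact support, so that the chain rule
holds pointwise almost everywhere and smooth functions of \<open>w\<close> are admissible tests; let \<open>m = 1\<close>.

\<^item> Test with \<open>q = arctan w\<close>. By the product rule the \<open>G\<close> and \<open>F\<close> terms are the functional that is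
  nonnegative by hypothesis, evaluated at \<open>w arctan w \<ge> 0\<close>, minus a term of the same kind as the
  \<open>H\<close> term. Since \<open>arctan' = (arsinh')\<^sup>2\<close> and \<open>|w| arsinh'(w) \<le> 1\<close>, the remaining terms are at
  most a constant times \<open>|arsinh w|\<close>, while \<open>\<langle>arctan w, w\<rangle> = |arsinh w|\<^sup>2\<close>
  (\<open>log_estimate\<close>). So the sets where \<open>|w| > k\<close> have small \<open>v\<close>-measure for large \<open>k\<close>, uniformly
  in \<open>w\<close>.
\<^item> Test with \<open>q = w\<close>. The same terms are at most \<open>const |w|\<close> times the \<open>L\<^sup>2(v)\<close>-norm of
  \<open>(|H| + |G|) w\<close>, which is harmless where \<open>|w| \<le> k\<close>. Where \<open>|w| > k\<close> the integrability of \<open>H\<close> and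
  \<open>G\<close> exceeds what duality with the Sobolev gain requires (\<open>lam < 1\<close>), so that this norm is a
  small multiple of \<open>|w|\<close> and can be absorbed (\<open>young_inequality_with_gain\<close>,
  \<open>unit_a_priori_estimate\<close>).

The estimate for the adjoint makes every problem \<open>a\<^sub>t(u, \<cdot>) = \<ell>\<close> solvable with \<open>|u| \<le> C |\<ell>|\<close>,
by two applications of the Riesz representation theorem. At \<open>t = 0\<close> solutions are unique, and
uniqueness propagates in \<open>t\<close> by steps whose length depends on \<open>C\<close> and \<open>B\<close> only
(\<open>method_of_continuity\<close>).

Two facts underlie the calculus: \<open>grad\<close> is defined by pointwise partial derivatives, so these
must exist almost everywhere for Lipschitz functions, which is deduced from the Vitali covering
theorem; and the norm of \<open>QL\<^sup>2\<close> involves \<open>\<surd>Q\<close>, which exists by the spectral theorem.\<close>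

section \<open>Square roots of positive semidefinite matrices\<close>

text \<open>The first-order condition at the minimum \<open>t = 0\<close> of a quadratic polynomial in \<open>t\<close>.\<close>

lemma linear_term_vanishes:
  fixes a b :: real
  assumes "\<And>t. 0 \<le> 2 * t * b + t\<^sup>2 * a"
  shows "b = 0"
proof (rule ccontr)
  assume b: "b \<noteq> 0"
  define t where "t = - b / (\<bar>a\<bar> + 1)"
  have "2 * t * b + t\<^sup>2 * a \<le> 2 * t * b + t\<^sup>2 * (\<bar>a\<bar> + 1)"
    by (intro add_left_mono mult_left_mono) auto
  also have "\<dots> = 2 * t * b + t * (t * (\<bar>a\<bar> + 1))" by (simp add: power2_eq_square mult.assoc)
  also have "t * (\<bar>a\<bar> + 1) = - b" by (simp add: t_def)
  also have "2 * t * b + t * (- b) = - (b\<^sup>2 / (\<bar>a\<bar> + 1))" by (simp add: t_def power2_eq_square)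
  also have "\<dots> < 0" using b by (simp add: add_nonneg_pos)
  finally show False using assms[of t] by simp
qed

text \<open>A maximiser \<open>e\<close> of \<open>x \<bullet> f x\<close> on the unit sphere of \<open>S\<close>, with maximum \<open>c\<close>, is an eigenvector:
the quadratic form \<open>c (y \<bullet> y) - y \<bullet> f y\<close> is nonnegative on \<open>S\<close> and vanishes at \<open>e\<close>, so its
derivative at \<open>e\<close> in the direction \<open>c e - f e\<close> is zero.\<close>

lemma selfadjoint_invariant_subspace_has_eigenvector:
  fixes f :: "'a::euclidean_space \<Rightarrow> 'a"
  assumes lin: "linear f" and sym: "\<And>x y. x \<bullet> f y = f x \<bullet> y"
    and S: "subspace S" "f ` S \<subseteq> S" "S \<noteq> {0}"
  shows "\<exists>e\<in>S. norm e = 1 \<and> (\<exists>c. f e = c *\<^sub>R e)"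
proof -
  let ?K = "sphere 0 1 \<inter> S"
  have contf: "continuous_on UNIV f" using lin by (simp add: linear_continuous_on linear_conv_bounded_linear)
  have "compact ?K" using closed_subspace[OF S(1)] by (intro compact_Int_closed) auto
  moreover have "?K \<noteq> {}"
  proof -
    obtain x where x: "x \<in> S" "x \<noteq> 0" using S subspace_0 by blast
    then have "(1 / norm x) *\<^sub>R x \<in> ?K" using S(1) by (auto simp: subspace_scale)
    then show ?thesis by blast
  qed
  moreover have "continuous_on ?K (\<lambda>x. x \<bullet> f x)"
    using contf by (intro continuous_intros) (auto intro: continuous_on_subset)
  ultimately obtain e where e: "e \<in> ?K" and emax: "\<And>y. y \<in> ?K \<Longrightarrow> y \<bullet> f y \<le> e \<bullet> f e"
    using continuous_attains_sup by metis
  define c where "c = e \<bullet> f e"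
  have ee: "e \<bullet> e = 1" using e by (simp add: dot_square_norm)
  have le: "y \<bullet> f y \<le> c * (y \<bullet> y)" if "y \<in> S" for y
  proof (cases "y = 0")
    case True then show ?thesis by (simp add: linear_0[OF lin])
  next
    case False
    then have "(1 / norm y) *\<^sub>R y \<in> ?K" using that S(1) by (auto simp: subspace_scale)
    from emax[OF this] have "(y \<bullet> f y) / (norm y)\<^sup>2 \<le> c"
      by (simp add: c_def linear_scale[OF lin] power2_eq_square)
    then show ?thesis using False by (simp add: field_simps dot_square_norm)
  qed
  define y where "y = c *\<^sub>R e - f e"
  have yS: "y \<in> S" unfolding y_def using e S by (auto intro!: subspace_diff subspace_scale)
  define B where "B = y \<bullet> y"
  define A where "A = c * (y \<bullet> y) - y \<bullet> f y"
  have quad: "0 \<le> 2 * t * B + t\<^sup>2 * A" for t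
  proof -
    have "e + t *\<^sub>R y \<in> S" using e yS S by (auto intro!: subspace_add subspace_scale)
    from le[OF this] have h1: "(e + t *\<^sub>R y) \<bullet> (f e + t *\<^sub>R f y) \<le> c * ((e + t *\<^sub>R y) \<bullet> (e + t *\<^sub>R y))"
      by (simp add: linear_add[OF lin] linear_scale[OF lin])
    have h2: "(e + t *\<^sub>R y) \<bullet> (f e + t *\<^sub>R f y) = c + 2 * t * (f e \<bullet> y) + t\<^sup>2 * (y \<bullet> f y)"
      using sym[of e y] by (simp add: inner_add_left inner_add_right c_def power2_eq_square algebra_simps inner_commute[of y "f e"])
    have h3: "(e + t *\<^sub>R y) \<bullet> (e + t *\<^sub>R y) = 1 + 2 * t * (e \<bullet> y) + t\<^sup>2 * (y \<bullet> y)"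
      using ee by (simp add: inner_add_left inner_add_right power2_eq_square algebra_simps inner_commute[of y e])
    have h4: "B = c * (e \<bullet> y) - f e \<bullet> y"
      by (simp add: B_def y_def inner_diff_left)
    show ?thesis using h1 unfolding h2 h3 h4 A_def by (simp add: algebra_simps)
  qed
  have "B = 0" using quad by (rule linear_term_vanishes)
  then have "y = 0" by (simp add: B_def)
  then have "f e = c *\<^sub>R e" by (simp add: y_def)
  then show ?thesis using e by (intro bexI[of _ e] conjI exI[of _ c]) auto
qed

text \<open>A maximal orthonormal set of eigenvectors spans the space, since its orthogonal
  complement is invariant.\<close>

lemma selfadjoint_orthonormal_eigenbasis:
  fixes f :: "'a::euclidean_space \<Rightarrow> 'a"
  assumes lin: "linear f" and sym: "\<And>x y. x \<bullet> f y = f x \<bullet> y"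
  obtains B c where "finite B" "pairwise orthogonal B" "\<And>e. e \<in> B \<Longrightarrow> norm e = 1"
    "\<And>e. e \<in> B \<Longrightarrow> f e = c e *\<^sub>R e" "span B = UNIV"
proof -
  define P where "P = (\<lambda>B. pairwise orthogonal B \<and> (\<forall>e\<in>B. norm e = 1 \<and> (\<exists>c. f e = c *\<^sub>R e)))"
  have bnd: "finite B \<and> card B \<le> DIM('a)" if "P B" for B
  proof -
    have "independent B"
      using that by (intro pairwise_orthogonal_independent) (auto simp: P_def)
    then show ?thesis by (rule independent_bound)
  qed
  have "P {}" by (simp add: P_def)
  then obtain B where B: "P B" and max: "\<And>C. P C \<Longrightarrow> card C \<le> card B"
    using ex_has_greatest_nat[of P "{}" card "Suc DIM('a)"] bnd by (metis le_imp_less_Suc less_imp_le)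
  have "span B = UNIV"
  proof (rule ccontr)
    assume ne: "span B \<noteq> UNIV"
    define S where "S = {x. \<forall>b\<in>B. orthogonal b x}"
    have "S \<noteq> {0}"
    proof
      assume S0: "S = {0}"
      have "x \<in> span B" for x
      proof -
        obtain y z where yz: "y \<in> span B" "\<And>w. w \<in> span B \<Longrightarrow> orthogonal z w" "x = y + z"
          using orthogonal_subspace_decomp_exists[of B x] by metis
        then have "z \<in> S" by (auto simp: S_def orthogonal_commute span_base)
        with S0 yz show ?thesis by simp
      qed
      with ne show False by blast
    qed
    moreover have "subspace S"
      by (auto simp: S_def subspace_def orthogonal_def inner_add_right)
    moreover have "f ` S \<subseteq> S"
    proof clarify
      fix x assume x: "x \<in> S"
      have "b \<bullet> f x = 0" if b: "b \<in> B" for b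
      proof -
        obtain c where "f b = c *\<^sub>R b" using B b by (auto simp: P_def)
        then show ?thesis using sym[of b x] x b by (simp add: S_def orthogonal_def)
      qed
      then show "f x \<in> S" by (simp add: S_def orthogonal_def)
    qed
    ultimately obtain e c where e: "e \<in> S" "norm e = 1" "f e = c *\<^sub>R e"
      using selfadjoint_invariant_subspace_has_eigenvector[OF lin sym, of S] by blast
    have "e \<notin> B" using e by (auto simp: S_def orthogonal_def)
    moreover have "P (insert e B)"
      using B e by (auto simp: P_def pairwise_insert S_def orthogonal_commute)
    ultimately show False using max[of "insert e B"] bnd[OF B] by simp
  qed
  moreover have "\<forall>e\<in>B. \<exists>c. f e = c *\<^sub>R e" using B by (simp add: P_def)
  then obtain c where "\<And>e. e \<in> B \<Longrightarrow> f e = c e *\<^sub>R e" by metis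
  ultimately show ?thesis using that[of B c] B bnd[OF B] by (auto simp: P_def)
qed

lemma psd_matrix_symmetric: "psd_matrix M \<Longrightarrow> x \<bullet> (M *v y) = (M *v x) \<bullet> y"
  by (metis dot_lmul_matrix psd_matrix_def transpose_matrix_vector vector_transpose_matrix)

text \<open>Take the square roots of the eigenvalues in an orthonormal basis of eigenvectors.\<close>

lemma psd_matrix_sqrt_exists:
  fixes M :: "real^'n^'n"
  assumes M: "psd_matrix M"
  shows "\<exists>R. psd_matrix R \<and> R ** R = M"
proof -
  obtain B c where B: "finite B" "pairwise orthogonal B" "\<And>e. e \<in> B \<Longrightarrow> norm e = 1"
    "\<And>e. e \<in> B \<Longrightarrow> M *v e = c e *\<^sub>R e" "span B = UNIV"
    using selfadjoint_orthonormal_eigenbasis[of "(*v) M"] psd_matrix_symmetric[OF M]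
    by (metis matrix_vector_mul_linear)
  have ee: "e \<bullet> e = 1" if "e \<in> B" for e using B(3)[OF that] by (simp add: dot_square_norm)
  have c: "0 \<le> c e" if "e \<in> B" for e
  proof -
    have "0 \<le> e \<bullet> (M *v e)" using M by (simp add: psd_matrix_def)
    also have "\<dots> = c e" using that B(4) ee by simp
    finally show ?thesis .
  qed
  define r where "r = (\<lambda>x::real^'n. \<Sum>e\<in>B. (sqrt (c e) * (e \<bullet> x)) *\<^sub>R e)"
  define R where "R = matrix r"
  have linr: "linear r"
    by (auto intro!: linearI simp: r_def inner_add_right algebra_simps sum.distrib scaleR_sum_right)
  have Rr: "R *v x = r x" for x by (simp add: R_def matrix_works linr)
  have rx: "y \<bullet> r x = (\<Sum>e\<in>B. sqrt (c e) * (e \<bullet> x) * (e \<bullet> y))" for x y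
    by (simp add: r_def inner_sum_right inner_commute)
  have "psd_matrix R"
    unfolding psd_matrix_def
  proof (intro conjI allI)
    show "transpose R = R"
    proof -
      have "(transpose R *v x) \<bullet> y = (R *v x) \<bullet> y" for x y
      proof -
        have "(transpose R *v x) \<bullet> y = x \<bullet> (R *v y)" by (simp add: dot_lmul_matrix)
        also have "\<dots> = (R *v x) \<bullet> y" unfolding Rr inner_commute[of "r x" y] rx by (simp add: mult_ac)
        finally show ?thesis .
      qed
      then have "transpose R *v x = R *v x" for x by (metis vector_eq_rdot)
      then show ?thesis by (simp add: matrix_eq)
    qed
    show "0 \<le> x \<bullet> (R *v x)" for x
      unfolding Rr rx using c by (auto intro!: sum_nonneg simp: mult.assoc)
  qed
  moreover have "R ** R = M"
  proof -
    have re: "r e = sqrt (c e) *\<^sub>R e" if e: "e \<in> B" for e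
    proof -
      have "r e = (\<Sum>b\<in>B. if b = e then sqrt (c e) *\<^sub>R e else 0)"
        unfolding r_def
      proof (rule sum.cong)
        fix b assume "b \<in> B"
        then show "(sqrt (c b) * (b \<bullet> e)) *\<^sub>R b = (if b = e then sqrt (c e) *\<^sub>R e else 0)"
          using e ee B(2) by (auto simp: pairwise_def orthogonal_def)
      qed simp
      also have "\<dots> = sqrt (c e) *\<^sub>R e" using B(1) e by simp
      finally show ?thesis .
    qed
    have "(R ** R) *v x = M *v x" for x
    proof (rule linear_eq_on_span[of "(*v) (R ** R)" "(*v) M" B])
      fix e assume "e \<in> B"
      then show "(R ** R) *v e = M *v e"
        using re[of e] c[of e] B(4) by (simp add: matrix_vector_mul_assoc[symmetric] Rr linear_scale[OF linr])
    qed (use B(5) in auto)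
    then show ?thesis by (simp add: matrix_eq)
  qed
  ultimately show ?thesis by blast
qed

text \<open>If \<open>R\<^sup>2 = R'\<^sup>2\<close> and \<open>e\<close> is an eigenvector of \<open>R - R'\<close> with eigenvalue \<open>\<mu>\<close>, then
  \<open>0 = e \<bullet> (R\<^sup>2 - R'\<^sup>2) e = \<mu> (e \<bullet> R e + e \<bullet> R' e)\<close> forces \<open>\<mu> = 0\<close>.\<close>

lemma psd_matrix_sqrt_unique:
  fixes R R' :: "real^'n^'n"
  assumes R: "psd_matrix R" and R': "psd_matrix R'" and eq: "R ** R = R' ** R'"
  shows "R = R'"
proof -
  define f where "f = (\<lambda>x. R *v x - R' *v x)"
  have lin: "linear f" unfolding f_def by (intro linear_compose_sub matrix_vector_mul_linear)
  have sym: "x \<bullet> f y = f x \<bullet> y" for x y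
    using psd_matrix_symmetric[OF R, of x y] psd_matrix_symmetric[OF R', of x y]
    by (simp add: f_def inner_diff_left inner_diff_right)
  obtain B c where B: "\<And>e. e \<in> B \<Longrightarrow> norm e = 1"
    "\<And>e. e \<in> B \<Longrightarrow> f e = c e *\<^sub>R e" "span B = UNIV"
    using selfadjoint_orthonormal_eigenbasis[OF lin sym] by metis
  have f0: "f e = 0" if e: "e \<in> B" for e
  proof -
    have nn: "0 \<le> e \<bullet> (R *v e)" "0 \<le> e \<bullet> (R' *v e)" using R R' by (auto simp: psd_matrix_def)
    have "(R *v e) \<bullet> (R *v e) = e \<bullet> (R *v (R *v e))"
      using psd_matrix_symmetric[OF R] by metis
    also have "\<dots> = e \<bullet> (R' *v (R' *v e))" by (simp add: matrix_vector_mul_assoc eq)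
    also have "\<dots> = (R' *v e) \<bullet> (R' *v e)" using psd_matrix_symmetric[OF R'] by metis
    finally have "0 = f e \<bullet> (R *v e + R' *v e)"
      by (simp add: f_def inner_diff_left inner_add_right inner_commute[of "R' *v e" "R *v e"])
    also have "\<dots> = c e * (e \<bullet> (R *v e) + e \<bullet> (R' *v e))"
      using B(2)[OF e] by (simp add: inner_add_right distrib_left)
    finally have "c e = 0 \<or> e \<bullet> (R *v e) + e \<bullet> (R' *v e) = 0" by simp
    moreover have "c e = 0" if "e \<bullet> (R *v e) + e \<bullet> (R' *v e) = 0"
    proof -
      have "e \<bullet> f e = 0" using that nn by (simp add: f_def inner_diff_right)
      then show ?thesis using B(1,2)[OF e] by (simp add: dot_square_norm)
    qed
    ultimately show ?thesis using B(2)[OF e] by auto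
  qed
  have "f x = 0" for x
    using linear_eq_on_span[OF lin linear_zero, of B x] f0 B(3) by auto
  then show ?thesis by (simp add: f_def matrix_eq)
qed

lemma matrix_sqrt:
  assumes "psd_matrix M"
  shows "psd_matrix (matrix_sqrt M)" "matrix_sqrt M ** matrix_sqrt M = M"
proof -
  have "\<exists>!R. psd_matrix R \<and> R ** R = M"
    using psd_matrix_sqrt_exists[OF assms] psd_matrix_sqrt_unique by metis
  from theI'[OF this] show "psd_matrix (matrix_sqrt M)" "matrix_sqrt M ** matrix_sqrt M = M"
    by (simp_all add: matrix_sqrt_def)
qed

lemma matrix_sqrt_inner:
  assumes "psd_matrix M"
  shows "(matrix_sqrt M *v x) \<bullet> (matrix_sqrt M *v y) = (M *v x) \<bullet> y"
  using psd_matrix_symmetric[OF matrix_sqrt(1)[OF assms], of "matrix_sqrt M *v x" y]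
    matrix_sqrt(2)[OF assms]
  by (simp add: matrix_vector_mul_assoc)

lemma norm_matrix_sqrt_power2:
  assumes "psd_matrix M"
  shows "(norm (matrix_sqrt M *v x))\<^sup>2 = (M *v x) \<bullet> x"
  using matrix_sqrt_inner[OF assms, of x x] by (simp add: power2_norm_eq_inner)

lemma matrix_sqrt_injective:
  assumes "psd_matrix M" "invertible M" "matrix_sqrt M *v x = 0"
  shows "x = 0"
proof -
  have "M *v x = matrix_sqrt M *v (matrix_sqrt M *v x)"
    using matrix_sqrt(2)[OF assms(1)] by (simp add: matrix_vector_mul_assoc)
  then have "M *v x = 0" using assms(3) by simp
  then show ?thesis using assms(2) by (metis invertible_def matrix_left_invertible_ker)
qed

section \<open>Partial derivatives of Lipschitz functions\<close>

text \<open>The Vitali covering theorem extracts from the intervals with small increments a disjoint family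
that covers \<open>E\<close> up to a null set and stays in an open set of almost the measure of \<open>E\<close>; the
Lipschitz map \<open>F\<close> sends the null set to a null set. The continuous inverse \<open>G\<close> makes \<open>F ` E\<close>
measurable.\<close>

lemma emeasure_image_le_of_small_increments:
  fixes F G :: "real \<Rightarrow> real" and L p :: real
  assumes mono: "mono F"
    and GF: "\<And>x. G (F x) = x" and FG: "\<And>y. F (G y) = y"
    and contG: "continuous_on UNIV G"
    and lip: "L-lipschitz_on UNIV F"
    and E: "E \<in> sets borel" and p: "0 \<le> p"
    and V: "\<And>x d. x \<in> E \<Longrightarrow> 0 < d \<Longrightarrow>
              \<exists>a b. a < b \<and> x \<in> {a..b} \<and> b - a < d \<and> F b - F a \<le> p * (b - a)"
  shows "emeasure lborel (F ` E) \<le> ennreal p * emeasure lborel E"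
proof (rule ennreal_le_epsilon)
  fix e :: real assume e: "0 < e"
  have "0 < e / (p + 1)" using e p by simp
  then obtain U where U: "open U" "E \<subseteq> U" "emeasure lborel (U - E) < ennreal (e / (p + 1))"
    using outer_regular_lborel[OF E] by metis
  define K where "K = {i::real \<times> real. fst i < snd i \<and> {fst i..snd i} \<subseteq> U \<and> F (snd i) - F (fst i) \<le> p * (snd i - fst i)}"
  define m where "m = (\<lambda>i::real\<times>real. (fst i + snd i) / 2)"
  define r where "r = (\<lambda>i::real\<times>real. (snd i - fst i) / 2)"
  have cb: "cball (m i) (r i) = {fst i..snd i}" for i
    unfolding cball_eq_atLeastAtMost m_def r_def by (simp add: field_simps)
  have rpos: "0 < r i" if "i \<in> K" for i using that by (simp add: K_def r_def)
  have fine: "\<exists>i. i \<in> K \<and> x \<in> cball (m i) (r i) \<and> r i < d" if x: "x \<in> E" and d: "0 < d" for x d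
  proof -
    obtain d' where d': "0 < d'" "cball x d' \<subseteq> U" using U x open_contains_cball by blast
    obtain a b where ab: "a < b" "x \<in> {a..b}" "b - a < min d d'" "F b - F a \<le> p * (b - a)"
      using V[OF x, of "min d d'"] d d' by auto
    have "{a..b} \<subseteq> cball x d'" using ab by (auto simp: dist_real_def)
    with d' ab have "(a, b) \<in> K" by (auto simp: K_def)
    moreover have "x \<in> cball (m (a,b)) (r (a,b))" unfolding cb using ab by simp
    moreover have "r (a,b) < d" using ab d by (simp add: r_def)
    ultimately show ?thesis by blast
  qed
  obtain C where C: "countable C" "C \<subseteq> K"
     "pairwise (\<lambda>i j. disjnt (cball (m i) (r i)) (cball (m j) (r j))) C"
     "negligible (E - (\<Union>i \<in> C. cball (m i) (r i)))"
    using Vitali_covering_theorem_cballs[of K r E m, OF rpos fine] by blast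
  define I where "I = (\<lambda>i::real\<times>real. {fst i..snd i})"
  have C3: "disjoint_family_on I C"
    using C(3) by (auto simp: disjoint_family_on_def pairwise_def disjnt_def cb I_def)
  have inj: "inj F" using GF by (metis injI)
  have disj': "disjoint_family_on (\<lambda>i. F ` I i) C"
    using C3 inj unfolding disjoint_family_on_def by (metis image_Int image_empty)
  have contF: "continuous_on UNIV F" using lip by (rule lipschitz_on_continuous_on)
  have FI: "F ` I i = {F (fst i)..F (snd i)}" for i
  proof
    show "F ` I i \<subseteq> {F (fst i)..F (snd i)}" using mono by (auto simp: I_def mono_def)
    show "{F (fst i)..F (snd i)} \<subseteq> F ` I i"
    proof
      fix y assume y: "y \<in> {F (fst i)..F (snd i)}"
      have "fst i \<le> G y" "G y \<le> snd i"
        using y GF FG inj mono by (smt (verit) atLeastAtMost_iff monoD)+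
      then show "y \<in> F ` I i" using FG[of y] by (auto simp: I_def image_iff intro!: bexI[of _ "G y"])
    qed
  qed
  have im: "F ` X = G -` X" for X using GF FG by (auto simp: image_iff) (metis)
  have Gm: "G \<in> borel_measurable borel" using contG by (rule borel_measurable_continuous_onI)
  have FE: "F ` E \<in> sets borel" unfolding im using measurable_sets[OF Gm E] by simp
  have neg: "negligible (F ` (E - (\<Union>i\<in>C. I i)))"
  proof (rule negligible_locally_Lipschitz_image)
    show "negligible (E - (\<Union>i\<in>C. I i))" using C(4) by (simp add: cb I_def)
    fix x
    have "\<forall>y. norm (F y - F x) \<le> L * norm (y - x)"
      using lipschitz_onD[OF lip] by (auto simp: dist_norm)
    then show "\<exists>T B. open T \<and> x \<in> T \<and> (\<forall>y\<in>(E - (\<Union>i\<in>C. I i)) \<inter> T. norm (F y - F x) \<le> B * norm (y - x))"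
      by (intro exI[of _ UNIV] exI[of _ L]) auto
  qed simp
  have mN: "F ` (E - (\<Union>i\<in>C. I i)) \<in> sets lebesgue"
    using neg by (simp add: negligible_iff_null_sets null_setsD2)
  have mI: "(\<Union>i\<in>C. F ` I i) \<in> sets lebesgue"
    using C(1) by (intro sets.countable_UN'') (auto simp: FI)
  have "emeasure lborel (F ` E) = emeasure lebesgue (F ` E)" using FE by simp
  also have "\<dots> \<le> emeasure lebesgue (F ` (E - (\<Union>i\<in>C. I i)) \<union> (\<Union>i\<in>C. F ` I i))"
    by (rule emeasure_mono[OF _ sets.Un[OF mN mI]]) blast
  also have "\<dots> \<le> emeasure lebesgue (F ` (E - (\<Union>i\<in>C. I i))) + emeasure lebesgue (\<Union>i\<in>C. F ` I i)"
    by (rule emeasure_subadditive[OF mN mI])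
  also have "emeasure lebesgue (F ` (E - (\<Union>i\<in>C. I i))) = 0"
    using neg by (simp add: negligible_iff_null_sets null_setsD1)
  also have "0 + emeasure lebesgue (\<Union>i\<in>C. F ` I i) = (\<integral>\<^sup>+i. emeasure lebesgue (F ` I i) \<partial>count_space C)"
    using C(1) disj' by (subst emeasure_UN_countable) (auto simp: FI)
  also have "\<dots> \<le> (\<integral>\<^sup>+i. ennreal p * emeasure lebesgue (I i) \<partial>count_space C)"
  proof (rule nn_integral_mono)
    fix i assume "i \<in> space (count_space C)"
    then have i: "i \<in> K" using C by auto
    then have "F (fst i) \<le> F (snd i)" using mono by (auto simp: K_def mono_def)
    then show "emeasure lebesgue (F ` I i) \<le> ennreal p * emeasure lebesgue (I i)"
      using i p unfolding FI unfolding I_def K_def by (simp add: ennreal_mult[symmetric] ennreal_leI)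
  qed
  also have "\<dots> = ennreal p * emeasure lebesgue (\<Union>i\<in>C. I i)"
    using C(1) C3 by (subst emeasure_UN_countable) (auto simp: nn_integral_cmult I_def)
  also have "emeasure lebesgue (\<Union>i\<in>C. I i) \<le> emeasure lebesgue U"
    using C(2) U by (intro emeasure_mono) (auto simp: K_def I_def)
  also have "emeasure lebesgue U = emeasure lborel U" using U by simp
  also have "emeasure lborel U = emeasure lborel E + emeasure lborel (U - E)"
    using U E by (subst plus_emeasure) (auto simp: Un_absorb1)
  also have "\<dots> \<le> emeasure lborel E + ennreal (e / (p + 1))"
    using U by (intro add_left_mono) simp
  also have "ennreal p * \<dots> = ennreal p * emeasure lborel E + ennreal (p * (e / (p + 1)))"
    using p e by (simp add: distrib_left ennreal_mult[symmetric])
  also have "\<dots> \<le> ennreal p * emeasure lborel E + ennreal e"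
    using p e by (intro add_left_mono ennreal_leI) (simp add: field_simps)
  finally show "emeasure lborel (F ` E) \<le> ennreal p * emeasure lborel E + ennreal e"
    by (simp add: mult_left_mono)
qed


text \<open>Adding a linear function turns \<open>f\<close> into an increasing bi-Lipschitz map \<open>F\<close>. Let \<open>E\<close> be the set of
points at which the difference quotients of \<open>F\<close> fall below \<open>p\<close> and exceed \<open>q > p\<close> at arbitrarily
small scales. The preceding lemma, applied to \<open>F\<close> and to its inverse, bounds the measure of
\<open>F ` E\<close> by \<open>p\<close> times that of \<open>E\<close>, and the measure of \<open>E\<close> by \<open>1 / q\<close> times that of \<open>F ` E\<close>. So
\<open>E\<close> is null, as \<open>p / q < 1\<close>.\<close>

lemma lipschitz_differentiable_off_null_set:
  fixes f :: "real \<Rightarrow> real"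
  assumes f: "L-lipschitz_on UNIV f"
  shows "AE x in lborel. f differentiable (at x)"
proof -
  \<comment> \<open>One more than \<open>L\<close>, to be positive when \<open>L = 0\<close>.\<close>
  define M where "M = L + 1"
  have L0: "0 \<le> L" using f by (rule lipschitz_on_nonneg)
  then have M: "0 < M" by (simp add: M_def)
  have fM: "\<bar>f x - f y\<bar> \<le> M * \<bar>x - y\<bar>" for x y
  proof -
    have "\<bar>f x - f y\<bar> \<le> L * \<bar>x - y\<bar>" using lipschitz_onD[OF f, of x y] by (simp add: dist_real_def)
    also have "\<dots> \<le> M * \<bar>x - y\<bar>" by (simp add: M_def mult_right_mono)
    finally show ?thesis .
  qed
  \<comment> \<open>The slopes of \<open>F\<close> lie between \<open>M\<close> and \<open>3 M\<close>.\<close>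
  define F where "F = (\<lambda>x. f x + 2 * M * x)"
  have lo: "M * (y - x) \<le> F y - F x" if "x \<le> y" for x y
    using fM[of y x] that by (simp add: F_def algebra_simps abs_if split: if_splits)
  have up: "F y - F x \<le> 3 * M * (y - x)" if "x \<le> y" for x y
    using fM[of y x] that by (simp add: F_def algebra_simps abs_if split: if_splits)
  have mono: "mono F"
  proof (rule monoI)
    fix x y :: real assume "x \<le> y"
    then show "F x \<le> F y" using lo[of x y] M by (smt (verit) mult_nonneg_nonneg)
  qed
  have lipF: "(3 * M)-lipschitz_on UNIV F"
  proof (rule lipschitz_onI)
    show "dist (F x) (F y) \<le> 3 * M * dist x y" for x y
      using lo[of x y] lo[of y x] up[of x y] up[of y x] M mono
      by (cases "x \<le> y") (auto simp: dist_real_def abs_if dest: monoD split: if_splits)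
  qed (use M in simp)
  have contF: "continuous_on UNIV F" using lipF by (rule lipschitz_on_continuous_on)
  have "inj F"
  proof (rule injI, rule ccontr)
    fix x y assume e: "F x = F y" and ne: "x \<noteq> y"
    show False
    proof (cases "x \<le> y")
      case True
      with lo[OF True] M e ne show ?thesis by (simp add: mult_le_0_iff)
    next
      case False
      then have "y \<le> x" by simp
      from lo[OF this] M e ne False show ?thesis by (simp add: mult_le_0_iff)
    qed
  qed
  moreover have "surj F"
  proof -
    have "\<exists>x. F x = y" for y
    proof -
      define c where "c = \<bar>y - F 0\<bar> / M"
      have c: "0 \<le> c" "M * c = \<bar>y - F 0\<bar>" using M by (auto simp: c_def)
      have 1: "F (-c) \<le> y" "y \<le> F c" using lo[of "-c" 0] lo[of 0 c] c by auto
      have "\<exists>x\<ge>-c. x \<le> c \<and> F x = y"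
        using c 1 contF by (intro IVT') (auto intro: continuous_on_subset)
      then show ?thesis by blast
    qed
    then show ?thesis by (metis surjI surj_def)
  qed
  ultimately have bij: "bij F" by (simp add: bij_def)
  define G where "G = inv F"
  have GF: "G (F x) = x" for x using bij by (simp add: G_def bij_is_inj)
  have FG: "F (G y) = y" for y using bij by (simp add: G_def bij_is_surj surj_f_inv_f)
  have monoG: "mono G"
  proof (rule monoI)
    fix x y :: real assume "x \<le> y"
    then show "G x \<le> G y" using lo[of "G y" "G x"] M FG[of x] FG[of y]
      by (smt (verit) mult_pos_pos)
  qed
  have lipG: "(1 / M)-lipschitz_on UNIV G"
  proof (rule lipschitz_onI)
    show "dist (G x) (G y) \<le> 1 / M * dist x y" for x y
      using lo[of "G x" "G y"] lo[of "G y" "G x"] M FG[of x] FG[of y] monoD[OF monoG]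
      by (cases "x \<le> y") (auto simp: dist_real_def abs_if field_simps split: if_splits)
  qed (use M in simp)
  have contG: "continuous_on UNIV G" using lipG by (rule lipschitz_on_continuous_on)
  define s where "s = (\<lambda>x h. (F (x + h) - F x) / h)"
  have sbd: "M \<le> s x h" "s x h \<le> 3 * M" if "h \<noteq> 0" for x h
    using lo[of x "x+h"] lo[of "x+h" x] up[of x "x+h"] up[of "x+h" x] that
    by (cases "0 < h"; auto simp: s_def field_simps)+
  define E where "E = (\<lambda>p q. {x. \<forall>n::nat. (\<exists>h. h \<noteq> 0 \<and> \<bar>h\<bar> < 1 / Suc n \<and> s x h < p) \<and>
                                    (\<exists>h. h \<noteq> 0 \<and> \<bar>h\<bar> < 1 / Suc n \<and> q < s x h)})"
  have conts: "continuous_on UNIV (\<lambda>x. s x h)" if "h \<noteq> 0" for h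
    unfolding s_def using that contF
    by (intro continuous_intros continuous_on_compose2[OF contF]) auto
  have Eb: "E p q \<in> sets borel" for p q
  proof -
    have "open {x. s x h < p}" "open {x. q < s x h}" if "h \<noteq> 0" for h
      using conts[OF that] by (auto intro!: open_Collect_less continuous_intros)
    then have "open (\<Union>h\<in>{h. h \<noteq> 0 \<and> \<bar>h\<bar> < 1 / Suc n}. {x. s x h < p})"
              "open (\<Union>h\<in>{h. h \<noteq> 0 \<and> \<bar>h\<bar> < 1 / Suc n}. {x. q < s x h})" for n
      by (auto intro!: open_UN)
    then have "(\<Inter>n. (\<Union>h\<in>{h. h \<noteq> 0 \<and> \<bar>h\<bar> < 1 / Suc n}. {x. s x h < p}) \<inter>
                     (\<Union>h\<in>{h. h \<noteq> 0 \<and> \<bar>h\<bar> < 1 / Suc n}. {x. q < s x h})) \<in> sets borel"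
      by (intro sets.countable_INT'' sets.Int borel_open) auto
    also have "(\<Inter>n. (\<Union>h\<in>{h. h \<noteq> 0 \<and> \<bar>h\<bar> < 1 / Suc n}. {x. s x h < p}) \<inter>
                     (\<Union>h\<in>{h. h \<noteq> 0 \<and> \<bar>h\<bar> < 1 / Suc n}. {x. q < s x h})) = E p q"
      by (auto simp: E_def)
    finally show ?thesis .
  qed
  have null: "E p q \<in> null_sets lborel" if pq: "0 < p" "p < q" for p q
  proof -
    have "E p q \<inter> {-real n..real n} \<in> null_sets lborel" for n
    proof -
      let ?X = "E p q \<inter> {-real n..real n}"
      have Xb: "?X \<in> sets borel" using Eb by auto
      have im: "F ` ?X = G -` ?X"
      proof
        show "F ` ?X \<subseteq> G -` ?X" using GF by auto
        show "G -` ?X \<subseteq> F ` ?X" using FG by (metis image_eqI subsetI vimageE)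
      qed
      have "G \<in> borel_measurable borel" using contG by (rule borel_measurable_continuous_onI)
      from measurable_sets[OF this Xb] have FXb: "F ` ?X \<in> sets borel" unfolding im by simp
      have 1: "emeasure lborel (F ` ?X) \<le> ennreal p * emeasure lborel ?X"
      proof (rule emeasure_image_le_of_small_increments[OF mono GF FG contG lipF Xb])
        fix x d :: real assume x: "x \<in> ?X" and d: "0 < d"
        obtain k where k: "1 / real (Suc k) < d" using d nat_approx_posE by metis
        obtain h where h: "h \<noteq> 0" "\<bar>h\<bar> < 1 / Suc k" "s x h < p" using x unfolding E_def by blast
        have hd: "\<bar>h\<bar> < d" using h(2) k by linarith
        show "\<exists>a b. a < b \<and> x \<in> {a..b} \<and> b - a < d \<and> F b - F a \<le> p * (b - a)"
        proof (cases "0 < h")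
          case True
          then show ?thesis using h(3) hd
            by (intro exI[of _ x] exI[of _ "x+h"]) (auto simp: s_def field_simps)
        next
          case False
          then show ?thesis using h(1,3) hd
            by (intro exI[of _ "x+h"] exI[of _ x]) (auto simp: s_def field_simps)
        qed
      qed (use pq in simp)
      have 2: "emeasure lborel (G ` (F ` ?X)) \<le> ennreal (1/q) * emeasure lborel (F ` ?X)"
      proof (rule emeasure_image_le_of_small_increments[OF monoG FG GF contF lipG FXb])
        fix y d :: real assume y: "y \<in> F ` ?X" and d: "0 < d"
        then obtain x where x: "x \<in> ?X" "y = F x" by blast
        have "0 < d / (3 * M)" using d M by simp
        then obtain k where k: "1 / real (Suc k) < d / (3 * M)" using nat_approx_posE by metis
        obtain h where h: "h \<noteq> 0" "\<bar>h\<bar> < 1 / Suc k" "q < s x h" using x unfolding E_def by blast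
        have "\<bar>h\<bar> < d / (3 * M)" using h(2) k by linarith
        then have hd: "3 * M * \<bar>h\<bar> < d" using M by (simp add: pos_less_divide_eq mult.commute)
        show "\<exists>a b. a < b \<and> y \<in> {a..b} \<and> b - a < d \<and> G b - G a \<le> 1 / q * (b - a)"
        proof (cases "0 < h")
          case True
          have "F x < F (x + h)" using lo[of x "x+h"] True M by (smt (verit) mult_pos_pos)
          moreover have "F (x + h) - F x < d" using up[of x "x+h"] True hd by simp
          moreover have "h \<le> 1 / q * (F (x + h) - F x)" using h(3) True pq by (simp add: s_def field_simps)
          ultimately show ?thesis using x GF
            by (intro exI[of _ "F x"] exI[of _ "F (x+h)"]) auto
        next
          case False
          with h have hn: "h < 0" by simp
          have "F (x + h) < F x" using lo[of "x+h" x] hn M by (smt (verit) mult_pos_pos)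
          moreover have "F x - F (x + h) < d" using up[of "x+h" x] hn hd by simp
          moreover have "- h \<le> 1 / q * (F x - F (x + h))" using h(3) hn pq by (simp add: s_def field_simps)
          ultimately show ?thesis using x GF
            by (intro exI[of _ "F (x+h)"] exI[of _ "F x"]) auto
        qed
      qed (use pq in simp)
      have "G ` (F ` ?X) = ?X" using GF by (auto simp: image_iff)
      with 2 have "emeasure lborel ?X \<le> ennreal (1/q) * emeasure lborel (F ` ?X)" by simp
      also have "\<dots> \<le> ennreal (1/q) * (ennreal p * emeasure lborel ?X)"
        by (rule mult_left_mono[OF 1]) simp
      also have "\<dots> = ennreal (p/q) * emeasure lborel ?X"
        using pq by (simp add: ennreal_mult[symmetric] mult.assoc[symmetric])
      finally have le: "emeasure lborel ?X \<le> ennreal (p/q) * emeasure lborel ?X" .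
      have "emeasure lborel ?X \<le> emeasure lborel {-real n..real n}" by (intro emeasure_mono) auto
      also have "\<dots> < \<infinity>" by simp
      finally have "emeasure lborel ?X < \<infinity>" .
      then obtain m where m: "emeasure lborel ?X = ennreal m" "0 \<le> m"
        by (cases "emeasure lborel ?X") auto
      have "m \<le> p/q * m" using le pq m by (simp add: ennreal_mult[symmetric] del: times_divide_eq_left)
      then have "m * (1 - p/q) \<le> 0" by (simp add: algebra_simps)
      moreover have "0 < 1 - p/q" using pq by simp
      ultimately have "m = 0" using m(2) by (simp add: mult_le_0_iff)
      then show ?thesis using m Xb by auto
    qed
    then have "(\<Union>n. E p q \<inter> {-real n..real n}) \<in> null_sets lborel" by (rule null_sets_UN)
    also have "(\<Union>n. E p q \<inter> {-real n..real n}) = E p q"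
    proof -
      have "\<exists>n. x \<in> {-real n..real n}" for x :: real
      proof -
        obtain n where "\<bar>x\<bar> \<le> real n" using real_arch_simple by blast
        then show ?thesis by (intro exI[of _ n]) (simp add: abs_le_iff)
      qed
      then show ?thesis by blast
    qed
    finally show ?thesis .
  qed
  define N where "N = (\<Union>(p, q) \<in> {(p, q). 0 < p \<and> p < q}. E (real_of_rat p) (real_of_rat q))"
  have "N \<in> null_sets lborel"
    unfolding N_def by (intro null_sets_UN') (auto intro!: null simp: of_rat_less)
  then show ?thesis
  proof (rule AE_I')
    show "{x \<in> space lborel. \<not> f differentiable at x} \<subseteq> N"
    proof (clarsimp, rule ccontr)
      fix x assume nd: "\<not> f differentiable at x" and x: "x \<notin> N"
      let ?u = "\<lambda>h. ereal (s x h)"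
      have ev: "eventually (\<lambda>h::real. h \<noteq> 0) (at 0)" by (simp add: eventually_at_filter)
      have lb: "ereal M \<le> Liminf (at 0) ?u"
        by (rule Liminf_bounded) (use ev sbd in \<open>auto elim: eventually_mono\<close>)
      have ub: "Limsup (at 0) ?u \<le> ereal (3 * M)"
        by (rule Limsup_bounded) (use ev sbd in \<open>auto elim: eventually_mono\<close>)
      have le: "Liminf (at 0) ?u \<le> Limsup (at 0) ?u" by (rule Liminf_le_Limsup) simp
      have eq: "Liminf (at 0) ?u = Limsup (at 0) ?u"
      proof (rule ccontr)
        assume "Liminf (at 0) ?u \<noteq> Limsup (at 0) ?u"
        with le have "Liminf (at 0) ?u < Limsup (at 0) ?u" by simp
        then obtain p where p: "Liminf (at 0) ?u < ereal (real_of_rat p)" "ereal (real_of_rat p) < Limsup (at 0) ?u"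
          using ereal_dense3 by blast
        then obtain q where q: "ereal (real_of_rat p) < ereal (real_of_rat q)" "ereal (real_of_rat q) < Limsup (at 0) ?u"
          using ereal_dense3 by blast
        have "ereal M < ereal (real_of_rat p)" by (rule order.strict_trans1[OF lb p(1)])
        with M have p0: "0 < p" by (smt (verit) ereal_less_eq(3) less_ereal.simps(1) of_rat_le_0_iff zero_less_of_rat_iff)
        have pq: "p < q" using q by (simp add: of_rat_less)
        have fr: "(\<exists>h. h \<noteq> 0 \<and> \<bar>h\<bar> < d \<and> s x h < real_of_rat p) \<and> (\<exists>h. h \<noteq> 0 \<and> \<bar>h\<bar> < d \<and> real_of_rat q < s x h)"
          if d: "0 < d" for d :: real
        proof (intro conjI; rule ccontr)
          assume "\<nexists>h. h \<noteq> 0 \<and> \<bar>h\<bar> < d \<and> s x h < real_of_rat p"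
          then have "eventually (\<lambda>h. ereal (real_of_rat p) \<le> ?u h) (at 0)"
            unfolding eventually_at using d by (intro exI[of _ d]) (auto simp: dist_real_def not_less)
          then have "ereal (real_of_rat p) \<le> Liminf (at 0) ?u" by (rule Liminf_bounded)
          with p show False by simp
        next
          assume "\<nexists>h. h \<noteq> 0 \<and> \<bar>h\<bar> < d \<and> real_of_rat q < s x h"
          then have "eventually (\<lambda>h. ?u h \<le> ereal (real_of_rat q)) (at 0)"
            unfolding eventually_at using d by (intro exI[of _ d]) (auto simp: dist_real_def not_less)
          then have "Limsup (at 0) ?u \<le> ereal (real_of_rat q)" by (rule Limsup_bounded)
          with q show False by simp
        qed
        have "x \<in> E (real_of_rat p) (real_of_rat q)" unfolding E_def using fr by simp
        with x p0 pq show False unfolding N_def by blast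
      qed
      then obtain D where D: "Limsup (at 0) ?u = ereal D"
        using lb ub by (cases "Limsup (at 0) ?u") auto
      have "(?u \<longlongrightarrow> ereal D) (at 0)"
        using tendsto_iff_Liminf_eq_Limsup[of "at (0::real)" ?u "ereal D"] eq D by simp
      then have "((\<lambda>h. s x h) \<longlongrightarrow> D) (at 0)" by simp
      then have "DERIV F x :> D" by (simp add: DERIV_def s_def)
      then have "DERIV (\<lambda>x. F x - 2 * M * x) x :> D - 2 * M"
        by (auto intro!: derivative_eq_intros)
      then have "DERIV f x :> D - 2 * M" by (simp add: F_def)
      then show False using nd by (auto simp: differentiable_def has_field_derivative_def)
    qed
  qed
qed


text \<open>On every line in the direction \<open>e\<close> the exceptional set \<open>Z\<close> is null, by the one-dimensional case.
Its measure is the average over \<open>0 \<le> t \<le> 1\<close> of the measures of its translates by \<open>- t e\<close>, and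
exchanging the two integrations shows that it is zero.\<close>

lemma lipschitz_directionally_differentiable_ae:
  fixes g :: "'a::euclidean_space \<Rightarrow> real"
  assumes g: "L-lipschitz_on UNIV g"
  shows "AE x in lborel. (\<lambda>t. g (x + t *\<^sub>R e)) differentiable (at 0)"
proof -
  define s where "s = (\<lambda>x h. (g (x + h *\<^sub>R e) - g x) / h)"
  have contg: "continuous_on UNIV g" using g by (rule lipschitz_on_continuous_on)
  have conts: "continuous_on UNIV (\<lambda>x. s x h)" if "h \<noteq> 0" for h
    unfolding s_def using that contg
    by (intro continuous_intros continuous_on_compose2[OF contg]) auto
  \<comment> \<open>Differentiability as a Cauchy criterion over all increments: each \<open>W m k\<close> is an intersection of
     closed sets, so the exceptional set is Borel.\<close>
  define W where "W = (\<lambda>m k. {x. \<forall>h h'. h \<noteq> 0 \<and> \<bar>h\<bar> < 1 / Suc k \<and> h' \<noteq> 0 \<and> \<bar>h'\<bar> < 1 / Suc k \<longrightarrow>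
                          \<bar>s x h - s x h'\<bar> \<le> 1 / Suc m})"
  define Z where "Z = - (\<Inter>m. \<Union>k. W m k)"
  have Wc: "closed (W m k)" for m k
  proof -
    have "W m k = (\<Inter>h\<in>{h. h \<noteq> 0 \<and> \<bar>h\<bar> < 1 / Suc k}. \<Inter>h'\<in>{h. h \<noteq> 0 \<and> \<bar>h\<bar> < 1 / Suc k}.
                     {x. \<bar>s x h - s x h'\<bar> \<le> 1 / Suc m})"
      by (auto simp: W_def)
    moreover have "closed {x. \<bar>s x h - s x h'\<bar> \<le> 1 / Suc m}" if "h \<noteq> 0" "h' \<noteq> 0" for h h'
      using conts[OF that(1)] conts[OF that(2)] by (intro closed_Collect_le continuous_intros)
    ultimately show ?thesis by (auto intro!: closed_INT)
  qed
  have Zb: "Z \<in> sets borel" unfolding Z_def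
    by (intro sets.compl_sets[where M=borel, simplified] borel_comp sets.countable_INT'' sets.countable_UN'' borel_closed Wc) auto
  have Zdiff: "x \<notin> Z \<longleftrightarrow> (\<lambda>t. g (x + t *\<^sub>R e)) differentiable (at 0)" for x
  proof
    assume "x \<notin> Z"
    then have c: "\<exists>k. x \<in> W m k" for m by (simp add: Z_def)
    have CZ: "\<exists>k. \<forall>h h'. h \<noteq> 0 \<and> \<bar>h\<bar> < 1 / Suc k \<and> h' \<noteq> 0 \<and> \<bar>h'\<bar> < 1 / Suc k \<longrightarrow> \<bar>s x h - s x h'\<bar> < r"
      if r: "0 < r" for r
    proof -
      obtain m where m: "1 / real (Suc m) < r" using r nat_approx_posE by metis
      obtain k where "x \<in> W m k" using c by blast
      then show ?thesis using m unfolding W_def by (intro exI[of _ k]) fastforce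
    qed
    define a where "a = (\<lambda>n. s x (1 / (real n + 2)))"
    have nk: "1 / (real n + 2) \<noteq> 0 \<and> \<bar>1 / (real n + 2)\<bar> < 1 / Suc k" if "n \<ge> k" for n k
      using that by (simp add: field_simps)
    have "Cauchy a"
      unfolding Cauchy_def dist_real_def a_def using CZ nk by metis
    then obtain D where D: "a \<longlonglongrightarrow> D" using Cauchy_convergent convergent_def by blast
    have "(s x \<longlongrightarrow> D) (at 0)"
    proof (rule tendstoI)
      fix r :: real assume "0 < r"
      then have "0 < r / 2" by simp
      from CZ[OF this] obtain k where
        k: "\<And>h h'. h \<noteq> 0 \<Longrightarrow> \<bar>h\<bar> < 1 / Suc k \<Longrightarrow> h' \<noteq> 0 \<Longrightarrow> \<bar>h'\<bar> < 1 / Suc k \<Longrightarrow> \<bar>s x h - s x h'\<bar> < r / 2"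
        by blast
      have "\<bar>s x h - D\<bar> \<le> r / 2" if h: "h \<noteq> 0" "\<bar>h\<bar> < 1 / Suc k" for h
      proof -
        have "(\<lambda>n. \<bar>s x h - a n\<bar>) \<longlonglongrightarrow> \<bar>s x h - D\<bar>" using D by (intro tendsto_intros)
        moreover have "\<bar>s x h - a n\<bar> \<le> r / 2" if "n \<ge> k" for n
          using k[OF h, of "1 / (real n + 2)"] nk[OF that] by (simp add: a_def)
        ultimately show ?thesis by (intro LIMSEQ_le_const2) auto
      qed
      then show "\<forall>\<^sub>F h in at 0. dist (s x h) D < r"
        unfolding eventually_at using \<open>0 < r\<close>
        by (intro exI[of _ "1 / Suc k"]) (force simp: dist_real_def)
    qed
    then have "DERIV (\<lambda>t. g (x + t *\<^sub>R e)) 0 :> D" by (simp add: DERIV_def s_def)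
    then show "(\<lambda>t. g (x + t *\<^sub>R e)) differentiable (at 0)"
      by (auto simp: differentiable_def has_field_derivative_def)
  next
    assume "(\<lambda>t. g (x + t *\<^sub>R e)) differentiable (at 0)"
    then obtain D where "DERIV (\<lambda>t. g (x + t *\<^sub>R e)) 0 :> D"
      using real_differentiable_def by blast
    then have D: "(s x \<longlongrightarrow> D) (at 0)" by (simp add: DERIV_def s_def[abs_def])
    have "\<exists>k. x \<in> W m k" for m
    proof -
      have "0 < 1 / (2 * real (Suc m))" by simp
      from tendstoD[OF D this] obtain d where d: "0 < d"
        "\<And>h. h \<noteq> 0 \<Longrightarrow> \<bar>h\<bar> < d \<Longrightarrow> \<bar>s x h - D\<bar> < 1 / (2 * real (Suc m))"
        unfolding eventually_at by (auto simp: dist_real_def)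
      obtain k where k: "1 / real (Suc k) < d" using d(1) nat_approx_posE by metis
      have "\<bar>s x h - s x h'\<bar> \<le> 1 / Suc m"
        if "h \<noteq> 0" "\<bar>h\<bar> < 1 / Suc k" "h' \<noteq> 0" "\<bar>h'\<bar> < 1 / Suc k" for h h'
      proof -
        have "\<bar>s x h - s x h'\<bar> \<le> \<bar>s x h - D\<bar> + \<bar>s x h' - D\<bar>" by linarith
        also have "\<dots> \<le> 1 / (2 * real (Suc m)) + 1 / (2 * real (Suc m))"
          using d(2)[of h] d(2)[of h'] that k by (intro add_mono less_imp_le) auto
        also have "\<dots> = 1 / Suc m" by (simp add: field_simps)
        finally show ?thesis .
      qed
      then show ?thesis unfolding W_def by blast
    qed
    then show "x \<notin> Z" by (simp add: Z_def)
  qed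
  have line: "AE t in lborel. x + t *\<^sub>R e \<notin> Z" for x
  proof -
    define f where "f = (\<lambda>t. g (x + t *\<^sub>R e))"
    have "(L * norm e)-lipschitz_on UNIV f"
    proof (rule lipschitz_onI)
      show "dist (f t) (f t') \<le> L * norm e * dist t t'" for t t'
        using lipschitz_onD[OF g, of "x + t *\<^sub>R e" "x + t' *\<^sub>R e"]
        by (simp add: f_def dist_norm scaleR_diff_left[symmetric] mult_ac)
      show "0 \<le> L * norm e" using lipschitz_on_nonneg[OF g] by simp
    qed
    from lipschitz_differentiable_off_null_set[OF this]
    show ?thesis
    proof (rule AE_mp, intro AE_I2 impI)
      fix t assume "f differentiable at t"
      then obtain D where D: "DERIV f t :> D" using real_differentiable_def by blast
      have "DERIV (\<lambda>r. f (t + r)) 0 :> D" using D DERIV_shift[of f D 0 t] by (simp add: add.commute)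
      then have "(\<lambda>r. f (t + r)) differentiable at 0"
        using real_differentiable_def by blast
      then show "x + t *\<^sub>R e \<notin> Z"
        unfolding Zdiff by (simp add: f_def scaleR_add_left add.assoc)
    qed
  qed
  have meas: "(\<lambda>(x, t). indicator Z (x + t *\<^sub>R e) * indicator {0..1} t :: ennreal)
                \<in> borel_measurable ((lborel :: 'a measure) \<Otimes>\<^sub>M (lborel :: real measure))"
  proof -
    have "(\<lambda>p. fst p + snd p *\<^sub>R e) \<in> ((lborel :: 'a measure) \<Otimes>\<^sub>M (lborel :: real measure)) \<rightarrow>\<^sub>M borel"
      by measurable
    then have [measurable]: "(\<lambda>p. indicator Z (fst p + snd p *\<^sub>R e) :: ennreal)
        \<in> borel_measurable ((lborel :: 'a measure) \<Otimes>\<^sub>M (lborel :: real measure))"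
      using Zb by (intro measurable_compose[OF _ borel_measurable_indicator]) auto
    show ?thesis unfolding split_beta' by measurable
  qed
  have trans: "(\<integral>\<^sup>+x. indicator Z (x + t *\<^sub>R e) \<partial>lborel) = emeasure lborel Z" for t
  proof -
    have "emeasure lborel Z = (\<integral>\<^sup>+x. indicator Z x \<partial>distr lborel borel ((+) (t *\<^sub>R e)))"
      using Zb by (simp add: lborel_distr_plus)
    also have "\<dots> = (\<integral>\<^sup>+x. indicator Z (t *\<^sub>R e + x) \<partial>lborel)"
      using Zb by (intro nn_integral_distr) auto
    finally show ?thesis by (simp add: add.commute)
  qed
  have "emeasure lborel Z = (\<integral>\<^sup>+t. emeasure lborel Z * indicator {0..1::real} t \<partial>lborel)"
    by (subst nn_integral_cmult_indicator) auto
  also have "\<dots> = (\<integral>\<^sup>+t. (\<integral>\<^sup>+x. indicator Z (x + t *\<^sub>R e) * indicator {0..1} t \<partial>lborel) \<partial>lborel)"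
  proof (rule nn_integral_cong)
    fix t :: real
    have [measurable]: "(\<lambda>x. indicator Z (x + t *\<^sub>R e) :: ennreal) \<in> borel_measurable borel"
      using Zb by (intro measurable_compose[OF _ borel_measurable_indicator]) auto
    show "emeasure lborel Z * indicator {0..1} t = (\<integral>\<^sup>+x. indicator Z (x + t *\<^sub>R e) * indicator {0..1} t \<partial>lborel)"
      by (subst nn_integral_multc) (auto simp: trans)
  qed
  also have "\<dots> = (\<integral>\<^sup>+x. (\<integral>\<^sup>+t. indicator Z (x + t *\<^sub>R e) * indicator {0..1} t \<partial>lborel) \<partial>lborel)"
    by (rule lborel_pair.Fubini'[OF meas])
  also have "\<dots> = (\<integral>\<^sup>+(x::'a). 0 \<partial>lborel)"
  proof (rule nn_integral_cong)
    fix x :: 'a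
    have "(\<integral>\<^sup>+t. indicator Z (x + t *\<^sub>R e) * indicator {0..1} t \<partial>lborel) = (\<integral>\<^sup>+(t::real). 0 \<partial>lborel)"
      by (rule nn_integral_cong_AE) (use line[of x] in \<open>auto elim!: eventually_mono\<close>)
    then show "(\<integral>\<^sup>+t. indicator Z (x + t *\<^sub>R e) * indicator {0..1} t \<partial>lborel) = (0::ennreal)" by simp
  qed
  finally have "Z \<in> null_sets lborel" using Zb by auto
  then show ?thesis
    by (rule AE_I') (auto simp: Zdiff[symmetric])
qed

lemma AE_lebesgue_on_of_lborel:
  assumes "AE x in lborel. P x" "\<Omega> \<in> sets lebesgue"
  shows "AE x in lebesgue_on \<Omega>. P x"
proof -
  have "AE x in lebesgue. P x" using assms(1) by (rule AE_completion)
  then show ?thesis using assms(2) by (subst AE_restrict_space_iff) (auto elim: eventually_mono)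
qed

text \<open>The gradient of a composition or of a linear combination is known almost everywhere only; that is
enough for measurability, as Lebesgue measure is complete.\<close>

lemma borel_measurable_AE_lebesgue_on:
  fixes f g :: "'a::euclidean_space \<Rightarrow> 'b::euclidean_space"
  assumes \<Omega>: "\<Omega> \<in> sets lebesgue" and f: "f \<in> borel_measurable (lebesgue_on \<Omega>)"
    and ae: "AE x in lebesgue_on \<Omega>. f x = g x"
  shows "g \<in> borel_measurable (lebesgue_on \<Omega>)"
proof -
  have "(\<lambda>x. if x \<in> \<Omega> then f x else 0) \<in> borel_measurable lebesgue"
    using f \<Omega> by (simp add: borel_measurable_if)
  moreover have "AE x in lebesgue. x \<in> \<Omega> \<longrightarrow> f x = g x"
    using ae \<Omega> by (subst (asm) AE_restrict_space_iff) auto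
  then have "AE x in lebesgue. (if x \<in> \<Omega> then f x else 0) = (if x \<in> \<Omega> then g x else 0)"
    by eventually_elim auto
  ultimately have "(\<lambda>x. if x \<in> \<Omega> then g x else 0) \<in> borel_measurable lebesgue"
    by (rule borel_measurable_AE)
  then show ?thesis using \<Omega> by (simp add: borel_measurable_if)
qed

definition partially_differentiable :: "(real^'n \<Rightarrow> real) \<Rightarrow> real^'n \<Rightarrow> bool" where
  "partially_differentiable \<phi> x \<longleftrightarrow> (\<forall>i. (\<lambda>t. \<phi> (x + t *\<^sub>R axis i 1)) differentiable (at 0))"

lemma partially_differentiableD:
  "partially_differentiable \<phi> x \<Longrightarrow> DERIV (\<lambda>t. \<phi> (x + t *\<^sub>R axis i 1)) 0 :> grad \<phi> x $ i"
  unfolding partially_differentiable_def grad_def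
  by (simp add: DERIV_deriv_iff_real_differentiable)

lemma grad_eqI:
  assumes "\<And>i. DERIV (\<lambda>t. \<phi> (x + t *\<^sub>R axis i 1)) 0 :> d $ i"
  shows "grad \<phi> x = d"
  unfolding grad_def vec_eq_iff using DERIV_imp_deriv[OF assms] by simp

lemma grad_linear:
  assumes "partially_differentiable \<phi> x" "partially_differentiable \<psi> x"
  shows "grad (\<lambda>x. a * \<phi> x + b * \<psi> x) x = a *\<^sub>R grad \<phi> x + b *\<^sub>R grad \<psi> x"
proof (rule grad_eqI)
  fix i
  show "DERIV (\<lambda>t. a * \<phi> (x + t *\<^sub>R axis i 1) + b * \<psi> (x + t *\<^sub>R axis i 1)) 0 :> (a *\<^sub>R grad \<phi> x + b *\<^sub>R grad \<psi> x) $ i"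
    using assms by (auto intro!: derivative_eq_intros partially_differentiableD)
qed

lemma grad_compose:
  assumes \<phi>: "partially_differentiable \<phi> x" and \<beta>: "DERIV \<beta> (\<phi> x) :> d"
  shows "grad (\<lambda>x. \<beta> (\<phi> x)) x = d *\<^sub>R grad \<phi> x"
proof (rule grad_eqI)
  fix i
  have "DERIV (\<lambda>t. \<beta> (\<phi> (x + t *\<^sub>R axis i 1))) 0 :> d * grad \<phi> x $ i"
    using \<beta> by (intro DERIV_chain2[of \<beta>] partially_differentiableD[OF \<phi>]) simp
  then show "DERIV (\<lambda>t. \<beta> (\<phi> (x + t *\<^sub>R axis i 1))) 0 :> (d *\<^sub>R grad \<phi> x) $ i" by simp
qed

lemma Lip_0_bounded:
  assumes "\<phi> \<in> Lip_0 \<Omega>"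
  shows "\<exists>b\<ge>0. \<forall>x\<in>\<Omega>. \<bar>\<phi> x\<bar> \<le> b"
proof -
  let ?S = "closure {x\<in>\<Omega>. \<phi> x \<noteq> 0}"
  obtain L where L: "L-lipschitz_on \<Omega> \<phi>" and S: "compact ?S" "?S \<subseteq> \<Omega>"
    using assms by (auto simp: Lip_0_def)
  have "continuous_on ?S \<phi>" using lipschitz_on_continuous_on[OF L] S(2) by (rule continuous_on_subset)
  then have "compact (\<phi> ` ?S)" using S(1) by (rule compact_continuous_image)
  then have "bounded (\<phi> ` ?S)" by (rule compact_imp_bounded)
  then obtain b where b: "0 < b" "\<forall>y\<in>\<phi> ` ?S. norm y \<le> b"
    unfolding bounded_pos by (elim exE conjE) (rule that)
  have "\<bar>\<phi> x\<bar> \<le> b" if "x \<in> \<Omega>" for x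
  proof (cases "\<phi> x = 0")
    case False
    then have "x \<in> ?S" using that by (intro subsetD[OF closure_subset]) simp
    then show ?thesis using b(2) by simp
  qed (use b in simp)
  then show ?thesis using b(1) by (intro exI[of _ b]) auto
qed

text \<open>Extension by zero is Lipschitz across the boundary of \<open>\<Omega>\<close> because the support has positive
distance from the complement of \<open>\<Omega>\<close>.\<close>

lemma Lip_0_extension:
  fixes \<phi> :: "real^'n \<Rightarrow> real"
  assumes \<phi>: "\<phi> \<in> Lip_0 \<Omega>" and \<Omega>: "open \<Omega>"
  shows "\<exists>L. L-lipschitz_on UNIV (\<lambda>x. if x \<in> \<Omega> then \<phi> x else 0)"
proof -
  let ?S = "closure {x\<in>\<Omega>. \<phi> x \<noteq> 0}" and ?f = "\<lambda>x. if x \<in> \<Omega> then \<phi> x else 0"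
  obtain L where L: "L-lipschitz_on \<Omega> \<phi>" and S: "compact ?S" "?S \<subseteq> \<Omega>"
    using \<phi> by (auto simp: Lip_0_def)
  obtain b where b: "0 \<le> b" "\<And>x. x \<in> \<Omega> \<Longrightarrow> \<bar>\<phi> x\<bar> \<le> b" using Lip_0_bounded[OF \<phi>] by blast
  obtain d where d: "0 < d" "\<And>x y. x \<in> ?S \<Longrightarrow> y \<in> - \<Omega> \<Longrightarrow> d \<le> dist x y"
  proof -
    have "\<exists>d>0. \<forall>x\<in>?S. \<forall>y\<in>- \<Omega>. d \<le> dist x y"
      using S \<Omega> by (intro separate_compact_closed) auto
    then show ?thesis using that by blast
  qed
  have L0: "0 \<le> L" using L by (rule lipschitz_on_nonneg)
  have mix: "\<bar>\<phi> x\<bar> \<le> b / d * dist x y" if x: "x \<in> \<Omega>" and y: "y \<notin> \<Omega>" for x y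
  proof (cases "\<phi> x = 0")
    case True then show ?thesis using b d by simp
  next
    case False
    then have "x \<in> ?S" using x by (intro subsetD[OF closure_subset]) simp
    then have "1 \<le> dist x y / d" using d y by (simp add: le_divide_eq_1)
    then have "b * 1 \<le> b * (dist x y / d)" using b(1) by (rule mult_left_mono)
    then show ?thesis using b(2)[OF x] by simp
  qed
  have "(L + b / d)-lipschitz_on UNIV ?f"
  proof (rule lipschitz_onI)
    fix x y :: "real^'n"
    have nn: "0 \<le> L * dist x y" "0 \<le> b / d * dist x y" using L0 b d by auto
    show "dist (?f x) (?f y) \<le> (L + b / d) * dist x y"
    proof (cases "x \<in> \<Omega>"; cases "y \<in> \<Omega>")
      assume "x \<in> \<Omega>" "y \<in> \<Omega>"
      then show ?thesis using lipschitz_onD[OF L, of x y] nn by (simp add: distrib_right)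
    next
      assume "x \<in> \<Omega>" "y \<notin> \<Omega>"
      then show ?thesis using mix[of x y] nn by (simp add: distrib_right)
    next
      assume "x \<notin> \<Omega>" "y \<in> \<Omega>"
      then show ?thesis using mix[of y x] nn by (simp add: distrib_right dist_commute)
    next
      assume "x \<notin> \<Omega>" "y \<notin> \<Omega>"
      then show ?thesis using nn by (simp add: distrib_right)
    qed
  qed (use L0 b d in simp)
  then show ?thesis by blast
qed

lemma Lip_0_partially_differentiable_AE:
  fixes \<phi> :: "real^'n \<Rightarrow> real"
  assumes \<phi>: "\<phi> \<in> Lip_0 \<Omega>" and \<Omega>: "open \<Omega>"
  shows "AE x in lebesgue_on \<Omega>. partially_differentiable \<phi> x"
proof -
  let ?f = "\<lambda>x. if x \<in> \<Omega> then \<phi> x else 0"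
  obtain L where "L-lipschitz_on UNIV ?f" using Lip_0_extension[OF assms] by blast
  then have "AE x in lborel. (\<lambda>t. ?f (x + t *\<^sub>R axis i 1)) differentiable (at 0)" for i
    by (rule lipschitz_directionally_differentiable_ae)
  then have "AE x in lborel. \<forall>i\<in>UNIV. (\<lambda>t. ?f (x + t *\<^sub>R axis i 1)) differentiable (at 0)"
    by (intro AE_finite_allI) auto
  then have "AE x in lebesgue_on \<Omega>. \<forall>i\<in>UNIV. (\<lambda>t. ?f (x + t *\<^sub>R axis i 1)) differentiable (at 0)"
    by (rule AE_lebesgue_on_of_lborel) (use \<Omega> in simp)
  then show ?thesis
    using AE_space
  proof eventually_elim
    case (elim x)
    then have x: "x \<in> \<Omega>" by (simp add: space_restrict_space)
    show ?case unfolding partially_differentiable_def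
    proof
      fix i
      obtain D where D: "DERIV (\<lambda>t. ?f (x + t *\<^sub>R axis i 1)) 0 :> D"
        using elim real_differentiable_def by blast
      have "continuous_on UNIV (\<lambda>t::real. x + t *\<^sub>R axis i 1)" by (intro continuous_intros)
      then have "open ((\<lambda>t::real. x + t *\<^sub>R axis i 1) -` \<Omega>)" using \<Omega> by (rule open_vimage[rotated])
      moreover have "0 \<in> (\<lambda>t::real. x + t *\<^sub>R axis i 1) -` \<Omega>" using x by simp
      ultimately have "DERIV (\<lambda>t. \<phi> (x + t *\<^sub>R axis i 1)) 0 :> D"
        using D by (elim has_field_derivative_transform_within_open) auto
      then show "(\<lambda>t. \<phi> (x + t *\<^sub>R axis i 1)) differentiable (at 0)"
        using real_differentiable_def by blast
    qed
  qed
qed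

lemma compact_closure_sub:
  fixes A K :: "'a::heine_borel set"
  assumes "compact K" "closure A \<subseteq> K"
  shows "compact (closure A)"
  using assms by (meson closed_closure compact_eq_bounded_closed bounded_subset)

lemma Lip_0_linear:
  assumes \<phi>: "\<phi> \<in> Lip_0 \<Omega>" and \<psi>: "\<psi> \<in> Lip_0 \<Omega>"
  shows "(\<lambda>x. a * \<phi> x + b * \<psi> x) \<in> Lip_0 \<Omega>"
proof -
  let ?f = "\<lambda>x. a * \<phi> x + b * \<psi> x"
  obtain L M where L: "L-lipschitz_on \<Omega> \<phi>" "M-lipschitz_on \<Omega> \<psi>"
    and S: "compact (closure {x\<in>\<Omega>. \<phi> x \<noteq> 0})" "closure {x\<in>\<Omega>. \<phi> x \<noteq> 0} \<subseteq> \<Omega>"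
           "compact (closure {x\<in>\<Omega>. \<psi> x \<noteq> 0})" "closure {x\<in>\<Omega>. \<psi> x \<noteq> 0} \<subseteq> \<Omega>"
    using assms by (auto simp: Lip_0_def)
  have "(\<bar>a\<bar> * L + \<bar>b\<bar> * M)-lipschitz_on \<Omega> ?f"
    using lipschitz_on_add[OF lipschitz_on_cmult_real[OF L(1), of a] lipschitz_on_cmult_real[OF L(2), of b]] by simp
  moreover have sub: "closure {x\<in>\<Omega>. ?f x \<noteq> 0} \<subseteq> closure {x\<in>\<Omega>. \<phi> x \<noteq> 0} \<union> closure {x\<in>\<Omega>. \<psi> x \<noteq> 0}"
    unfolding closure_Un[symmetric] by (intro closure_mono) auto
  moreover have "compact (closure {x\<in>\<Omega>. ?f x \<noteq> 0})"
    using compact_Un[OF S(1,3)] sub by (rule compact_closure_sub)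
  ultimately show ?thesis using S unfolding Lip_0_def by blast
qed

lemma Lip_0_compose:
  assumes \<phi>: "\<phi> \<in> Lip_0 \<Omega>"
    and \<beta>: "\<And>s. DERIV \<beta> s :> \<beta>' s" "continuous_on UNIV \<beta>'" "\<beta> 0 = 0"
  shows "(\<lambda>x. \<beta> (\<phi> x)) \<in> Lip_0 \<Omega>" "\<exists>D\<ge>0. \<forall>x\<in>\<Omega>. \<bar>\<beta>' (\<phi> x)\<bar> \<le> D \<and> \<bar>\<beta> (\<phi> x)\<bar> \<le> D * \<bar>\<phi> x\<bar>"
proof -
  obtain L where L: "L-lipschitz_on \<Omega> \<phi>"
    and S: "compact (closure {x\<in>\<Omega>. \<phi> x \<noteq> 0})" "closure {x\<in>\<Omega>. \<phi> x \<noteq> 0} \<subseteq> \<Omega>"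
    using assms by (auto simp: Lip_0_def)
  obtain b where b: "0 \<le> b" "\<And>x. x \<in> \<Omega> \<Longrightarrow> \<bar>\<phi> x\<bar> \<le> b" using Lip_0_bounded[OF \<phi>] by blast
  have "compact (\<beta>' ` {-b..b})"
    by (rule compact_continuous_image[OF continuous_on_subset[OF \<beta>(2)]]) auto
  then have "bounded (\<beta>' ` {-b..b})" by (rule compact_imp_bounded)
  then obtain D where D: "0 < D" "\<forall>y\<in>\<beta>' ` {-b..b}. norm y \<le> D"
    unfolding bounded_pos by (elim exE conjE) (rule that)
  have lipb: "\<bar>\<beta> s - \<beta> t\<bar> \<le> D * \<bar>s - t\<bar>" if "s \<in> {-b..b}" "t \<in> {-b..b}" for s t
    using field_differentiable_bound[of "{-b..b}" \<beta> \<beta>' D s t] \<beta>(1) D(2) that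
    by (auto intro: has_field_derivative_at_within)
  have rng: "\<phi> x \<in> {-b..b}" if "x \<in> \<Omega>" for x using b(2)[OF that] by (auto simp: abs_le_iff)
  have "(D * L)-lipschitz_on \<Omega> (\<lambda>x. \<beta> (\<phi> x))"
  proof (rule lipschitz_on_compose2[OF L])
    show "D-lipschitz_on (\<phi> ` \<Omega>) \<beta>"
      using lipb rng D(1) by (intro lipschitz_onI) (auto simp: dist_real_def)
  qed
  moreover have sub: "closure {x\<in>\<Omega>. \<beta> (\<phi> x) \<noteq> 0} \<subseteq> closure {x\<in>\<Omega>. \<phi> x \<noteq> 0}"
    using \<beta>(3) by (intro closure_mono) auto
  moreover have "compact (closure {x\<in>\<Omega>. \<beta> (\<phi> x) \<noteq> 0})"
    using S(1) sub by (rule compact_closure_sub)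
  ultimately show "(\<lambda>x. \<beta> (\<phi> x)) \<in> Lip_0 \<Omega>" using S(2) unfolding Lip_0_def by blast
  have "\<bar>\<beta>' (\<phi> x)\<bar> \<le> D \<and> \<bar>\<beta> (\<phi> x)\<bar> \<le> D * \<bar>\<phi> x\<bar>" if "x \<in> \<Omega>" for x
    using D(2) rng[OF that] lipb[of "\<phi> x" 0] b(1) \<beta>(3) by auto
  then show "\<exists>D\<ge>0. \<forall>x\<in>\<Omega>. \<bar>\<beta>' (\<phi> x)\<bar> \<le> D \<and> \<bar>\<beta> (\<phi> x)\<bar> \<le> D * \<bar>\<phi> x\<bar>"
    using D(1) by (intro exI[of _ D]) auto
qed

section \<open>Bilinear forms on Hilbert spaces with a degenerate inner product\<close>

text \<open>Pointwise operations turn pairs \<open>(u, \<nabla>u)\<close> of functions into elements of a real vector space.\<close>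

instantiation "fun" :: (type, real_vector) real_vector
begin

definition scaleR_fun :: "real \<Rightarrow> ('a \<Rightarrow> 'b) \<Rightarrow> 'a \<Rightarrow> 'b" where
  "scaleR_fun c f = (\<lambda>x. c *\<^sub>R f x)"

instance
  by intro_classes (auto simp: scaleR_fun_def fun_eq_iff scaleR_add_right scaleR_add_left)

end

text \<open>A Hilbert space whose inner product may vanish on nonzero vectors, as it does on functions that
are not identified almost everywhere. Limits are unique only up to vectors of norm zero.\<close>

locale semi_hilbert =
  fixes W :: "'a::real_vector set" and ip :: "'a \<Rightarrow> 'a \<Rightarrow> real"
  assumes subspace_W: "subspace W"
    and ip_add: "\<And>x y z. x \<in> W \<Longrightarrow> y \<in> W \<Longrightarrow> z \<in> W \<Longrightarrow> ip (x + y) z = ip x z + ip y z"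
    and ip_scale: "\<And>c x z. x \<in> W \<Longrightarrow> z \<in> W \<Longrightarrow> ip (c *\<^sub>R x) z = c * ip x z"
    and ip_commute: "\<And>x y. x \<in> W \<Longrightarrow> y \<in> W \<Longrightarrow> ip x y = ip y x"
    and ip_nonneg: "\<And>x. x \<in> W \<Longrightarrow> 0 \<le> ip x x"
    and complete: "\<And>X. (\<And>n. X n \<in> W) \<Longrightarrow>
          (\<And>e. 0 < e \<Longrightarrow> \<exists>N. \<forall>m\<ge>N. \<forall>n\<ge>N. ip (X m - X n) (X m - X n) < e) \<Longrightarrow>
          \<exists>x\<in>W. (\<lambda>n. ip (X n - x) (X n - x)) \<longlonglongrightarrow> 0"
begin

definition nrm :: "'a \<Rightarrow> real" where "nrm x = sqrt (ip x x)"

lemmas W_add = subspace_add[OF subspace_W]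
  and W_scale = subspace_scale[OF subspace_W]
  and W_diff = subspace_diff[OF subspace_W]
  and W_0 = subspace_0[OF subspace_W]

lemma ip_add_right: "x \<in> W \<Longrightarrow> y \<in> W \<Longrightarrow> z \<in> W \<Longrightarrow> ip z (x + y) = ip z x + ip z y"
  using ip_add ip_commute W_add by metis

lemma ip_scale_right: "x \<in> W \<Longrightarrow> z \<in> W \<Longrightarrow> ip z (c *\<^sub>R x) = c * ip z x"
  using ip_scale ip_commute W_scale by metis

lemma ip_diff: "x \<in> W \<Longrightarrow> y \<in> W \<Longrightarrow> z \<in> W \<Longrightarrow> ip (x - y) z = ip x z - ip y z"
  using ip_add[of x "-1 *\<^sub>R y" z] ip_scale[of y z "-1"] W_scale[of y "-1"] by simp

lemma nrm_power2: "x \<in> W \<Longrightarrow> (nrm x)\<^sup>2 = ip x x"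
  by (simp add: nrm_def ip_nonneg)

lemma nrm_nonneg: "x \<in> W \<Longrightarrow> 0 \<le> nrm x"
  by (simp add: nrm_def ip_nonneg)

lemma ip_plus_scale: 
  assumes "x \<in> W" "y \<in> W"
  shows "ip (x + t *\<^sub>R y) (x + t *\<^sub>R y) = ip x x + 2 * t * ip x y + t\<^sup>2 * ip y y"
  using assms ip_commute[of x y]
  by (simp add: ip_add ip_add_right ip_scale ip_scale_right W_add W_scale power2_eq_square algebra_simps)

lemma cauchy_schwarz:
  assumes x: "x \<in> W" and y: "y \<in> W"
  shows "\<bar>ip x y\<bar> \<le> nrm x * nrm y"
proof -
  have q: "0 \<le> ip x x + 2 * t * ip x y + t\<^sup>2 * ip y y" for t
    using ip_nonneg[of "x + t *\<^sub>R y"] x y by (simp add: ip_plus_scale W_add W_scale)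
  have "(ip x y)\<^sup>2 \<le> ip x x * ip y y"
  proof (cases "ip y y = 0")
    case True
    have "ip x y = 0"
    proof (rule ccontr)
      assume n: "ip x y \<noteq> 0"
      define t where "t = - (ip x x + 1) / (2 * ip x y)"
      have "2 * t * ip x y = - (ip x x + 1)" using n by (simp add: t_def)
      then show False using q[of t] True by simp
    qed
    then show ?thesis using True by simp
  next
    case False
    then have p: "0 < ip y y" using ip_nonneg[OF y] by simp
    define t where "t = - ip x y / ip y y"
    have "ip x x + 2 * t * ip x y + t\<^sup>2 * ip y y = ip x x - (ip x y)\<^sup>2 / ip y y"
      using p by (simp add: t_def power2_eq_square field_simps)
    then have "(ip x y)\<^sup>2 / ip y y \<le> ip x x" using q[of t] by simp
    then show ?thesis using p by (simp add: pos_divide_le_eq)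
  qed
  also have "\<dots> = (nrm x * nrm y)\<^sup>2" using x y by (simp add: power_mult_distrib nrm_power2)
  finally show ?thesis using x y by (metis abs_le_square_iff abs_of_nonneg mult_nonneg_nonneg nrm_nonneg)
qed

lemma nrm_triangle:
  assumes x: "x \<in> W" and y: "y \<in> W"
  shows "nrm (x + y) \<le> nrm x + nrm y"
proof (rule power2_le_imp_le)
  have "(nrm (x + y))\<^sup>2 = ip x x + 2 * ip x y + ip y y"
    using ip_plus_scale[OF x y, of 1] x y by (simp add: nrm_power2 W_add)
  also have "\<dots> \<le> (nrm x)\<^sup>2 + 2 * (nrm x * nrm y) + (nrm y)\<^sup>2"
    using cauchy_schwarz[OF x y] x y by (simp add: nrm_power2)
  also have "\<dots> = (nrm x + nrm y)\<^sup>2" by (simp add: power2_eq_square algebra_simps)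
  finally show "(nrm (x + y))\<^sup>2 \<le> (nrm x + nrm y)\<^sup>2" .
qed (use nrm_nonneg x y in simp)

lemma nrm_triangle_diff:
  assumes x: "x \<in> W" and y: "y \<in> W"
  shows "nrm x \<le> nrm y + nrm (x - y)"
  using nrm_triangle[of y "x - y"] assms W_diff by simp

text \<open>A minimising sequence of \<open>ip x x - 2 l x\<close> in \<open>M\<close> is Cauchy by the parallelogram law, and the
first-order condition at its limit is the representation of \<open>l\<close>. As \<open>M\<close> need not be closed, the
limit is in \<open>W\<close> only.\<close>

lemma riesz_representation:
  assumes M: "subspace M" "M \<subseteq> W"
    and l_add: "\<And>x y. x \<in> M \<Longrightarrow> y \<in> M \<Longrightarrow> l (x + y) = l x + l y"
    and l_scale: "\<And>c x. x \<in> M \<Longrightarrow> l (c *\<^sub>R x) = c * l x"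
    and l_le: "\<And>x. x \<in> M \<Longrightarrow> \<bar>l x\<bar> \<le> K * nrm x"
    and K: "0 \<le> K"
  shows "\<exists>u\<in>W. nrm u \<le> K \<and> (\<forall>x\<in>M. ip u x = l x)"
proof -
  define J where "J = (\<lambda>x. ip x x - 2 * l x)"
  have Jlow: "- K\<^sup>2 \<le> J x" if x: "x \<in> M" for x
  proof -
    have "2 * l x \<le> 2 * (K * nrm x)" using l_le[OF x] by linarith
    also have "\<dots> \<le> K\<^sup>2 + (nrm x)\<^sup>2" using sum_squares_bound[of K "nrm x"] by simp
    finally show ?thesis using x M by (simp add: J_def nrm_power2 subset_iff)
  qed
  define d where "d = Inf (J ` M)"
  have bdd: "bdd_below (J ` M)" using Jlow by (auto intro!: bdd_belowI2)
  have M0: "0 \<in> M" using M subspace_0 by blast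
  have dle: "d \<le> J x" if "x \<in> M" for x
    unfolding d_def using bdd that by (intro cInf_lower) auto
  have "\<exists>x\<in>M. J x < d + 1 / (real n + 1)" for n
  proof -
    have "Inf (J ` M) < d + 1 / (real n + 1)" by (simp add: d_def)
    then show ?thesis using cInf_lessD[of "J ` M"] M0 by blast
  qed
  then obtain X where X: "\<And>n. X n \<in> M" "\<And>n. J (X n) < d + 1 / (real n + 1)" by metis
  have XW: "X n \<in> W" for n using X M by blast
  have par: "ip (x - y) (x - y) = 2 * (J x + J y - 2 * J ((1/2) *\<^sub>R (x + y)))"
    if "x \<in> M" "y \<in> M" for x y
  proof -
    have xy: "x \<in> W" "y \<in> W" using that M by auto
    have "l ((1/2) *\<^sub>R (x + y)) = (l x + l y) / 2"
      using that M by (simp add: l_scale l_add subspace_add)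
    moreover have "ip ((1/2) *\<^sub>R (x + y)) ((1/2) *\<^sub>R (x + y)) = (ip x x + 2 * ip x y + ip y y) / 4"
      using ip_plus_scale[OF xy, of 1] xy by (simp add: ip_scale ip_scale_right W_add W_scale)
    moreover have "ip (x - y) (x - y) = ip x x - 2 * ip x y + ip y y"
      using ip_plus_scale[OF xy, of "-1"] by simp
    ultimately show ?thesis by (simp add: J_def field_simps)
  qed
  have close: "ip (X m - X n) (X m - X n) \<le> 2 / (real m + 1) + 2 / (real n + 1)" for m n
  proof -
    have "(1/2) *\<^sub>R (X m + X n) \<in> M" using X M by (intro subspace_scale subspace_add) auto
    from dle[OF this] show ?thesis using par[OF X(1) X(1), of m n] X(2)[of m] X(2)[of n] by simp
  qed
  have "\<exists>u\<in>W. (\<lambda>n. ip (X n - u) (X n - u)) \<longlonglongrightarrow> 0"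
  proof (rule complete[OF XW])
    fix e :: real assume e: "0 < e"
    obtain N :: nat where N: "4 / e < real N" using reals_Archimedean2 by blast
    have "ip (X m - X n) (X m - X n) < e" if "m \<ge> N" "n \<ge> N" for m n
    proof -
      have s: "2 / (real k + 1) < e / 2" if "k \<ge> N" for k
      proof -
        have "4 / e < real k + 1" using N that by linarith
        then show ?thesis using e by (simp add: field_simps)
      qed
      show ?thesis using close[of m n] s[OF that(1)] s[OF that(2)] by linarith
    qed
    then show "\<exists>N. \<forall>m\<ge>N. \<forall>n\<ge>N. ip (X m - X n) (X m - X n) < e" by blast
  qed
  then obtain u where u: "u \<in> W" "(\<lambda>n. ip (X n - u) (X n - u)) \<longlonglongrightarrow> 0" by blast
  have nu: "(\<lambda>n. nrm (X n - u)) \<longlonglongrightarrow> 0"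
    using tendsto_real_sqrt[OF u(2)] by (simp add: nrm_def)
  have lim: "(\<lambda>n. ip (X n) y) \<longlonglongrightarrow> ip u y" if y: "y \<in> W" for y
  proof -
    have lim0: "(\<lambda>n. nrm (X n - u) * nrm y) \<longlonglongrightarrow> 0"
      using tendsto_mult_right[OF nu, of "nrm y"] by simp
    have ev: "\<forall>\<^sub>F n in sequentially. norm (ip (X n) y - ip u y) \<le> nrm (X n - u) * nrm y"
    proof (intro always_eventually allI)
      fix n
      have "\<bar>ip (X n - u) y\<bar> \<le> nrm (X n - u) * nrm y"
        using XW u y by (intro cauchy_schwarz) (auto intro!: W_diff)
      then show "norm (ip (X n) y - ip u y) \<le> nrm (X n - u) * nrm y"
        using XW[of n] u y by (simp add: ip_diff)
    qed
    have "(\<lambda>n. ip (X n) y - ip u y) \<longlonglongrightarrow> 0"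
      using ev lim0 by (rule Lim_null_comparison)
    then show ?thesis by (simp add: LIM_zero_iff)
  qed
  have rep: "ip u m = l m" if m: "m \<in> M" for m
  proof -
    have mW: "m \<in> W" using m M by blast
    have "0 \<le> 2 * t * (ip u m - l m) + t\<^sup>2 * ip m m" for t
    proof -
      have "- (1 / (real n + 1)) \<le> 2 * t * (ip (X n) m - l m) + t\<^sup>2 * ip m m" for n
      proof -
        have tm: "t *\<^sub>R m \<in> M" using m M by (intro subspace_scale)
        then have "X n + t *\<^sub>R m \<in> M" using X(1) M by (intro subspace_add)
        from dle[OF this] have "d \<le> ip (X n) (X n) + 2 * t * ip (X n) m + t\<^sup>2 * ip m m - 2 * (l (X n) + t * l m)"
          using tm m X(1)[of n] by (simp add: J_def ip_plus_scale[OF XW mW] l_add l_scale)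
        also have "\<dots> = J (X n) + (2 * t * (ip (X n) m - l m) + t\<^sup>2 * ip m m)"
          by (simp add: J_def algebra_simps)
        finally show ?thesis using X(2)[of n] by linarith
      qed
      moreover have "(\<lambda>n. 2 * t * (ip (X n) m - l m) + t\<^sup>2 * ip m m) \<longlonglongrightarrow> 2 * t * (ip u m - l m) + t\<^sup>2 * ip m m"
        by (intro tendsto_intros lim mW)
      moreover have "(\<lambda>n. - (1 / (real n + 1))) \<longlonglongrightarrow> - 0"
        using LIMSEQ_inverse_real_of_nat by (intro tendsto_minus) (simp add: inverse_eq_divide add.commute)
      ultimately show ?thesis by (intro LIMSEQ_le[where X="\<lambda>n. - (1 / (real n + 1))"]) auto
    qed
    then have "ip u m - l m = 0" by (rule linear_term_vanishes)
    then show ?thesis by simp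
  qed
  have "nrm u \<le> K"
  proof -
    have iple: "ip u (X n) \<le> K * (nrm u + nrm (X n - u))" for n
    proof -
      have "ip u (X n) \<le> K * nrm (X n)" using rep[OF X(1)[of n]] l_le[OF X(1)[of n]] by linarith
      also have "\<dots> \<le> K * (nrm u + nrm (X n - u))"
        by (rule mult_left_mono[OF nrm_triangle_diff[OF XW u(1)] K])
      finally show ?thesis .
    qed
    have "ip (X n) u \<le> K * (nrm u + nrm (X n - u))" for n
      using iple[of n] ip_commute[OF XW u(1), of n] by linarith
    moreover have "(\<lambda>n. K * (nrm u + nrm (X n - u))) \<longlonglongrightarrow> K * (nrm u + 0)" by (intro tendsto_intros nu)
    ultimately have "ip u u \<le> K * nrm u" using lim[OF u(1)] by (intro LIMSEQ_le) auto
    then have "nrm u * nrm u \<le> K * nrm u" using nrm_power2[OF u(1)] by (simp add: power2_eq_square)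
    then show ?thesis using nrm_nonneg[OF u(1)] K by (metis mult_le_cancel_right order_le_less)
  qed
  then show ?thesis using u(1) rep by blast
qed

definition bilinear_on_W :: "('a \<Rightarrow> 'a \<Rightarrow> real) \<Rightarrow> bool" where
  "bilinear_on_W a \<longleftrightarrow>
     (\<forall>x\<in>W. \<forall>y\<in>W. \<forall>z\<in>W. a (x + y) z = a x z + a y z \<and> a z (x + y) = a z x + a z y) \<and>
     (\<forall>c. \<forall>x\<in>W. \<forall>z\<in>W. a (c *\<^sub>R x) z = c * a x z \<and> a z (c *\<^sub>R x) = c * a z x)"

lemma bilinear_on_W_scale:
  assumes "bilinear_on_W a" "x \<in> W" "z \<in> W"
  shows "a (c *\<^sub>R x) z = c * a x z" "a z (c *\<^sub>R x) = c * a z x"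
  using assms by (auto simp: bilinear_on_W_def)

lemma bilinear_on_W_add:
  assumes "bilinear_on_W a" "x \<in> W" "y \<in> W" "z \<in> W"
  shows "a (x + y) z = a x z + a y z" "a z (x + y) = a z x + a z y"
  using assms by (auto simp: bilinear_on_W_def)

lemma bilinear_on_W_diff:
  assumes "bilinear_on_W a" "x \<in> W" "y \<in> W" "z \<in> W"
  shows "a (x - y) z = a x z - a y z" "a z (x - y) = a z x - a z y"
  using bilinear_on_W_add[OF assms(1) assms(2) W_scale[OF assms(3), of "-1"] assms(4)]
    bilinear_on_W_scale[OF assms(1,3,4), of "-1"] by simp_all

lemmas bilinear_on_WD = bilinear_on_W_add bilinear_on_W_scale bilinear_on_W_diff

text \<open>The number \<open>m\<close> stands for an upper bound of the dual norm of \<open>a u\<close>. So this says that the operator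
\<open>u \<mapsto> a u\<close> into the dual space is bounded below by \<open>1 / C\<close>; \<open>right_bounded_below\<close> says the same of
its adjoint.\<close>

definition left_bounded_below :: "('a \<Rightarrow> 'a \<Rightarrow> real) \<Rightarrow> real \<Rightarrow> bool" where
  "left_bounded_below a C \<longleftrightarrow>
     (\<forall>u\<in>W. \<forall>m\<ge>0. (\<forall>y\<in>W. \<bar>a u y\<bar> \<le> m * nrm y) \<longrightarrow> nrm u \<le> C * m)"

definition right_bounded_below :: "('a \<Rightarrow> 'a \<Rightarrow> real) \<Rightarrow> real \<Rightarrow> bool" where
  "right_bounded_below a C \<longleftrightarrow>
     (\<forall>w\<in>W. \<forall>m\<ge>0. (\<forall>y\<in>W. \<bar>a y w\<bar> \<le> m * nrm y) \<longrightarrow> nrm w \<le> C * m)"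

text \<open>Let \<open>R x w\<close> mean that \<open>x\<close> represents the functional \<open>\<lambda>y. a y w\<close>. The lower bound makes \<open>l w\<close>
a function of \<open>x\<close> with \<open>|l w| \<le> C m |x|\<close>, and a representer \<open>u\<close> of this function satisfies
\<open>a u w = ip x u = l w\<close>.\<close>

lemma right_bounded_below_imp_solvable:
  assumes a: "bilinear_on_W a" and K: "0 \<le> K" "\<And>x y. x \<in> W \<Longrightarrow> y \<in> W \<Longrightarrow> \<bar>a x y\<bar> \<le> K * nrm x * nrm y"
    and C: "0 \<le> C" "right_bounded_below a C"
    and l_add: "\<And>x y. x \<in> W \<Longrightarrow> y \<in> W \<Longrightarrow> l (x + y) = l x + l y"
    and l_scale: "\<And>c x. x \<in> W \<Longrightarrow> l (c *\<^sub>R x) = c * l x"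
    and l_le: "\<And>x. x \<in> W \<Longrightarrow> \<bar>l x\<bar> \<le> m * nrm x"
    and m: "0 \<le> m"
  shows "\<exists>u\<in>W. nrm u \<le> C * m \<and> (\<forall>w\<in>W. a u w = l w)"
proof -
  define R where "R = (\<lambda>x w. \<forall>y\<in>W. ip x y = a y w)"
  define M where "M = {x\<in>W. \<exists>w\<in>W. R x w}"
  have ex: "\<exists>x\<in>W. R x w" if w: "w \<in> W" for w
  proof -
    have "\<exists>x\<in>W. nrm x \<le> K * nrm w \<and> (\<forall>y\<in>W. ip x y = a y w)"
    proof (rule riesz_representation[OF subspace_W])
      show "\<bar>a y w\<bar> \<le> K * nrm w * nrm y" if "y \<in> W" for y using K(2)[OF that w] by (simp add: mult_ac)
      show "a (x + y) w = a x w + a y w" if "x \<in> W" "y \<in> W" for x y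
        using bilinear_on_WD(1)[OF a that w] .
      show "a (c *\<^sub>R x) w = c * a x w" if "x \<in> W" for c x
        using bilinear_on_WD(3)[OF a that w] .
    qed (use w K nrm_nonneg in auto)
    then show ?thesis by (auto simp: R_def)
  qed
  have Rle: "nrm w \<le> C * nrm x" if "x \<in> W" "w \<in> W" "R x w" for x w
  proof -
    have "\<bar>a y w\<bar> \<le> nrm x * nrm y" if "y \<in> W" for y
      using cauchy_schwarz[OF \<open>x \<in> W\<close> that] \<open>R x w\<close> that by (simp add: R_def)
    then show ?thesis using C(2) that nrm_nonneg unfolding right_bounded_below_def by blast
  qed
  have Radd: "R (x + y) (w + z)" if "x \<in> W" "y \<in> W" "w \<in> W" "z \<in> W" "R x w" "R y z" for x y w z
    using that by (simp add: R_def ip_add bilinear_on_WD[OF a])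
  have Rscale: "R (c *\<^sub>R x) (c *\<^sub>R w)" if "x \<in> W" "w \<in> W" "R x w" for c x w
    using that by (simp add: R_def ip_scale bilinear_on_WD[OF a])
  have uniq: "l w = l z" if "x \<in> W" "w \<in> W" "z \<in> W" "R x w" "R x z" for x w z
  proof -
    have wz: "w - z \<in> W" using that W_diff by blast
    have "\<bar>a y (w - z)\<bar> \<le> 0 * nrm y" if "y \<in> W" for y
      using that \<open>R x w\<close> \<open>R x z\<close> \<open>w \<in> W\<close> \<open>z \<in> W\<close> by (simp add: bilinear_on_WD[OF a] R_def)
    then have "nrm (w - z) \<le> C * 0" using C(2) wz unfolding right_bounded_below_def by blast
    then have "l (w - z) = 0" using l_le[OF wz] nrm_nonneg[OF wz] by simp
    moreover have "l w = l (w - z) + l z" using l_add[OF wz that(3)] by simp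
    ultimately show ?thesis by simp
  qed
  have subM: "subspace M"
  proof (rule subspaceI)
    have "R 0 0" using ip_scale[of 0 _ 0] bilinear_on_W_scale(2)[OF a W_0, of _ 0] W_0 by (simp add: R_def)
    then show "0 \<in> M" using W_0 by (auto simp: M_def)
    show "x + y \<in> M" if "x \<in> M" "y \<in> M" for x y
      using that Radd W_add unfolding M_def by blast
    show "c *\<^sub>R x \<in> M" if "x \<in> M" for c x
      using that Rscale W_scale unfolding M_def by blast
  qed
  \<comment> \<open>By \<open>uniq\<close> the choice of \<open>w\<close> does not matter.\<close>
  define \<Lambda> where "\<Lambda> = (\<lambda>x. l (SOME w. w \<in> W \<and> R x w))"
  have \<Lambda>: "\<Lambda> x = l w" if "x \<in> W" "w \<in> W" "R x w" for x w
  proof -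
    have "(SOME w. w \<in> W \<and> R x w) \<in> W \<and> R x (SOME w. w \<in> W \<and> R x w)"
      using that by (intro someI[of "\<lambda>w. w \<in> W \<and> R x w" w]) auto
    then show ?thesis unfolding \<Lambda>_def using uniq that by blast
  qed
  have "\<exists>u\<in>W. nrm u \<le> C * m \<and> (\<forall>x\<in>M. ip u x = \<Lambda> x)"
  proof (rule riesz_representation[OF subM])
    show "M \<subseteq> W" by (auto simp: M_def)
    show "\<Lambda> (x + y) = \<Lambda> x + \<Lambda> y" if x: "x \<in> M" and y: "y \<in> M" for x y
    proof -
      obtain w z where "w \<in> W" "R x w" "z \<in> W" "R y z" "x \<in> W" "y \<in> W" using x y by (auto simp: M_def)
      then show ?thesis using \<Lambda>[of x w] \<Lambda>[of y z] \<Lambda>[of "x + y" "w + z"] Radd W_add l_add by simp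
    qed
    show "\<Lambda> (c *\<^sub>R x) = c * \<Lambda> x" if x: "x \<in> M" for c x
    proof -
      obtain w where "w \<in> W" "R x w" "x \<in> W" using x by (auto simp: M_def)
      then show ?thesis using \<Lambda>[of x w] \<Lambda>[of "c *\<^sub>R x" "c *\<^sub>R w"] Rscale W_scale l_scale by simp
    qed
    show "\<bar>\<Lambda> x\<bar> \<le> C * m * nrm x" if x: "x \<in> M" for x
    proof -
      obtain w where w: "w \<in> W" "R x w" "x \<in> W" using x by (auto simp: M_def)
      have "\<bar>l w\<bar> \<le> m * nrm w" using l_le w by blast
      also have "\<dots> \<le> m * (C * nrm x)" using Rle[OF w(3,1,2)] m by (rule mult_left_mono)
      finally show ?thesis using \<Lambda>[OF w(3,1,2)] by (simp add: mult_ac)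
    qed
  qed (use C m in simp)
  then obtain u where u: "u \<in> W" "nrm u \<le> C * m" "\<And>x. x \<in> M \<Longrightarrow> ip u x = \<Lambda> x" by blast
  have "a u w = l w" if w: "w \<in> W" for w
  proof -
    obtain x where x: "x \<in> W" "R x w" using ex[OF w] by blast
    then have "x \<in> M" using w by (auto simp: M_def)
    then have "ip u x = l w" using u(3) \<Lambda>[OF x(1) w x(2)] by simp
    then show ?thesis using x u(1) ip_commute[OF u(1) x(1)] by (simp add: R_def)
  qed
  then show ?thesis using u by blast
qed

text \<open>Let \<open>a t = ip + t B\<close>. If \<open>a t0\<close> is bounded below by \<open>1 / C\<close> on the left and \<open>|t - t0| K C < 1\<close>,
then \<open>a t\<close> is so with the same \<open>C\<close>: there is a solution \<open>u'\<close> of \<open>a t u' = a t u\<close> that obeys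
the bound, and the difference \<open>w = u - u'\<close> has norm zero, since \<open>a t w = 0\<close> gives
\<open>|w| \<le> C |t - t0| K |w|\<close>. As the admissible step does not shrink, finitely many steps lead from
\<open>t = 0\<close> to \<open>t = 1\<close>.\<close>

theorem method_of_continuity:
  assumes B: "bilinear_on_W B" and K: "0 \<le> K" "\<And>x y. x \<in> W \<Longrightarrow> y \<in> W \<Longrightarrow> \<bar>B x y\<bar> \<le> K * nrm x * nrm y"
    and C: "1 \<le> C" "\<And>t. 0 \<le> t \<Longrightarrow> t \<le> 1 \<Longrightarrow> right_bounded_below (\<lambda>x y. ip x y + t * B x y) C"
  shows "left_bounded_below (\<lambda>x y. ip x y + B x y) C"
proof -
  define a where "a = (\<lambda>t x y. ip x y + t * B x y)"
  have bil: "bilinear_on_W (a t)" for t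
    unfolding bilinear_on_W_def a_def
    by (intro conjI ballI allI)
      (simp_all only: bilinear_on_W_add[OF B] bilinear_on_W_scale[OF B] ip_add ip_add_right ip_scale ip_scale_right,
       simp_all add: algebra_simps)
  have bnd: "\<bar>a t x y\<bar> \<le> (1 + K) * nrm x * nrm y" if "0 \<le> t" "t \<le> 1" "x \<in> W" "y \<in> W" for t x y
  proof -
    have "\<bar>a t x y\<bar> \<le> \<bar>ip x y\<bar> + \<bar>t * B x y\<bar>" by (simp add: a_def)
    also have "\<bar>t * B x y\<bar> \<le> \<bar>B x y\<bar>" using that by (simp add: abs_mult mult_left_le_one_le)
    finally show ?thesis using cauchy_schwarz[OF that(3,4)] K(2)[OF that(3,4)] by (simp add: algebra_simps)
  qed
  have step: "left_bounded_below (a t) C"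
    if t0: "left_bounded_below (a t0) C" and t: "0 \<le> t" "t \<le> 1" "\<bar>t - t0\<bar> * K * C < 1" for t t0
    unfolding left_bounded_below_def
  proof (intro ballI allI impI)
    fix u m assume u: "u \<in> W" and m: "0 \<le> m" and le: "\<forall>y\<in>W. \<bar>a t u y\<bar> \<le> m * nrm y"
    have "\<exists>u'\<in>W. nrm u' \<le> C * m \<and> (\<forall>w\<in>W. a t u' w = a t u w)"
    proof (rule right_bounded_below_imp_solvable[OF bil])
      show "right_bounded_below (a t) C" using C t by (simp add: a_def)
      show "\<bar>a t x y\<bar> \<le> (1 + K) * nrm x * nrm y" if "x \<in> W" "y \<in> W" for x y
        using bnd t that by blast
      show "a t u (x + y) = a t u x + a t u y" if "x \<in> W" "y \<in> W" for x y
        using bilinear_on_WD(2)[OF bil that u] .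
      show "a t u (c *\<^sub>R x) = c * a t u x" if "x \<in> W" for c x
        using bilinear_on_WD(4)[OF bil that u] .
      show "\<bar>a t u x\<bar> \<le> m * nrm x" if "x \<in> W" for x using le that by blast
    qed (use C K m in auto)
    then obtain u' where u': "u' \<in> W" "nrm u' \<le> C * m" "\<And>w. w \<in> W \<Longrightarrow> a t u' w = a t u w" by blast
    define w where "w = u - u'"
    have wW: "w \<in> W" using u u' W_diff by (simp add: w_def)
    have "\<bar>a t0 w y\<bar> \<le> (\<bar>t - t0\<bar> * K * nrm w) * nrm y" if y: "y \<in> W" for y
    proof -
      have "a t w y = 0" using u'(3)[OF y] u u' y by (simp add: w_def bilinear_on_WD[OF bil])
      then have "a t0 w y = (t0 - t) * B w y" by (simp add: a_def algebra_simps)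
      then have "\<bar>a t0 w y\<bar> = \<bar>t - t0\<bar> * \<bar>B w y\<bar>" by (simp add: abs_mult abs_minus_commute)
      also have "\<dots> \<le> \<bar>t - t0\<bar> * (K * nrm w * nrm y)" using K(2)[OF wW y] by (rule mult_left_mono) simp
      finally show ?thesis by (simp add: mult_ac)
    qed
    moreover have "0 \<le> \<bar>t - t0\<bar> * K * nrm w" using K nrm_nonneg[OF wW] by simp
    ultimately have "nrm w \<le> C * (\<bar>t - t0\<bar> * K * nrm w)"
      using t0 wW unfolding left_bounded_below_def by blast
    then have "nrm w * (1 - \<bar>t - t0\<bar> * K * C) \<le> 0" by (simp add: algebra_simps)
    then have "nrm w = 0" using t(3) nrm_nonneg[OF wW] by (simp add: mult_le_0_iff)
    then have "nrm u \<le> nrm u'" using nrm_triangle_diff[OF u u'(1)] by (simp add: w_def)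
    then show "nrm u \<le> C * m" using u'(2) by linarith
  qed
  have base: "left_bounded_below (a 0) C"
    unfolding left_bounded_below_def
  proof (intro ballI allI impI)
    fix u m assume u: "u \<in> W" and m: "0 \<le> m" and le: "\<forall>y\<in>W. \<bar>a 0 u y\<bar> \<le> m * nrm y"
    have "nrm u * nrm u \<le> m * nrm u"
      using le u nrm_power2[OF u] by (force simp: a_def power2_eq_square)
    then have "nrm u \<le> m" using nrm_nonneg[OF u] m by (metis mult_le_cancel_right order_le_less)
    also have "\<dots> \<le> C * m" using C(1) m by (simp add: mult_le_cancel_right1)
    finally show "nrm u \<le> C * m" .
  qed
  obtain N :: nat where N: "K * C < real N" using reals_Archimedean2 by blast
  have N0: "0 < real N" using N K C by (smt (verit) mult_nonneg_nonneg)
  have "left_bounded_below (a (real j / real N)) C" if "j \<le> N" for j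
    using that
  proof (induction j)
    case 0 then show ?case using base by simp
  next
    case (Suc j)
    show ?case
    proof (rule step)
      show "left_bounded_below (a (real j / real N)) C" using Suc by simp
      have "real (Suc j) / real N - real j / real N = 1 / real N" by (simp add: field_simps add_divide_distrib)
      then show "\<bar>real (Suc j) / real N - real j / real N\<bar> * K * C < 1" using N N0 by (simp add: field_simps)
    qed (use Suc N0 in \<open>simp_all add: field_simps\<close>)
  qed
  from this[of N] N0 show ?thesis by (simp add: a_def)
qed

end

section \<open>Square-integrable functions\<close>

definition square_integrable :: "'a measure \<Rightarrow> ('a \<Rightarrow> real) \<Rightarrow> bool" where
  "square_integrable M f \<longleftrightarrow> f \<in> borel_measurable M \<and> integrable M (\<lambda>x. (f x)\<^sup>2)"

definition L2norm :: "'a measure \<Rightarrow> ('a \<Rightarrow> real) \<Rightarrow> real" where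
  "L2norm M f = sqrt (LINT x|M. (f x)\<^sup>2)"

lemma L2norm_nonneg [simp]: "0 \<le> L2norm M f"
  by (simp add: L2norm_def)

lemma L2norm_power2: "(L2norm M f)\<^sup>2 = (LINT x|M. (f x)\<^sup>2)"
  by (simp add: L2norm_def)

text \<open>The Cauchy-Schwarz inequality, by optimising \<open>t\<close> in \<open>2 |f g| \<le> t f\<^sup>2 + g\<^sup>2 / t\<close>.\<close>

lemma square_integrable_mult:
  assumes "square_integrable M f" "square_integrable M g"
  shows "integrable M (\<lambda>x. f x * g x)"
    and "\<bar>LINT x|M. f x * g x\<bar> \<le> L2norm M f * L2norm M g"
proof -
  have [measurable]: "f \<in> borel_measurable M" "g \<in> borel_measurable M"
    and i: "integrable M (\<lambda>x. (f x)\<^sup>2)" "integrable M (\<lambda>x. (g x)\<^sup>2)"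
    using assms by (auto simp: square_integrable_def)
  have amgm: "\<bar>a * b\<bar> \<le> (a\<^sup>2 + b\<^sup>2) / 2" for a b :: real
    using sum_squares_bound[of "\<bar>a\<bar>" "\<bar>b\<bar>"] by (simp add: abs_mult)
  show int: "integrable M (\<lambda>x. f x * g x)"
  proof (rule Bochner_Integration.integrable_bound[of M "\<lambda>x. ((f x)\<^sup>2 + (g x)\<^sup>2) / 2"])
    show "AE x in M. norm (f x * g x) \<le> norm (((f x)\<^sup>2 + (g x)\<^sup>2) / 2)"
      using amgm by (intro AE_I2) (simp add: abs_of_nonneg)
  qed (use i in \<open>auto intro!: integrable_divide_zero\<close>)
  define X where "X = (LINT x|M. \<bar>f x * g x\<bar>)"
  define a where "a = L2norm M f"
  define b where "b = L2norm M g"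
  have ab: "a\<^sup>2 = (LINT x|M. (f x)\<^sup>2)" "b\<^sup>2 = (LINT x|M. (g x)\<^sup>2)" "0 \<le> a" "0 \<le> b"
    by (simp_all add: a_def b_def L2norm_power2)
  have le: "2 * X \<le> t * a\<^sup>2 + b\<^sup>2 / t" if t: "0 < t" for t
  proof -
    have "2 * X = (LINT x|M. 2 * \<bar>f x * g x\<bar>)" by (simp add: X_def)
    also have "\<dots> \<le> (LINT x|M. t * (f x)\<^sup>2 + (g x)\<^sup>2 / t)"
    proof (rule integral_mono)
      fix x
      have "2 * \<bar>(sqrt t * f x) * (g x / sqrt t)\<bar> \<le> (sqrt t * f x)\<^sup>2 + (g x / sqrt t)\<^sup>2"
        using amgm[of "sqrt t * f x" "g x / sqrt t"] by simp
      then show "2 * \<bar>f x * g x\<bar> \<le> t * (f x)\<^sup>2 + (g x)\<^sup>2 / t"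
        using t by (simp add: power_mult_distrib power_divide)
    qed (use int i in auto)
    also have "\<dots> = t * a\<^sup>2 + b\<^sup>2 / t" using i by (simp add: ab)
    finally show ?thesis .
  qed
  have "X \<le> a * b"
  proof (cases "a = 0 \<or> b = 0")
    case True
    have "X \<le> 0 + e" if e: "0 < e" for e
    proof (cases "a = 0")
      case True
      define t where "t = (b\<^sup>2 + 1) / e"
      have t: "0 < t" using e by (simp add: t_def add_nonneg_pos)
      have "b\<^sup>2 / t \<le> e" using e t by (simp add: t_def field_simps add_nonneg_pos)
      then show ?thesis using le[OF t] True e by simp
    next
      case False
      then have b0: "b = 0" using \<open>a = 0 \<or> b = 0\<close> by simp
      define t where "t = e / (a\<^sup>2 + 1)"
      have p: "0 < a\<^sup>2 + 1" by (simp add: add_nonneg_pos)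
      have t: "0 < t" using e p by (simp add: t_def)
      have "t * a\<^sup>2 \<le> t * (a\<^sup>2 + 1)" using t by simp
      also have "\<dots> = e" using p by (simp add: t_def)
      finally show ?thesis using le[OF t] b0 e by simp
    qed
    then have "X \<le> 0" by (rule field_le_epsilon)
    then show ?thesis using True by auto
  next
    case False
    then have p: "0 < a" "0 < b" using ab by auto
    have "b / a * a\<^sup>2 + b\<^sup>2 / (b / a) = 2 * (a * b)" using p by (simp add: power2_eq_square field_simps)
    then show ?thesis using le[of "b / a"] p by simp
  qed
  then have X: "(LINT x|M. \<bar>f x * g x\<bar>) \<le> L2norm M f * L2norm M g" by (simp add: X_def a_def b_def)
  have "\<bar>LINT x|M. f x * g x\<bar> \<le> (LINT x|M. \<bar>f x * g x\<bar>)"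
    by (rule integral_abs_bound)
  with X show "\<bar>LINT x|M. f x * g x\<bar> \<le> L2norm M f * L2norm M g" by linarith
qed

lemma square_integrable_bound:
  assumes "square_integrable M g" "f \<in> borel_measurable M" "AE x in M. \<bar>f x\<bar> \<le> \<bar>g x\<bar>"
  shows "square_integrable M f" "L2norm M f \<le> L2norm M g"
proof -
  have g: "integrable M (\<lambda>x. (g x)\<^sup>2)" and [measurable]: "f \<in> borel_measurable M"
    using assms by (auto simp: square_integrable_def)
  have le: "AE x in M. (f x)\<^sup>2 \<le> (g x)\<^sup>2"
    using assms(3) by eventually_elim (simp add: abs_le_square_iff)
  then have "AE x in M. norm ((f x)\<^sup>2) \<le> norm ((g x)\<^sup>2)" by simp
  then have i: "integrable M (\<lambda>x. (f x)\<^sup>2)"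
    by (rule Bochner_Integration.integrable_bound[OF g, rotated]) measurable
  then show "square_integrable M f" by (simp add: square_integrable_def)
  show "L2norm M f \<le> L2norm M g"
    unfolding L2norm_def using integral_mono_AE[OF i g le] by simp
qed

lemma square_integrable_add:
  assumes "square_integrable M f" "square_integrable M g"
  shows "square_integrable M (\<lambda>x. f x + g x)" "L2norm M (\<lambda>x. f x + g x) \<le> L2norm M f + L2norm M g"
proof -
  have [measurable]: "f \<in> borel_measurable M" "g \<in> borel_measurable M"
    and i: "integrable M (\<lambda>x. (f x)\<^sup>2)" "integrable M (\<lambda>x. (g x)\<^sup>2)"
    using assms by (auto simp: square_integrable_def)
  note fg = square_integrable_mult[OF assms]
  have e: "(f x + g x)\<^sup>2 = (f x)\<^sup>2 + (g x)\<^sup>2 + 2 * (f x * g x)" for x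
    by (simp add: power2_eq_square algebra_simps)
  show "square_integrable M (\<lambda>x. f x + g x)"
    unfolding square_integrable_def e using i fg by auto
  have "(L2norm M (\<lambda>x. f x + g x))\<^sup>2 = (L2norm M f)\<^sup>2 + (L2norm M g)\<^sup>2 + 2 * (LINT x|M. f x * g x)"
    unfolding L2norm_power2 e using i fg by simp
  also have "\<dots> \<le> (L2norm M f)\<^sup>2 + (L2norm M g)\<^sup>2 + 2 * (L2norm M f * L2norm M g)"
    using fg(2) by linarith
  also have "\<dots> = (L2norm M f + L2norm M g)\<^sup>2" by (simp add: power2_eq_square algebra_simps)
  finally show "L2norm M (\<lambda>x. f x + g x) \<le> L2norm M f + L2norm M g"
    by (rule power2_le_imp_le) simp
qed

lemma square_integrable_cmult:
  assumes "square_integrable M f"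
  shows "square_integrable M (\<lambda>x. c * f x)" "L2norm M (\<lambda>x. c * f x) = \<bar>c\<bar> * L2norm M f"
  using assms by (auto simp: square_integrable_def L2norm_def power_mult_distrib real_sqrt_mult)

lemma square_integrable_le_add:
  assumes "square_integrable M g" "square_integrable M h" "f \<in> borel_measurable M"
    and "AE x in M. \<bar>f x\<bar> \<le> \<bar>g x\<bar> + \<bar>h x\<bar>"
  shows "square_integrable M f" "L2norm M f \<le> L2norm M g + L2norm M h"
proof -
  have a: "square_integrable M (\<lambda>x. \<bar>g x\<bar>)" "square_integrable M (\<lambda>x. \<bar>h x\<bar>)"
    using assms by (auto simp: square_integrable_def)
  have "AE x in M. \<bar>f x\<bar> \<le> \<bar>\<bar>g x\<bar> + \<bar>h x\<bar>\<bar>" using assms(4) by eventually_elim simp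
  note b = square_integrable_bound[OF square_integrable_add(1)[OF a] assms(3) this]
  show "square_integrable M f" by (rule b)
  show "L2norm M f \<le> L2norm M g + L2norm M h"
    using order_trans[OF b(2) square_integrable_add(2)[OF a]] by (simp add: L2norm_def)
qed

lemma nn_integral_square:
  assumes "square_integrable M f"
  shows "(\<integral>\<^sup>+x. ennreal ((f x)\<^sup>2) \<partial>M) = ennreal ((L2norm M f)\<^sup>2)"
  using assms by (simp add: square_integrable_def L2norm_power2 nn_integral_eq_integral)

lemma square_integrableI_nn:
  assumes "f \<in> borel_measurable M" "(\<integral>\<^sup>+x. ennreal ((f x)\<^sup>2) \<partial>M) \<le> ennreal (c\<^sup>2)" "0 \<le> c"
  shows "square_integrable M f" "L2norm M f \<le> c"
proof -
  have i: "integrable M (\<lambda>x. (f x)\<^sup>2)"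
    using assms by (intro integrableI_nonneg) (auto intro: order.strict_trans1)
  then show sq: "square_integrable M f" using assms by (simp add: square_integrable_def)
  have "ennreal ((L2norm M f)\<^sup>2) \<le> ennreal (c\<^sup>2)" using nn_integral_square[OF sq] assms by simp
  then show "L2norm M f \<le> c" using assms(3) by (auto intro: power2_le_imp_le)
qed

lemma L2norm_eq_0_AE:
  assumes "square_integrable M f" "L2norm M f = 0"
  shows "AE x in M. f x = 0"
proof -
  have "(LINT x|M. (f x)\<^sup>2) = 0" using assms(2) by (simp add: L2norm_def)
  then have "AE x in M. (f x)\<^sup>2 = 0"
    using assms(1) by (subst (asm) integral_nonneg_eq_0_iff_AE) (auto simp: square_integrable_def)
  then show ?thesis by simp
qed

text \<open>Bounds with one weight pass to limits with respect to another, positive weight: a subsequence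
converges almost everywhere, and Fatou's lemma applies.\<close>

lemma L2_limit_bound:
  fixes u :: "nat \<Rightarrow> 'a \<Rightarrow> real"
  assumes v: "v \<in> borel_measurable M" "AE x in M. 0 < v x"
    and lim: "\<And>n. square_integrable M (\<lambda>x. v x * (u n x - u' x))"
      "(\<lambda>n. L2norm M (\<lambda>x. v x * (u n x - u' x))) \<longlonglongrightarrow> 0"
    and w: "\<And>n. square_integrable M (\<lambda>x. w x * u n x)" "\<And>n. L2norm M (\<lambda>x. w x * u n x) \<le> c n"
      "(\<lambda>x. w x * u' x) \<in> borel_measurable M" and c: "c \<longlonglongrightarrow> b"
  shows "square_integrable M (\<lambda>x. w x * u' x)" "L2norm M (\<lambda>x. w x * u' x) \<le> b"
proof -
  have c0: "0 \<le> c n" for n using w(2)[of n] L2norm_nonneg order_trans by blast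
  have b0: "0 \<le> b" using c c0 by (intro LIMSEQ_le_const) auto
  have "(\<lambda>n. (L2norm M (\<lambda>x. v x * (u n x - u' x)))\<^sup>2) \<longlonglongrightarrow> 0\<^sup>2" by (intro tendsto_power lim)
  then have "(\<lambda>n. LINT x|M. norm ((v x * (u n x - u' x))\<^sup>2)) \<longlonglongrightarrow> 0" by (simp add: L2norm_power2)
  then obtain r :: "nat \<Rightarrow> nat" where r: "strict_mono r" "AE x in M. (\<lambda>n. (v x * (u (r n) x - u' x))\<^sup>2) \<longlonglongrightarrow> 0"
    using tendsto_L1_AE_subseq[of M "\<lambda>n x. (v x * (u n x - u' x))\<^sup>2"] lim(1)
    by (auto simp: square_integrable_def)
  have conv: "AE x in M. (\<lambda>n. ennreal ((w x * u (r n) x)\<^sup>2)) \<longlonglongrightarrow> ennreal ((w x * u' x)\<^sup>2)"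
    using r(2) v(2)
  proof eventually_elim
    case (elim x)
    have "(\<lambda>n. sqrt ((v x * (u (r n) x - u' x))\<^sup>2)) \<longlonglongrightarrow> sqrt 0" using elim by (intro tendsto_real_sqrt)
    then have "(\<lambda>n. \<bar>v x * (u (r n) x - u' x)\<bar>) \<longlonglongrightarrow> 0" by simp
    then have "(\<lambda>n. v x * (u (r n) x - u' x)) \<longlonglongrightarrow> 0" by (simp add: tendsto_rabs_zero_iff)
    then have "(\<lambda>n. v x * (u (r n) x - u' x) / v x) \<longlonglongrightarrow> 0 / v x" using elim by (intro tendsto_divide) auto
    then have "(\<lambda>n. u (r n) x - u' x) \<longlonglongrightarrow> 0" using elim by simp
    then have "(\<lambda>n. u (r n) x) \<longlonglongrightarrow> u' x" by (simp add: LIM_zero_iff)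
    then show ?case by (intro tendsto_intros)
  qed
  have "(\<integral>\<^sup>+x. ennreal ((w x * u' x)\<^sup>2) \<partial>M) = (\<integral>\<^sup>+x. liminf (\<lambda>n. ennreal ((w x * u (r n) x)\<^sup>2)) \<partial>M)"
    by (rule nn_integral_cong_AE, rule AE_mp[OF conv])
      (intro AE_I2 impI lim_imp_Liminf[symmetric] sequentially_bot)
  also have "\<dots> \<le> liminf (\<lambda>n. \<integral>\<^sup>+x. ennreal ((w x * u (r n) x)\<^sup>2) \<partial>M)"
    using w(1) by (intro nn_integral_liminf) (auto simp: square_integrable_def)
  also have "\<dots> \<le> liminf (\<lambda>n. ennreal ((c (r n))\<^sup>2))"
    using w c0 by (intro Liminf_mono always_eventually allI) (simp add: nn_integral_square power_mono ennreal_leI)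
  also have "\<dots> = ennreal (b\<^sup>2)"
    using LIMSEQ_subseq_LIMSEQ[OF c r(1)]
    by (intro lim_imp_Liminf tendsto_intros) (auto simp: o_def)
  finally have le: "(\<integral>\<^sup>+x. ennreal ((w x * u' x)\<^sup>2) \<partial>M) \<le> ennreal (b\<^sup>2)" .
  show "square_integrable M (\<lambda>x. w x * u' x)" "L2norm M (\<lambda>x. w x * u' x) \<le> b"
    using square_integrableI_nn[OF w(3) le b0] by auto
qed

lemma fast_subsequence:
  fixes d :: "nat \<Rightarrow> nat \<Rightarrow> real"
  assumes "\<And>e. 0 < e \<Longrightarrow> \<exists>N. \<forall>m\<ge>N. \<forall>n\<ge>N. d m n < e"
  obtains r :: "nat \<Rightarrow> nat" where "strict_mono r" "\<And>k m. r k \<le> m \<Longrightarrow> d m (r k) < (1/8) ^ k"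
proof -
  have "\<forall>k. \<exists>N. \<forall>m\<ge>N. \<forall>n\<ge>N. d m n < (1/8) ^ k" using assms by simp
  then obtain N where N: "\<And>k m n. N k \<le> m \<Longrightarrow> N k \<le> n \<Longrightarrow> d m n < (1/8) ^ k" by metis
  define r where "r = rec_nat (N 0) (\<lambda>k p. max (Suc p) (N (Suc k)))"
  have r: "r 0 = N 0" "r (Suc k) = max (Suc (r k)) (N (Suc k))" for k by (simp_all add: r_def)
  have "strict_mono r" by (rule strict_monoI_Suc) (simp add: r)
  moreover have "N k \<le> r k" for k by (cases k) (simp_all add: r)
  ultimately show ?thesis using that[of r] N by (meson order_refl order_trans)
qed

text \<open>The Riesz-Fischer theorem for \<open>g \<mapsto> A x (g x)\<close>, with a limit that is again of this form. Along a
subsequence the increments of \<open>A x (f n x)\<close> are of order \<open>2\<^sup>-\<^sup>k\<close> almost everywhere; the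
injective linear map \<open>A x\<close> on a finite-dimensional space is bounded below, so \<open>f\<close> itself
converges.\<close>

theorem weighted_L2_complete:
  fixes A :: "'x \<Rightarrow> 'e::euclidean_space \<Rightarrow> 'b::euclidean_space" and f :: "nat \<Rightarrow> 'x \<Rightarrow> 'e"
  assumes lin: "\<And>x. x \<in> space M \<Longrightarrow> linear (A x)"
    and inj: "AE x in M. \<forall>y. A x y = 0 \<longrightarrow> y = 0"
    and meas: "\<And>g. g \<in> borel_measurable M \<Longrightarrow> (\<lambda>x. norm (A x (g x))) \<in> borel_measurable M"
    and f: "\<And>n. f n \<in> borel_measurable M" "\<And>n. square_integrable M (\<lambda>x. norm (A x (f n x)))"
    and Cauchy: "\<And>e. 0 < e \<Longrightarrow> \<exists>N. \<forall>m\<ge>N. \<forall>n\<ge>N. (LINT x|M. (norm (A x (f m x - f n x)))\<^sup>2) < e"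
  shows "\<exists>g. g \<in> borel_measurable M \<and> square_integrable M (\<lambda>x. norm (A x (g x))) \<and>
             (\<lambda>n. LINT x|M. (norm (A x (f n x - g x)))\<^sup>2) \<longlonglongrightarrow> 0"
proof -
  have diffm: "(\<lambda>x. f m x - f n x) \<in> borel_measurable M" for m n
    using f(1)[of m] f(1)[of n] by measurable
  have sqd: "square_integrable M (\<lambda>x. norm (A x (f m x - f n x)))" for m n
  proof (rule square_integrable_le_add(1)[OF f(2)[of m] f(2)[of n] meas[OF diffm]])
    show "AE x in M. \<bar>norm (A x (f m x - f n x))\<bar> \<le> \<bar>norm (A x (f m x))\<bar> + \<bar>norm (A x (f n x))\<bar>"
      by (intro AE_I2) (simp add: linear_diff[OF lin] norm_triangle_ineq4)
  qed
  obtain r :: "nat \<Rightarrow> nat" where r: "strict_mono r"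
    "\<And>k m. r k \<le> m \<Longrightarrow> (LINT x|M. (norm (A x (f m x - f (r k) x)))\<^sup>2) < (1/8) ^ k"
    using fast_subsequence[OF Cauchy] by blast
  define h where "h = (\<lambda>k x. (norm (A x (f (r (Suc k)) x - f (r k) x)))\<^sup>2)"
  have hm [measurable]: "h k \<in> borel_measurable M" for k
    unfolding h_def by (intro borel_measurable_power meas diffm)
  have "(\<integral>\<^sup>+x. (\<Sum>k. ennreal (4 ^ k * h k x)) \<partial>M) = (\<Sum>k. \<integral>\<^sup>+x. ennreal (4 ^ k * h k x) \<partial>M)"
    by (rule nn_integral_suminf) measurable
  also have "\<dots> \<le> (\<Sum>k. ennreal ((1/2) ^ k))"
  proof (rule suminf_le)
    fix k
    have "(\<integral>\<^sup>+x. ennreal (4 ^ k * h k x) \<partial>M) = ennreal (4 ^ k) * (\<integral>\<^sup>+x. ennreal (h k x) \<partial>M)"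
      by (subst nn_integral_cmult[symmetric]) (auto simp: ennreal_mult h_def[abs_def] intro!: nn_integral_cong borel_measurable_power meas diffm)
    also have "(\<integral>\<^sup>+x. ennreal (h k x) \<partial>M) = ennreal (LINT x|M. h k x)"
      using sqd by (intro nn_integral_eq_integral) (auto simp: h_def square_integrable_def)
    also have "\<dots> \<le> ennreal ((1/8) ^ k)"
      using r(2)[of k "r (Suc k)"] r(1) unfolding h_def
      by (intro ennreal_leI) (auto simp: strict_mono_def less_imp_le)
    also have "ennreal (4 ^ k) * ennreal ((1/8) ^ k) = ennreal ((1/2) ^ k)"
      by (simp flip: ennreal_mult power_mult_distrib)
    finally show "(\<integral>\<^sup>+x. ennreal (4 ^ k * h k x) \<partial>M) \<le> ennreal ((1/2) ^ k)"
      by (simp add: mult_left_mono)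
  qed auto
  also have "\<dots> < \<infinity>"
    by (subst suminf_ennreal2) (auto intro!: summable_geometric)
  finally have "AE x in M. (\<Sum>k. ennreal (4 ^ k * h k x)) \<noteq> \<infinity>"
    by (intro nn_integral_PInf_AE) auto
  then have conv: "AE x in M. convergent (\<lambda>k. f (r k) x)"
    using inj AE_space
  proof eventually_elim
    case (elim x)
    have l: "linear (A x)" using elim lin by blast
    have "inj (A x)" using elim linear_injective_0[OF l] by blast
    then obtain B where B: "0 < B" "\<And>y. B * norm y \<le> norm (A x y)"
      using linear_inj_bounded_below_pos[OF l] by metis
    have "summable (\<lambda>k. 4 ^ k * h k x)"
      using elim by (intro summable_suminf_not_top) (auto simp: h_def)
    then have "Bseq (\<lambda>k. 4 ^ k * h k x)" using summable_LIMSEQ_zero convergent_def convergent_imp_Bseq by blast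
    then obtain c where c: "0 < c" "\<And>k. norm (4 ^ k * h k x) \<le> c" by (auto simp: Bseq_def)
    have le: "norm (f (r (Suc k)) x - f (r k) x) \<le> sqrt c / B * (1/2) ^ k" for k
    proof -
      have "(B * norm (f (r (Suc k)) x - f (r k) x))\<^sup>2 \<le> h k x"
        unfolding h_def using B by (intro power_mono) auto
      also have "h k x \<le> c * (1/4) ^ k" using c(2)[of k] by (simp add: h_def field_simps power_divide)
      also have "c * (1/4) ^ k = (sqrt c * (1/2) ^ k)\<^sup>2"
        using c(1) by (simp add: power_mult_distrib power_divide power2_eq_square flip: power_mult_distrib)
      finally have "B * norm (f (r (Suc k)) x - f (r k) x) \<le> sqrt c * (1/2) ^ k"
        using c(1) by (auto intro: power2_le_imp_le)
      then show ?thesis using B(1) by (simp add: field_simps)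
    qed
    have "summable (\<lambda>k. f (r (Suc k)) x - f (r k) x)"
    proof (rule summable_comparison_test'[where N=0])
      show "summable (\<lambda>k. sqrt c / B * (1/2) ^ k)" by (intro summable_mult summable_geometric) auto
    qed (use le in auto)
    then have "convergent (\<lambda>n. \<Sum>k<n. f (r (Suc k)) x - f (r k) x)"
      by (simp add: summable_iff_convergent)
    then have "convergent (\<lambda>n. f (r n) x - f (r 0) x)" by (simp add: sum_lessThan_telescope[of "\<lambda>k. f (r k) x"])
    then show ?case using convergent_add[OF _ convergent_const[of "f (r 0) x"]] by fastforce
  qed
  define g where "g = (\<lambda>x. lim (\<lambda>k. f (r k) x))"
  have gm: "g \<in> borel_measurable M" unfolding g_def using f(1) by (intro borel_measurable_lim_metric)
  have lim: "AE x in M. (\<lambda>k. f (r k) x) \<longlonglongrightarrow> g x"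
    using conv by eventually_elim (simp add: g_def convergent_LIMSEQ_iff)
  have dgm: "(\<lambda>x. f n x - g x) \<in> borel_measurable M" for n using f(1)[of n] gm by measurable
  have bound: "(\<integral>\<^sup>+x. ennreal ((norm (A x (f n x - g x)))\<^sup>2) \<partial>M) \<le> ennreal ((sqrt e)\<^sup>2)"
    if n: "\<And>m. m \<ge> n \<Longrightarrow> (LINT x|M. (norm (A x (f n x - f m x)))\<^sup>2) \<le> e" and e: "0 < e" for n e
  proof -
    have "AE x in M. (\<lambda>k. ennreal ((norm (A x (f n x - f (r k) x)))\<^sup>2)) \<longlonglongrightarrow> ennreal ((norm (A x (f n x - g x)))\<^sup>2)"
      using lim AE_space
    proof eventually_elim
      case (elim x)
      have "continuous_on UNIV (A x)" using lin[OF elim(2)] by (simp add: linear_continuous_on linear_conv_bounded_linear)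
      moreover have "(\<lambda>k. f n x - f (r k) x) \<longlonglongrightarrow> f n x - g x" using elim by (intro tendsto_intros)
      ultimately have "(\<lambda>k. A x (f n x - f (r k) x)) \<longlonglongrightarrow> A x (f n x - g x)"
        by (rule continuous_on_tendsto_compose) auto
      then show ?case by (intro tendsto_intros)
    qed
    note convA = this
    have "(\<integral>\<^sup>+x. ennreal ((norm (A x (f n x - g x)))\<^sup>2) \<partial>M) = (\<integral>\<^sup>+x. liminf (\<lambda>k. ennreal ((norm (A x (f n x - f (r k) x)))\<^sup>2)) \<partial>M)"
      by (rule nn_integral_cong_AE, rule AE_mp[OF convA])
        (intro AE_I2 impI lim_imp_Liminf[symmetric] sequentially_bot)
    also have "\<dots> \<le> liminf (\<lambda>k. \<integral>\<^sup>+x. ennreal ((norm (A x (f n x - f (r k) x)))\<^sup>2) \<partial>M)"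
      using sqd by (intro nn_integral_liminf) (auto simp: square_integrable_def)
    also have "\<dots> \<le> liminf (\<lambda>k. ennreal e)"
    proof (rule Liminf_mono)
      have "\<forall>\<^sub>F k in sequentially. n \<le> r k"
        using r(1) by (metis eventually_sequentially seq_suble order_trans)
      then show "\<forall>\<^sub>F k in sequentially. (\<integral>\<^sup>+x. ennreal ((norm (A x (f n x - f (r k) x)))\<^sup>2) \<partial>M) \<le> ennreal e"
      proof eventually_elim
        case (elim k)
        have "(\<integral>\<^sup>+x. ennreal ((norm (A x (f n x - f (r k) x)))\<^sup>2) \<partial>M) = ennreal (LINT x|M. (norm (A x (f n x - f (r k) x)))\<^sup>2)"
          using nn_integral_square[OF sqd] by (simp add: L2norm_power2)
        also have "\<dots> \<le> ennreal e" using n[OF elim] by (rule ennreal_leI)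
        finally show ?case .
      qed
    qed
    also have "\<dots> = ennreal ((sqrt e)\<^sup>2)" using e by (simp add: Liminf_const)
    finally show ?thesis .
  qed
  have ev: "\<exists>N. \<forall>n\<ge>N. square_integrable M (\<lambda>x. norm (A x (f n x - g x))) \<and> (LINT x|M. (norm (A x (f n x - g x)))\<^sup>2) \<le> e"
    if e: "0 < e" for e
  proof -
    obtain N where N: "\<And>m n. N \<le> m \<Longrightarrow> N \<le> n \<Longrightarrow> (LINT x|M. (norm (A x (f m x - f n x)))\<^sup>2) < e"
      using Cauchy[OF e] by blast
    have "square_integrable M (\<lambda>x. norm (A x (f n x - g x))) \<and> (LINT x|M. (norm (A x (f n x - g x)))\<^sup>2) \<le> e"
      if n: "n \<ge> N" for n
    proof -
      have "(\<integral>\<^sup>+x. ennreal ((norm (A x (f n x - g x)))\<^sup>2) \<partial>M) \<le> ennreal ((sqrt e)\<^sup>2)"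
        using N n e by (intro bound) (auto simp: less_imp_le)
      note sq = square_integrableI_nn[OF meas[OF dgm] this]
      have "(L2norm M (\<lambda>x. norm (A x (f n x - g x))))\<^sup>2 \<le> (sqrt e)\<^sup>2"
        using sq(2) e by (intro power_mono) auto
      then show ?thesis using sq(1) e by (simp add: L2norm_power2)
    qed
    then show ?thesis by blast
  qed
  obtain n0 where n0: "square_integrable M (\<lambda>x. norm (A x (f n0 x - g x)))" using ev[of 1] by auto
  have "square_integrable M (\<lambda>x. norm (A x (g x)))"
  proof (rule square_integrable_le_add(1)[OF f(2)[of n0] n0 meas[OF gm]])
    show "AE x in M. \<bar>norm (A x (g x))\<bar> \<le> \<bar>norm (A x (f n0 x))\<bar> + \<bar>norm (A x (f n0 x - g x))\<bar>"
    proof (rule AE_I2)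
      fix x assume x: "x \<in> space M"
      have "A x (g x) = A x (f n0 x) - A x (f n0 x - g x)" by (simp add: linear_diff[OF lin[OF x]])
      then show "\<bar>norm (A x (g x))\<bar> \<le> \<bar>norm (A x (f n0 x))\<bar> + \<bar>norm (A x (f n0 x - g x))\<bar>"
        by (metis abs_norm_cancel norm_triangle_ineq4)
    qed
  qed
  moreover have "(\<lambda>n. LINT x|M. (norm (A x (f n x - g x)))\<^sup>2) \<longlonglongrightarrow> 0"
  proof (rule LIMSEQ_I)
    fix e :: real assume e: "0 < e"
    then obtain N where N: "\<And>n. n \<ge> N \<Longrightarrow> (LINT x|M. (norm (A x (f n x - g x)))\<^sup>2) \<le> e / 2"
      using ev[of "e / 2"] by auto
    have "norm ((LINT x|M. (norm (A x (f n x - g x)))\<^sup>2) - 0) < e" if "n \<ge> N" for n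
      using N[OF that] e by (simp add: abs_of_nonneg integral_nonneg_AE)
    then show "\<exists>no. \<forall>n\<ge>no. norm ((LINT x|M. (norm (A x (f n x - g x)))\<^sup>2) - 0) < e" by blast
  qed
  ultimately show ?thesis using gm by blast
qed

section \<open>Exponentially integrable multipliers\<close>

lemma exp_linear_le_exp_powr:
  fixes c r \<eta> :: real
  assumes c: "0 \<le> c" and r: "1 < r" and \<eta>: "0 < \<eta>"
  shows "\<exists>C\<ge>0. \<forall>y\<ge>0. exp (c * y) \<le> \<eta> * exp (y powr r) + C"
proof -
  define Y where "Y = max 1 ((c + \<bar>ln \<eta>\<bar>) powr (1 / (r - 1)))"
  have "exp (c * y) \<le> \<eta> * exp (y powr r) + exp (c * Y)" if y: "0 \<le> y" for y
  proof (cases "y \<le> Y")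
    case True
    then have "exp (c * y) \<le> exp (c * Y)" using c by (simp add: mult_left_mono)
    moreover have "0 \<le> \<eta> * exp (y powr r)" using \<eta> by simp
    ultimately show ?thesis by linarith
  next
    case False
    then have y1: "1 \<le> y" and yY: "(c + \<bar>ln \<eta>\<bar>) powr (1 / (r - 1)) \<le> y"
      by (auto simp: Y_def)
    have "c + \<bar>ln \<eta>\<bar> = ((c + \<bar>ln \<eta>\<bar>) powr (1 / (r - 1))) powr (r - 1)"
      using c r by (simp add: powr_powr)
    also have "\<dots> \<le> y powr (r - 1)" using yY r by (intro powr_mono2) auto
    finally have "y * (c + \<bar>ln \<eta>\<bar>) \<le> y * y powr (r - 1)" using y1 by (intro mult_left_mono) auto
    also have "\<dots> = y powr r" using y1 by (simp add: powr_diff)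
    finally have 1: "y * c + y * \<bar>ln \<eta>\<bar> \<le> y powr r" by (simp add: distrib_left)
    have "\<bar>ln \<eta>\<bar> \<le> y * \<bar>ln \<eta>\<bar>" using y1 by (simp add: mult_le_cancel_right1)
    with 1 have "c * y - ln \<eta> \<le> y powr r" by (simp add: mult.commute)
    then have "exp (c * y - ln \<eta>) \<le> exp (y powr r)" by simp
    then have "exp (c * y) \<le> \<eta> * exp (y powr r)" using \<eta> by (simp add: exp_diff field_simps)
    then show ?thesis by (smt (verit) exp_gt_zero)
  qed
  then show ?thesis by (intro exI[of _ "exp (c * Y)"]) auto
qed

text \<open>If \<open>h\<^sup>2 \<le> \<eta> log(e + s)\<^sup>\<sigma>\<close>, the first term on the right suffices. Otherwise \<open>s\<close> is at most
\<open>exp(c h\<^sup>2\<^sup>/\<^sup>\<sigma>)\<close>, and \<open>h\<^sup>2 exp(2 c h\<^sup>2\<^sup>/\<^sup>\<sigma>)\<close> is of lower order than the exponential on the right,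
because \<open>lam < 1\<close> makes its exponent larger than \<open>2 / \<sigma>\<close>. The factor \<open>\<eta>\<close> can therefore be
as small as desired.\<close>

lemma young_inequality_with_gain:
  fixes \<sigma> lam \<eta> :: real
  assumes \<sigma>: "0 < \<sigma>" and lam: "0 < lam" "lam < 1" and \<eta>: "0 < \<eta>"
  shows "\<exists>C\<ge>0. \<forall>h\<ge>0. \<forall>s\<ge>0. h\<^sup>2 * s\<^sup>2 \<le> \<eta> * (young_A \<sigma> s + exp (h powr (2 / (lam * \<sigma>)))) + C"
proof -
  define c where "c = \<eta> powr (- 1 / \<sigma>)"
  define p where "p = 2 / \<sigma>"
  have p: "0 < p" using \<sigma> by (simp add: p_def)
  have c: "0 < c" using \<eta> by (simp add: c_def)
  obtain C where C: "0 \<le> C" "\<And>y. 0 \<le> y \<Longrightarrow> exp ((2 * c + 2 / p) * y) \<le> \<eta> * exp (y powr (1 / lam)) + C"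
    using exp_linear_le_exp_powr[of "2 * c + 2 / p" "1 / lam" \<eta>] c p lam \<eta> by auto
  have "h\<^sup>2 * s\<^sup>2 \<le> \<eta> * (young_A \<sigma> s + exp (h powr (2 / (lam * \<sigma>)))) + (C + exp (2 * c))"
    if h: "0 \<le> h" and s: "0 \<le> s" for h s
  proof -
    define l where "l = ln (exp 1 + s)"
    have e1: "1 < exp (1::real)" using exp_gt_one by simp
    have l1: "1 \<le> l" using s by (simp add: l_def ln_ge_iff add_pos_nonneg)
    have A0: "0 \<le> \<eta> * young_A \<sigma> s" using \<eta> by (simp add: young_A_def)
    have E0: "0 \<le> \<eta> * exp (h powr (2 / (lam * \<sigma>)))" using \<eta> by simp
    show ?thesis
    proof (cases "h\<^sup>2 \<le> \<eta> * l powr \<sigma>")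
      case True
      then have "h\<^sup>2 * s\<^sup>2 \<le> \<eta> * l powr \<sigma> * s\<^sup>2" by (intro mult_right_mono) auto
      also have "\<dots> = \<eta> * young_A \<sigma> s" by (simp add: young_A_def l_def)
      finally have "h\<^sup>2 * s\<^sup>2 \<le> \<eta> * young_A \<sigma> s" .
      moreover have "0 \<le> exp (2 * c)" by simp
      ultimately show ?thesis using E0 C(1) unfolding distrib_left by linarith
    next
      case False
      then have hpos: "0 < h" using h \<eta> l1 by (cases "h = 0") auto
      have "l powr \<sigma> < h\<^sup>2 / \<eta>" using False \<eta> by (simp add: field_simps)
      then have "(l powr \<sigma>) powr (1 / \<sigma>) \<le> (h\<^sup>2 / \<eta>) powr (1 / \<sigma>)" using \<sigma> by (intro powr_mono2) auto
      moreover have "(l powr \<sigma>) powr (1 / \<sigma>) = l" using l1 \<sigma> by (simp add: powr_powr)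
      moreover have "(h\<^sup>2 / \<eta>) powr (1 / \<sigma>) = c * h powr p"
      proof -
        have "h\<^sup>2 = h powr 2" using hpos by simp
        then have 1: "(h\<^sup>2) powr (1 / \<sigma>) = h powr p" by (simp only: powr_powr) (simp add: p_def)
        have "(h\<^sup>2 / \<eta>) powr (1 / \<sigma>) = (h\<^sup>2) powr (1 / \<sigma>) / \<eta> powr (1 / \<sigma>)"
          by (rule powr_divide)
        also have "\<dots> = c * h powr p"
          unfolding 1 c_def using \<eta> by (simp add: powr_minus_divide)
        finally show ?thesis .
      qed
      ultimately have l: "l \<le> c * h powr p" by simp
      have "s \<le> exp l" using s e1 by (simp add: l_def add_pos_nonneg)
      also have "\<dots> \<le> exp (c * h powr p)" using l by simp
      finally have "s\<^sup>2 \<le> (exp (c * h powr p))\<^sup>2" using s by (intro power_mono) auto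
      also have "\<dots> = exp (2 * c * h powr p)" by (simp add: exp_double[symmetric] mult.assoc)
      finally have s2: "s\<^sup>2 \<le> exp (2 * c * h powr p)" .
      have main: "h\<^sup>2 * exp (2 * c * h powr p) \<le> \<eta> * exp (h powr (2 / (lam * \<sigma>))) + (C + exp (2 * c))"
      proof (cases "1 \<le> h")
        case True
        have "ln h \<le> h powr p / p" using True p by (rule ln_powr_bound)
        then have "2 * ln h \<le> 2 / p * h powr p" by (simp add: field_simps)
        then have "exp (2 * ln h) \<le> exp (2 / p * h powr p)" by simp
        moreover have "exp (2 * ln h) = h\<^sup>2" using hpos by (simp add: exp_double)
        ultimately have "h\<^sup>2 * exp (2 * c * h powr p) \<le> exp (2 / p * h powr p) * exp (2 * c * h powr p)"
          by (intro mult_right_mono) auto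
        also have "\<dots> = exp ((2 * c + 2 / p) * h powr p)" by (simp add: exp_add[symmetric] algebra_simps)
        also have "\<dots> \<le> \<eta> * exp ((h powr p) powr (1 / lam)) + C" by (rule C(2)) simp
        also have "(h powr p) powr (1 / lam) = h powr (2 / (lam * \<sigma>))"
          by (simp add: powr_powr p_def mult.commute)
        finally show ?thesis by (smt (verit) exp_gt_zero)
      next
        case False
        then have "h powr p \<le> 1" using h p by (intro powr_le1) auto
        then have "exp (2 * c * h powr p) \<le> exp (2 * c)" using c by (simp add: mult_left_le)
        moreover have "h\<^sup>2 \<le> 1" using False h by (simp add: power_le_one)
        ultimately have "h\<^sup>2 * exp (2 * c * h powr p) \<le> 1 * exp (2 * c)" by (intro mult_mono) auto
        then show ?thesis using E0 C(1) by linarith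
      qed
      have "h\<^sup>2 * s\<^sup>2 \<le> h\<^sup>2 * exp (2 * c * h powr p)" using s2 by (intro mult_left_mono) auto
      with main A0 show ?thesis by (simp add: distrib_left)
    qed
  qed
  then show ?thesis using C(1) by (intro exI[of _ "C + exp (2 * c)"]) auto
qed

lemma square_le_young_A:
  assumes "0 < \<sigma>" "0 \<le> s"
  shows "s\<^sup>2 \<le> young_A \<sigma> s"
proof -
  have "1 \<le> ln (exp 1 + s)" using assms by (simp add: ln_ge_iff add_pos_nonneg)
  then have "1 \<le> ln (exp 1 + s) powr \<sigma>" using assms by (simp add: ge_one_powr_ge_zero)
  then show ?thesis unfolding young_A_def by (simp add: mult_le_cancel_left1)
qed

lemma young_A_measurable [measurable]:
  assumes [measurable]: "f \<in> borel_measurable M"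
  shows "(\<lambda>x. young_A \<sigma> (f x)) \<in> borel_measurable M"
  unfolding young_A_def by measurable

lemma orlicz_norm_less_iff:
  "orlicz_norm \<Phi> v \<Omega> f < c \<longleftrightarrow>
     (\<exists>l>0. ennreal l < c \<and> (\<integral>\<^sup>+x. ennreal (\<Phi> (norm (f x) / l) * v x) \<partial>lebesgue_on \<Omega>) \<le> 1)"
  unfolding orlicz_norm_def Inf_less_iff by auto

text \<open>The infimum in the Luxemburg norm need not be attained, so bounds are proved for every number
above it.\<close>

lemma le_of_all_greater_squares:
  fixes a c N :: real
  assumes "\<And>N'. N < N' \<Longrightarrow> a \<le> N'\<^sup>2 * c"
  shows "a \<le> N\<^sup>2 * c"
proof -
  have "((\<lambda>x. x\<^sup>2 * c) \<longlongrightarrow> N\<^sup>2 * c) (at_right N)"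
    by (intro tendsto_intros tendsto_ident_at)
  moreover have "eventually (\<lambda>x. a \<le> x\<^sup>2 * c) (at_right N)"
    using assms by (simp add: eventually_at_right_less eventually_at_filter)
  ultimately show ?thesis by (rule tendsto_lowerbound) simp
qed

text \<open>Integrate the preceding inequality with \<open>s = |\<phi>| / l\<^sub>0\<close> over \<open>E\<close>. The constant \<open>\<eta>\<close> is arbitrary and
the other one multiplies the \<open>v\<close>-measure of \<open>E\<close>, so multiplication by \<open>h\<close> is small in \<open>L\<^sup>2(v)\<close>
on sets of small measure.\<close>

lemma orlicz_multiplier_bound:
  fixes \<Omega> :: "(real^'n) set" and h :: "real^'n \<Rightarrow> real"
  assumes v: "is_weight \<Omega> v" "integrable (lebesgue_on \<Omega>) v"
    and \<sigma>: "0 < \<sigma>" and lam: "0 < lam" "lam < 1"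
    and h [measurable]: "h \<in> borel_measurable (lebesgue_on \<Omega>)"
    and h0: "\<And>x. 0 \<le> h x"
    and l: "0 < l" "(\<integral>\<^sup>+x. ennreal (young_C lam \<sigma> (h x / l) * v x) \<partial>lebesgue_on \<Omega>) \<le> 1"
    and \<eta>: "0 < \<eta>"
  shows "\<exists>C\<ge>0. \<forall>\<phi> N E. \<phi> \<in> borel_measurable (lebesgue_on \<Omega>) \<longrightarrow> 0 \<le> N \<longrightarrow>
            orlicz_norm (young_A \<sigma>) v \<Omega> \<phi> \<le> ennreal N \<longrightarrow> E \<in> sets (lebesgue_on \<Omega>) \<longrightarrow>
            integrable (lebesgue_on \<Omega>) (\<lambda>x. indicator E x * ((h x)\<^sup>2 * (\<phi> x)\<^sup>2 * v x)) \<and>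
            (LINT x|lebesgue_on \<Omega>. indicator E x * ((h x)\<^sup>2 * (\<phi> x)\<^sup>2 * v x))
              \<le> N\<^sup>2 * (\<eta> + C * (LINT x|lebesgue_on \<Omega>. indicator E x * v x))"
proof -
  let ?M = "lebesgue_on \<Omega>"
  have sp: "space ?M = \<Omega>" by (simp add: space_restrict_space)
  have vm [measurable]: "v \<in> borel_measurable ?M" and v0: "\<And>x. x \<in> \<Omega> \<Longrightarrow> 0 \<le> v x"
    using v(1) by (auto simp: is_weight_def)
  define V where "V = (LINT x|?M. v x)"
  have V0: "0 \<le> V" unfolding V_def using v0 by (intro integral_nonneg_AE AE_I2) (simp add: sp)
  have V: "(\<integral>\<^sup>+x. ennreal (v x) \<partial>?M) = ennreal V"
    unfolding V_def using v v0 by (intro nn_integral_eq_integral) (auto simp: sp)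
  \<comment> \<open>The integrals of \<open>young_A\<close>, \<open>young_C\<close> and \<open>v\<close> contribute \<open>1 + 1 + V\<close>.\<close>
  define \<eta>' where "\<eta>' = \<eta> / (l\<^sup>2 * (2 + V))"
  have \<eta>': "0 < \<eta>'" using \<eta> l V0 by (simp add: \<eta>'_def)
  define p where "p = 2 / (lam * \<sigma>)"
  obtain C0 where C0: "0 \<le> C0"
    "\<And>h s. 0 \<le> h \<Longrightarrow> 0 \<le> s \<Longrightarrow> h\<^sup>2 * s\<^sup>2 \<le> \<eta>' * (young_A \<sigma> s + exp (h powr p)) + C0"
    using young_inequality_with_gain[OF \<sigma> lam \<eta>'] unfolding p_def by blast
  define C where "C = l\<^sup>2 * C0"
  have C: "0 \<le> C" using C0 by (simp add: C_def)
  have "integrable ?M (\<lambda>x. indicator E x * ((h x)\<^sup>2 * (\<phi> x)\<^sup>2 * v x)) \<and>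
        (LINT x|?M. indicator E x * ((h x)\<^sup>2 * (\<phi> x)\<^sup>2 * v x)) \<le> N\<^sup>2 * (\<eta> + C * (LINT x|?M. indicator E x * v x))"
    if \<phi>m [measurable]: "\<phi> \<in> borel_measurable ?M" and N: "0 \<le> N" "orlicz_norm (young_A \<sigma>) v \<Omega> \<phi> \<le> ennreal N"
      and Em [measurable]: "E \<in> sets ?M" for \<phi> :: "real^'n \<Rightarrow> real" and N E
  proof -
    define W where "W = (LINT x|?M. indicator E x * v x)"
    let ?g = "\<lambda>x. indicator E x * ((h x)\<^sup>2 * (\<phi> x)\<^sup>2 * v x)"
    have iE: "integrable ?M (\<lambda>x. indicator E x * v x)"
      using integrable_real_mult_indicator[OF Em v(2)] by (simp add: mult.commute)
    have W0: "0 \<le> W" unfolding W_def using v0 by (intro integral_nonneg_AE AE_I2) (auto simp: sp)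
    have W: "(\<integral>\<^sup>+x. ennreal (indicator E x * v x) \<partial>?M) = ennreal W"
      unfolding W_def using iE v0 by (intro nn_integral_eq_integral) (auto simp: sp)
    have key: "(\<integral>\<^sup>+x. ennreal (?g x) \<partial>?M) \<le> ennreal (N'\<^sup>2 * (\<eta> + C * W))" if N': "N < N'" for N'
    proof -
      have "orlicz_norm (young_A \<sigma>) v \<Omega> \<phi> < ennreal N'" using N N' by (auto intro: order.strict_trans1 ennreal_lessI)
      then obtain l0 where l0: "0 < l0" "ennreal l0 < ennreal N'"
        "(\<integral>\<^sup>+x. ennreal (young_A \<sigma> (norm (\<phi> x) / l0) * v x) \<partial>?M) \<le> 1"
        unfolding orlicz_norm_less_iff by blast
      have l0N: "l0 \<le> N'" using l0 by (simp add: ennreal_less_iff)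
      have "?g x \<le> (l * l0)\<^sup>2 * (\<eta>' * (young_A \<sigma> (norm (\<phi> x) / l0) * v x + young_C lam \<sigma> (h x / l) * v x + v x) + C0 * (indicator E x * v x))"
        if x: "x \<in> space ?M" for x
      proof -
        have vx: "0 \<le> v x" using v0 x by (simp add: sp)
        have C1: "exp ((h x / l) powr p) = young_C lam \<sigma> (h x / l) + 1" by (simp add: young_C_def p_def)
        have "(h x)\<^sup>2 * (\<phi> x)\<^sup>2 = (l * l0)\<^sup>2 * ((h x / l)\<^sup>2 * (norm (\<phi> x) / l0)\<^sup>2)"
          using l l0 by (simp add: power_mult_distrib power_divide)
        also have "(h x / l)\<^sup>2 * (norm (\<phi> x) / l0)\<^sup>2 \<le> \<eta>' * (young_A \<sigma> (norm (\<phi> x) / l0) + exp ((h x / l) powr p)) + C0"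
          using h0 l l0 by (intro C0(2)) auto
        finally have 1: "(h x)\<^sup>2 * (\<phi> x)\<^sup>2 \<le> (l * l0)\<^sup>2 * (\<eta>' * (young_A \<sigma> (norm (\<phi> x) / l0) + young_C lam \<sigma> (h x / l) + 1) + C0)"
          by (simp add: C1 mult_left_mono add.assoc)
        have nn: "0 \<le> young_A \<sigma> (norm (\<phi> x) / l0) * v x + young_C lam \<sigma> (h x / l) * v x + v x"
          using vx by (auto simp: young_A_def young_C_def intro!: add_nonneg_nonneg mult_nonneg_nonneg)
        show ?thesis
        proof (cases "x \<in> E")
          case True
          have "(h x)\<^sup>2 * (\<phi> x)\<^sup>2 * v x \<le> (l * l0)\<^sup>2 * (\<eta>' * (young_A \<sigma> (norm (\<phi> x) / l0) + young_C lam \<sigma> (h x / l) + 1) + C0) * v x"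
            using 1 vx by (rule mult_right_mono)
          then show ?thesis using True by (simp add: algebra_simps)
        next
          case False
          then show ?thesis using nn \<eta>' by simp
        qed
      qed
      then have "(\<integral>\<^sup>+x. ennreal (?g x) \<partial>?M) \<le> (\<integral>\<^sup>+x. ennreal ((l * l0)\<^sup>2 * (\<eta>' * (young_A \<sigma> (norm (\<phi> x) / l0) * v x + young_C lam \<sigma> (h x / l) * v x + v x) + C0 * (indicator E x * v x))) \<partial>?M)"
        by (intro nn_integral_mono ennreal_leI)
      also have "\<dots> = (\<integral>\<^sup>+x. ennreal ((l * l0)\<^sup>2) * (ennreal \<eta>' * (ennreal (young_A \<sigma> (norm (\<phi> x) / l0) * v x) + ennreal (young_C lam \<sigma> (h x / l) * v x) + ennreal (v x)) + ennreal C0 * ennreal (indicator E x * v x)) \<partial>?M)"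
      proof (intro nn_integral_cong)
        fix x assume x: "x \<in> space ?M"
        have vx: "0 \<le> v x" using v0 x by (simp add: sp)
        have "0 \<le> young_A \<sigma> (norm (\<phi> x) / l0)" "0 \<le> young_C lam \<sigma> (h x / l)" "0 \<le> \<eta>'"
          using \<eta>' by (auto simp: young_A_def young_C_def)
        then show "ennreal ((l * l0)\<^sup>2 * (\<eta>' * (young_A \<sigma> (norm (\<phi> x) / l0) * v x + young_C lam \<sigma> (h x / l) * v x + v x) + C0 * (indicator E x * v x)))
          = ennreal ((l * l0)\<^sup>2) * (ennreal \<eta>' * (ennreal (young_A \<sigma> (norm (\<phi> x) / l0) * v x) + ennreal (young_C lam \<sigma> (h x / l) * v x) + ennreal (v x)) + ennreal C0 * ennreal (indicator E x * v x))"
          using vx C0(1) by (simp add: ennreal_mult ennreal_plus)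
      qed
      also have "\<dots> = ennreal ((l * l0)\<^sup>2) * (ennreal \<eta>' * ((\<integral>\<^sup>+x. ennreal (young_A \<sigma> (norm (\<phi> x) / l0) * v x) \<partial>?M) + (\<integral>\<^sup>+x. ennreal (young_C lam \<sigma> (h x / l) * v x) \<partial>?M) + (\<integral>\<^sup>+x. ennreal (v x) \<partial>?M)) + ennreal C0 * (\<integral>\<^sup>+x. ennreal (indicator E x * v x) \<partial>?M))"
        unfolding young_C_def by (simp add: nn_integral_cmult nn_integral_add)
      also have "\<dots> \<le> ennreal ((l * l0)\<^sup>2) * (ennreal \<eta>' * (1 + 1 + ennreal V) + ennreal C0 * ennreal W)"
        unfolding V W using l0(3) l(2) by (intro mult_left_mono add_mono order_refl) auto
      also have "\<dots> = ennreal ((l * l0)\<^sup>2 * (\<eta>' * (1 + 1 + V) + C0 * W))"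
      proof -
        have "1 + 1 + ennreal V = ennreal (1 + 1 + V)"
          using V0 by (simp add: ennreal_plus)
        then show ?thesis using \<eta>' V0 W0 C0(1) by (simp add: ennreal_mult ennreal_plus)
      qed
      also have "(l * l0)\<^sup>2 * (\<eta>' * (1 + 1 + V) + C0 * W) = l0\<^sup>2 * (l\<^sup>2 * \<eta>' * (2 + V) + C * W)"
        by (simp add: power_mult_distrib C_def algebra_simps)
      also have "l\<^sup>2 * \<eta>' * (2 + V) = \<eta>" using l V0 by (simp add: \<eta>'_def)
      also have "ennreal (l0\<^sup>2 * (\<eta> + C * W)) \<le> ennreal (N'\<^sup>2 * (\<eta> + C * W))"
        using l0 l0N \<eta> C W0 by (intro ennreal_leI mult_right_mono power_mono) auto
      finally show ?thesis .
    qed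
    have g0: "0 \<le> ?g x" if "x \<in> space ?M" for x using that v0 by (simp add: sp)
    have int: "integrable ?M ?g"
    proof (rule integrableI_nonneg)
      show "AE x in ?M. 0 \<le> ?g x" using g0 by (intro AE_I2)
      show "(\<integral>\<^sup>+x. ennreal (?g x) \<partial>?M) < \<infinity>" using key[of "N + 1"] by (auto intro: order.strict_trans1)
    qed measurable
    moreover have "(LINT x|?M. ?g x) \<le> N\<^sup>2 * (\<eta> + C * W)"
    proof (rule le_of_all_greater_squares)
      fix N' assume "N < N'"
      then have "ennreal (LINT x|?M. ?g x) \<le> ennreal (N'\<^sup>2 * (\<eta> + C * W))"
        using key int g0 by (subst nn_integral_eq_integral[symmetric]) (auto intro!: AE_I2)
      then show "(LINT x|?M. ?g x) \<le> N'\<^sup>2 * (\<eta> + C * W)" using \<eta> C W0 by (simp add: ennreal_le_iff)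
    qed
    ultimately show ?thesis by (simp add: W_def)
  qed
  then show ?thesis using C by (intro exI[of _ C]) blast
qed

lemma orlicz_A_imp_L2_bound:
  fixes \<Omega> :: "(real^'n) set" and \<phi> :: "real^'n \<Rightarrow> real"
  assumes v: "is_weight \<Omega> v" and \<sigma>: "0 < \<sigma>"
    and \<phi>: "\<phi> \<in> borel_measurable (lebesgue_on \<Omega>)" "integrable (lebesgue_on \<Omega>) (\<lambda>x. (\<phi> x)\<^sup>2 * v x)"
    and N: "0 \<le> N" "orlicz_norm (young_A \<sigma>) v \<Omega> \<phi> \<le> ennreal N"
  shows "(LINT x|lebesgue_on \<Omega>. (\<phi> x)\<^sup>2 * v x) \<le> N\<^sup>2"
proof -
  let ?M = "lebesgue_on \<Omega>"
  have sp: "space ?M = \<Omega>" by (simp add: space_restrict_space)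
  note \<phi>(1) [measurable]
  have vm [measurable]: "v \<in> borel_measurable ?M" and v0: "\<And>x. x \<in> \<Omega> \<Longrightarrow> 0 \<le> v x"
    using v(1) by (auto simp: is_weight_def)
  have g0: "AE x in ?M. 0 \<le> (\<phi> x)\<^sup>2 * v x" using v0 by (intro AE_I2) (simp add: sp)
  have "(LINT x|?M. (\<phi> x)\<^sup>2 * v x) \<le> N\<^sup>2 * 1"
  proof (rule le_of_all_greater_squares)
    fix N' assume N': "N < N'"
    have "orlicz_norm (young_A \<sigma>) v \<Omega> \<phi> < ennreal N'" using N N' by (auto intro: order.strict_trans1 ennreal_lessI)
    then obtain l where l: "0 < l" "ennreal l < ennreal N'"
      "(\<integral>\<^sup>+x. ennreal (young_A \<sigma> (norm (\<phi> x) / l) * v x) \<partial>?M) \<le> 1"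
      unfolding orlicz_norm_less_iff by blast
    have lN: "l \<le> N'" using l by (simp add: ennreal_less_iff)
    have "ennreal (LINT x|?M. (\<phi> x)\<^sup>2 * v x) = (\<integral>\<^sup>+x. ennreal ((\<phi> x)\<^sup>2 * v x) \<partial>?M)"
      using \<phi>(2) g0 by (rule nn_integral_eq_integral[symmetric])
    also have "\<dots> \<le> (\<integral>\<^sup>+x. ennreal (l\<^sup>2) * ennreal (young_A \<sigma> (norm (\<phi> x) / l) * v x) \<partial>?M)"
    proof (intro nn_integral_mono)
      fix x assume "x \<in> space ?M"
      then have vx: "0 \<le> v x" using v0 by (simp add: sp)
      have "(\<phi> x)\<^sup>2 = l\<^sup>2 * (norm (\<phi> x) / l)\<^sup>2" using l(1) by (simp add: power_divide)
      also have "\<dots> \<le> l\<^sup>2 * young_A \<sigma> (norm (\<phi> x) / l)"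
        using l(1) by (intro mult_left_mono square_le_young_A \<sigma>) auto
      finally have "(\<phi> x)\<^sup>2 * v x \<le> l\<^sup>2 * young_A \<sigma> (norm (\<phi> x) / l) * v x" using vx by (rule mult_right_mono)
      then show "ennreal ((\<phi> x)\<^sup>2 * v x) \<le> ennreal (l\<^sup>2) * ennreal (young_A \<sigma> (norm (\<phi> x) / l) * v x)"
        using vx by (subst ennreal_mult[symmetric]) (auto simp: young_A_def mult.assoc intro!: ennreal_leI)
    qed
    also have "\<dots> = ennreal (l\<^sup>2) * (\<integral>\<^sup>+x. ennreal (young_A \<sigma> (norm (\<phi> x) / l) * v x) \<partial>?M)"
      by (intro nn_integral_cmult) simp
    also have "\<dots> \<le> ennreal (l\<^sup>2) * 1" using l(3) by (rule mult_left_mono) simp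
    also have "\<dots> \<le> ennreal (N'\<^sup>2)" using lN l(1) by (simp add: ennreal_leI power_mono)
    finally show "(LINT x|?M. (\<phi> x)\<^sup>2 * v x) \<le> N'\<^sup>2 * 1" by (simp add: ennreal_le_iff)
  qed
  then show ?thesis by simp
qed

section \<open>The space of pairs as a Hilbert space\<close>

text \<open>\<open>X\<close> and \<open>W\<close> below are the Lipschitz test functions and the closure of their pairs
\<open>(\<phi>, \<nabla>\<phi>)\<close>. With \<open>sqrtv\<close> and \<open>Qlen\<close> the norms of \<open>L\<^sup>2(v)\<close> and \<open>QL\<^sup>2\<close> become unweighted
\<open>L\<^sup>2\<close>-norms of \<open>sqrtv u\<close> and \<open>Qlen g\<close>.\<close>

locale weighted_sobolev =
  fixes \<Omega> :: "(real^'n) set" and v :: "real^'n \<Rightarrow> real" and Q :: "real^'n \<Rightarrow> real^'n^'n"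
    and \<sigma> S2 :: real
  assumes open_Omega: "open \<Omega>"
    and weight: "is_weight \<Omega> v" and weight_integrable: "integrable (lebesgue_on \<Omega>) v"
    and matrix_function: "matrix_function \<Omega> Q"
    and sigma: "0 < \<sigma>"
    and S2: "0 \<le> S2"
    and sobolev: "\<And>\<phi>. \<phi> \<in> QLip_0 Q v \<Omega> \<Longrightarrow>
         orlicz_norm (young_A \<sigma>) v \<Omega> \<phi> \<le> ennreal (S2 * QL2_norm Q \<Omega> (grad \<phi>))"
begin

abbreviation M :: "(real^'n) measure" where "M \<equiv> lebesgue_on \<Omega>"
abbreviation X :: "(real^'n \<Rightarrow> real) set" where "X \<equiv> QLip_0 Q v \<Omega>"
abbreviation L2v :: "(real^'n \<Rightarrow> 'b::euclidean_space) set" where "L2v \<equiv> Lp_space 2 v \<Omega>"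
abbreviation vnorm :: "(real^'n \<Rightarrow> 'b::euclidean_space) \<Rightarrow> real" where "vnorm \<equiv> Lp_norm 2 v \<Omega>"
abbreviation L2Q :: "(real^'n \<Rightarrow> real^'n) set" where "L2Q \<equiv> QL2_space Q \<Omega>"
abbreviation gnorm :: "(real^'n \<Rightarrow> real^'n) \<Rightarrow> real" where "gnorm \<equiv> QL2_norm Q \<Omega>"
abbreviation W :: "((real^'n \<Rightarrow> real) \<times> (real^'n \<Rightarrow> real^'n)) set" where "W \<equiv> QH12_0 Q v \<Omega>"

definition sqrtv :: "real^'n \<Rightarrow> real" where "sqrtv x = sqrt (v x)"
definition Qlen :: "(real^'n \<Rightarrow> real^'n) \<Rightarrow> real^'n \<Rightarrow> real" where
  "Qlen g x = norm (matrix_sqrt (Q x) *v g x)"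

lemma Omega_sets: "\<Omega> \<in> sets lebesgue" using open_Omega by simp

lemma space_M: "space M = \<Omega>" by (simp add: space_restrict_space)

lemma v_measurable [measurable]: "v \<in> borel_measurable M"
  using weight by (simp add: is_weight_def)

lemma v_nonneg: "x \<in> \<Omega> \<Longrightarrow> 0 \<le> v x" using weight by (simp add: is_weight_def)

lemma v_pos: "AE x in M. 0 < v x" using weight by (simp add: is_weight_def)

lemma sqrtv_measurable [measurable]: "sqrtv \<in> borel_measurable M"
  unfolding sqrtv_def[abs_def] by measurable

lemma sqrtv_nonneg: "x \<in> \<Omega> \<Longrightarrow> 0 \<le> sqrtv x" by (simp add: sqrtv_def v_nonneg)

lemma sqrtv_power2: "x \<in> \<Omega> \<Longrightarrow> (sqrtv x)\<^sup>2 = v x" by (simp add: sqrtv_def v_nonneg)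

lemma sqrtv_mult: "x \<in> \<Omega> \<Longrightarrow> sqrtv x * sqrtv x = v x" by (simp add: sqrtv_def v_nonneg)

lemma sqrtv_pos: "AE x in M. 0 < sqrtv x" using v_pos by eventually_elim (simp add: sqrtv_def)

lemma Q_psd: "x \<in> \<Omega> \<Longrightarrow> psd_matrix (Q x)"
  using matrix_function by (simp add: matrix_function_def)

lemma vec_nth_measurable:
  fixes g :: "real^'n \<Rightarrow> real^'m"
  assumes "g \<in> borel_measurable M" shows "(\<lambda>x. g x $ i) \<in> borel_measurable M"
proof -
  have "(\<lambda>x. g x \<bullet> axis i 1) \<in> borel_measurable M" using assms by measurable
  then show ?thesis by (simp add: inner_axis)
qed

lemma Q_form_measurable:
  assumes "g \<in> borel_measurable M" "h \<in> borel_measurable M"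
  shows "(\<lambda>x. (Q x *v g x) \<bullet> h x) \<in> borel_measurable M"
proof -
  have [measurable]: "(\<lambda>x. Q x $ i $ j) \<in> borel_measurable M" for i j
    using matrix_function by (simp add: matrix_function_def)
  note [measurable] = vec_nth_measurable[OF assms(1)] vec_nth_measurable[OF assms(2)]
  have "(\<lambda>x. \<Sum>i\<in>UNIV. (\<Sum>j\<in>UNIV. Q x $ i $ j * g x $ j) * h x $ i) \<in> borel_measurable M"
    by measurable
  then show ?thesis by (simp add: inner_vec_def matrix_vector_mult_def)
qed

lemma Qlen_power2: "x \<in> \<Omega> \<Longrightarrow> (Qlen g x)\<^sup>2 = (Q x *v g x) \<bullet> g x"
  unfolding Qlen_def by (rule norm_matrix_sqrt_power2[OF Q_psd])

lemma Qlen_nonneg [simp]: "0 \<le> Qlen g x" by (simp add: Qlen_def)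

lemma Qlen_measurable:
  assumes "g \<in> borel_measurable M" shows "Qlen g \<in> borel_measurable M"
proof -
  have "(\<lambda>x. sqrt ((Q x *v g x) \<bullet> g x)) \<in> borel_measurable M"
    using Q_form_measurable[OF assms assms] by measurable
  then show ?thesis
    by (rule measurable_cong[THEN iffD1, rotated])
      (simp add: space_M Qlen_power2[symmetric])
qed

lemma QL2_space_iff: "g \<in> L2Q \<longleftrightarrow> g \<in> borel_measurable M \<and> square_integrable M (Qlen g)"
  by (auto simp: QL2_space_def square_integrable_def Qlen_measurable) (auto simp: Qlen_def)

lemma QL2_norm_eq: "gnorm g = L2norm M (Qlen g)"
  by (simp add: QL2_norm_def L2norm_def Qlen_def)

lemma Lp_space_iff:
  fixes f :: "real^'n \<Rightarrow> 'b::euclidean_space"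
  shows "f \<in> L2v \<longleftrightarrow> f \<in> borel_measurable M \<and> square_integrable M (\<lambda>x. sqrtv x * norm (f x))"
proof -
  have "integrable M (\<lambda>x. norm (f x) powr 2 * v x) \<longleftrightarrow> integrable M (\<lambda>x. (sqrtv x * norm (f x))\<^sup>2)"
    by (rule Bochner_Integration.integrable_cong) (simp_all add: space_M power_mult_distrib sqrtv_power2 mult.commute)
  then show ?thesis unfolding Lp_space_def square_integrable_def
    by auto
qed

lemma Lp_norm_eq:
  fixes f :: "real^'n \<Rightarrow> 'b::euclidean_space"
  shows "vnorm f = L2norm M (\<lambda>x. sqrtv x * norm (f x))"
proof -
  have e: "(LINT x|M. norm (f x) powr 2 * v x) = (LINT x|M. (sqrtv x * norm (f x))\<^sup>2)"
    by (rule Bochner_Integration.integral_cong) (simp_all add: space_M power_mult_distrib sqrtv_power2 mult.commute)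
  have "0 \<le> (LINT x|M. (sqrtv x * norm (f x))\<^sup>2)" by simp
  then show ?thesis unfolding Lp_norm_def e L2norm_def by (simp add: powr_half_sqrt)
qed

lemma Lp_space_real_iff:
  fixes f :: "real^'n \<Rightarrow> real"
  shows "f \<in> L2v \<longleftrightarrow> f \<in> borel_measurable M \<and> square_integrable M (\<lambda>x. sqrtv x * f x)"
  unfolding Lp_space_iff by (auto simp: square_integrable_def power_mult_distrib)

lemma Lp_norm_real_eq:
  fixes f :: "real^'n \<Rightarrow> real"
  shows "vnorm f = L2norm M (\<lambda>x. sqrtv x * f x)"
  unfolding Lp_norm_eq by (simp add: L2norm_def power_mult_distrib)

lemma Lp_linear:
  fixes f g h :: "real^'n \<Rightarrow> real"
  assumes "g \<in> L2v" "h \<in> L2v"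
    and eq: "\<And>x. x \<in> \<Omega> \<Longrightarrow> f x = a * g x + b * h x"
  shows "f \<in> L2v" "vnorm f \<le> \<bar>a\<bar> * vnorm g + \<bar>b\<bar> * vnorm h"
proof -
  have g: "g \<in> borel_measurable M" "square_integrable M (\<lambda>x. sqrtv x * g x)"
    and h: "h \<in> borel_measurable M" "square_integrable M (\<lambda>x. sqrtv x * h x)"
    using assms by (simp_all add: Lp_space_real_iff)
  note [measurable] = g(1) h(1)
  have "(\<lambda>x. a * g x + b * h x) \<in> borel_measurable M" by measurable
  then have fm [measurable]: "f \<in> borel_measurable M"
    by (rule measurable_cong[THEN iffD1, rotated]) (simp add: space_M eq)
  have le: "AE x in M. \<bar>sqrtv x * f x\<bar> \<le> \<bar>a * (sqrtv x * g x)\<bar> + \<bar>b * (sqrtv x * h x)\<bar>"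
  proof (rule AE_I2)
    fix x assume "x \<in> space M"
    then have "sqrtv x * f x = a * (sqrtv x * g x) + b * (sqrtv x * h x)" by (simp add: space_M eq algebra_simps)
    then show "\<bar>sqrtv x * f x\<bar> \<le> \<bar>a * (sqrtv x * g x)\<bar> + \<bar>b * (sqrtv x * h x)\<bar>" by simp
  qed
  have m: "(\<lambda>x. sqrtv x * f x) \<in> borel_measurable M" by measurable
  note r = square_integrable_le_add[OF square_integrable_cmult(1)[OF g(2)] square_integrable_cmult(1)[OF h(2)] m le]
  show "f \<in> L2v" using r(1) fm by (simp add: Lp_space_real_iff)
  show "vnorm f \<le> \<bar>a\<bar> * vnorm g + \<bar>b\<bar> * vnorm h"
    using r(2) square_integrable_cmult(2)[OF g(2)] square_integrable_cmult(2)[OF h(2)]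
    by (simp add: Lp_norm_real_eq)
qed

lemma QL2_linear:
  assumes "g \<in> L2Q" "h \<in> L2Q"
    and eq: "AE x in M. f x = a *\<^sub>R g x + b *\<^sub>R h x"
  shows "f \<in> L2Q" "gnorm f \<le> \<bar>a\<bar> * gnorm g + \<bar>b\<bar> * gnorm h"
proof -
  have g: "g \<in> borel_measurable M" "square_integrable M (Qlen g)"
    and h: "h \<in> borel_measurable M" "square_integrable M (Qlen h)"
    using assms by (simp_all add: QL2_space_iff)
  note [measurable] = g(1) h(1)
  have "(\<lambda>x. a *\<^sub>R g x + b *\<^sub>R h x) \<in> borel_measurable M" by measurable
  then have fm: "f \<in> borel_measurable M"
    by (rule borel_measurable_AE_lebesgue_on[OF Omega_sets]) (use eq in eventually_elim, simp)
  have le: "AE x in M. \<bar>Qlen f x\<bar> \<le> \<bar>a * Qlen g x\<bar> + \<bar>b * Qlen h x\<bar>"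
    using eq
  proof eventually_elim
    case (elim x)
    have "matrix_sqrt (Q x) *v f x = a *\<^sub>R (matrix_sqrt (Q x) *v g x) + b *\<^sub>R (matrix_sqrt (Q x) *v h x)"
      by (simp add: elim matrix_vector_right_distrib matrix_vector_mult_scaleR)
    then show ?case unfolding Qlen_def
      by (metis (no_types, lifting) abs_mult abs_norm_cancel norm_scaleR norm_triangle_ineq)
  qed
  note r = square_integrable_le_add[OF square_integrable_cmult(1)[OF g(2)] square_integrable_cmult(1)[OF h(2)] Qlen_measurable[OF fm] le]
  show "f \<in> L2Q" using r(1) fm by (simp add: QL2_space_iff)
  show "gnorm f \<le> \<bar>a\<bar> * gnorm g + \<bar>b\<bar> * gnorm h"
    using r(2) square_integrable_cmult(2)[OF g(2)] square_integrable_cmult(2)[OF h(2)]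
    by (simp add: QL2_norm_eq)
qed

lemma Lp_diff:
  fixes g h :: "real^'n \<Rightarrow> real"
  shows "g \<in> L2v \<Longrightarrow> h \<in> L2v \<Longrightarrow> (\<lambda>x. g x - h x) \<in> L2v"
  by (erule (1) Lp_linear(1)[where a=1 and b="-1"]) simp

lemma QL2_diff:
  "g \<in> L2Q \<Longrightarrow> h \<in> L2Q \<Longrightarrow> (\<lambda>x. g x - h x) \<in> L2Q"
  by (erule (1) QL2_linear(1)[where a=1 and b="-1"]) simp

lemma QL2_norm_nonneg [simp]: "0 \<le> gnorm g" by (simp add: QL2_norm_eq)

lemma Lp_norm_nonneg [simp]: "0 \<le> vnorm u" by (simp add: Lp_norm_eq)

lemma X_D:
  assumes "\<phi> \<in> X"
  shows "\<phi> \<in> Lip_0 \<Omega>" "\<phi> \<in> L2v" "grad \<phi> \<in> L2Q"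
    "\<phi> \<in> borel_measurable M" "grad \<phi> \<in> borel_measurable M"
    "AE x in M. partially_differentiable \<phi> x"
  using assms Lip_0_partially_differentiable_AE[OF _ open_Omega]
  by (auto simp: QLip_0_def Lp_space_real_iff QL2_space_iff)

lemma grad_linear_AE:
  assumes "\<phi> \<in> X" "\<psi> \<in> X"
  shows "AE x in M. grad (\<lambda>x. a * \<phi> x + b * \<psi> x) x = a *\<^sub>R grad \<phi> x + b *\<^sub>R grad \<psi> x"
  using X_D(6)[OF assms(1)] X_D(6)[OF assms(2)] by eventually_elim (rule grad_linear)

lemma X_linear:
  assumes "\<phi> \<in> X" "\<psi> \<in> X"
  shows "(\<lambda>x. a * \<phi> x + b * \<psi> x) \<in> X"
  using Lip_0_linear[OF X_D(1)[OF assms(1)] X_D(1)[OF assms(2)]]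
    Lp_linear(1)[OF X_D(2)[OF assms(1)] X_D(2)[OF assms(2)]]
    QL2_linear(1)[OF X_D(3)[OF assms(1)] X_D(3)[OF assms(2)] grad_linear_AE[OF assms]]
  by (auto simp: QLip_0_def)

lemma zero_in_X: "(\<lambda>x. 0) \<in> X"
proof -
  have "(\<lambda>x. 0) \<in> Lip_0 \<Omega>" by (auto simp: Lip_0_def intro!: exI[of _ 0] lipschitz_intros)
  moreover have "grad (\<lambda>x::real^'n. 0) = (\<lambda>x. 0)"
    by (rule ext, rule grad_eqI) simp
  ultimately show ?thesis
    by (simp add: QLip_0_def Lp_space_real_iff QL2_space_iff square_integrable_def Qlen_def[abs_def])
qed

text \<open>Continuously differentiable functions of a test function that vanish at \<open>0\<close> are test functions. On the bounded range
of \<open>\<phi>\<close> the derivative of \<open>\<beta>\<close> is bounded, which gives the integrability.\<close>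

lemma X_compose:
  assumes \<phi>: "\<phi> \<in> X"
    and \<beta>: "\<And>s. DERIV \<beta> s :> \<beta>' s" "continuous_on UNIV \<beta>'" "\<beta> 0 = 0"
  shows "(\<lambda>x. \<beta> (\<phi> x)) \<in> X" "AE x in M. grad (\<lambda>x. \<beta> (\<phi> x)) x = \<beta>' (\<phi> x) *\<^sub>R grad \<phi> x"
proof -
  note \<phi>D = X_D[OF \<phi>]
  note [measurable] = \<phi>D(4,5)
  show ae: "AE x in M. grad (\<lambda>x. \<beta> (\<phi> x)) x = \<beta>' (\<phi> x) *\<^sub>R grad \<phi> x"
    using \<phi>D(6) by eventually_elim (rule grad_compose[OF _ \<beta>(1)])
  obtain D where D: "0 \<le> D" "\<And>x. x \<in> \<Omega> \<Longrightarrow> \<bar>\<beta>' (\<phi> x)\<bar> \<le> D" "\<And>x. x \<in> \<Omega> \<Longrightarrow> \<bar>\<beta> (\<phi> x)\<bar> \<le> D * \<bar>\<phi> x\<bar>"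
    using Lip_0_compose(2)[OF \<phi>D(1) \<beta>] by blast
  have contb: "continuous_on UNIV \<beta>" using \<beta>(1) by (meson DERIV_continuous_on has_field_derivative_at_within)
  have [measurable]: "(\<lambda>x. \<beta> (\<phi> x)) \<in> borel_measurable M" "(\<lambda>x. \<beta>' (\<phi> x)) \<in> borel_measurable M"
    using contb \<beta>(2) \<phi>D(4) by (auto intro: borel_measurable_continuous_on)
  have "square_integrable M (\<lambda>x. D * (sqrtv x * \<phi> x))"
    using \<phi>D(2) by (intro square_integrable_cmult) (simp add: Lp_space_real_iff)
  then have "square_integrable M (\<lambda>x. sqrtv x * \<beta> (\<phi> x))"
  proof (rule square_integrable_bound(1))
    show "AE x in M. \<bar>sqrtv x * \<beta> (\<phi> x)\<bar> \<le> \<bar>D * (sqrtv x * \<phi> x)\<bar>"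
    proof (rule AE_I2)
      fix x assume "x \<in> space M"
      then have "sqrtv x * \<bar>\<beta> (\<phi> x)\<bar> \<le> sqrtv x * (D * \<bar>\<phi> x\<bar>)"
        by (intro mult_left_mono D sqrtv_nonneg) (auto simp: space_M)
      then show "\<bar>sqrtv x * \<beta> (\<phi> x)\<bar> \<le> \<bar>D * (sqrtv x * \<phi> x)\<bar>"
        using D(1) sqrtv_nonneg \<open>x \<in> space M\<close> by (simp add: abs_mult space_M mult_ac)
    qed
  qed measurable
  then have Lp: "(\<lambda>x. \<beta> (\<phi> x)) \<in> L2v" by (simp add: Lp_space_real_iff)
  have gm: "grad (\<lambda>x. \<beta> (\<phi> x)) \<in> borel_measurable M"
  proof (rule borel_measurable_AE_lebesgue_on[OF Omega_sets])
    show "(\<lambda>x. \<beta>' (\<phi> x) *\<^sub>R grad \<phi> x) \<in> borel_measurable M" by measurable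
    show "AE x in M. \<beta>' (\<phi> x) *\<^sub>R grad \<phi> x = grad (\<lambda>x. \<beta> (\<phi> x)) x" using ae by eventually_elim simp
  qed
  have "square_integrable M (\<lambda>x. D * Qlen (grad \<phi>) x)"
    using \<phi>D(3) by (intro square_integrable_cmult) (simp add: QL2_space_iff)
  then have "square_integrable M (Qlen (grad (\<lambda>x. \<beta> (\<phi> x))))"
  proof (rule square_integrable_bound(1)[OF _ Qlen_measurable[OF gm]])
    show "AE x in M. \<bar>Qlen (grad (\<lambda>x. \<beta> (\<phi> x))) x\<bar> \<le> \<bar>D * Qlen (grad \<phi>) x\<bar>"
      using ae AE_space
    proof eventually_elim
      case (elim x)
      have "Qlen (grad (\<lambda>x. \<beta> (\<phi> x))) x = \<bar>\<beta>' (\<phi> x)\<bar> * Qlen (grad \<phi>) x"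
        by (simp add: Qlen_def elim matrix_vector_mult_scaleR)
      also have "\<dots> \<le> D * Qlen (grad \<phi>) x" using elim D by (intro mult_right_mono) (auto simp: space_M)
      finally show ?case using D by simp
    qed
  qed
  then have "grad (\<lambda>x. \<beta> (\<phi> x)) \<in> L2Q" using gm by (simp add: QL2_space_iff)
  then show "(\<lambda>x. \<beta> (\<phi> x)) \<in> X" using Lp Lip_0_compose(1)[OF \<phi>D(1) \<beta>] by (simp add: QLip_0_def)
qed

lemma X_Lp_bound: "\<phi> \<in> X \<Longrightarrow> vnorm \<phi> \<le> S2 * gnorm (grad \<phi>)"
proof -
  assume \<phi>: "\<phi> \<in> X"
  have e: "(sqrtv x * \<phi> x)\<^sup>2 = (\<phi> x)\<^sup>2 * v x" if "x \<in> \<Omega>" for x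
    using that by (simp add: power_mult_distrib sqrtv_power2 mult.commute)
  have "integrable M (\<lambda>x. (sqrtv x * \<phi> x)\<^sup>2)"
    using X_D(2)[OF \<phi>] by (simp add: Lp_space_real_iff square_integrable_def)
  then have i: "integrable M (\<lambda>x. (\<phi> x)\<^sup>2 * v x)"
    by (rule Bochner_Integration.integrable_cong[THEN iffD1, rotated -1]) (simp_all add: space_M e)
  have N: "0 \<le> S2 * gnorm (grad \<phi>)" using S2 by simp
  have "(vnorm \<phi>)\<^sup>2 = (LINT x|M. (\<phi> x)\<^sup>2 * v x)"
    unfolding Lp_norm_real_eq L2norm_power2
    by (rule Bochner_Integration.integral_cong) (simp_all add: space_M e)
  also have "\<dots> \<le> (S2 * gnorm (grad \<phi>))\<^sup>2"
    by (rule orlicz_A_imp_L2_bound[OF weight sigma X_D(4)[OF \<phi>] i N sobolev[OF \<phi>]])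
  finally show ?thesis using N by (rule power2_le_imp_le)
qed

lemma W_iff:
  "p \<in> W \<longleftrightarrow> fst p \<in> L2v \<and> snd p \<in> L2Q \<and>
     (\<exists>\<phi>. (\<forall>n. \<phi> n \<in> X) \<and> (\<lambda>n. vnorm (\<lambda>x. fst p x - \<phi> n x)) \<longlonglongrightarrow> 0 \<and>
          (\<lambda>n. gnorm (\<lambda>x. snd p x - grad (\<phi> n) x)) \<longlonglongrightarrow> 0)"
  (is "_ \<longleftrightarrow> ?L \<and> ?Q \<and> ?E")
proof -
  let ?N = "\<lambda>\<phi>. QH_norm Q v \<Omega> (\<lambda>x. fst p x - \<phi> x, \<lambda>x. snd p x - grad \<phi> x)"
  have N: "?N \<phi> = vnorm (\<lambda>x. fst p x - \<phi> x) + gnorm (\<lambda>x. snd p x - grad \<phi> x)" for \<phi>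
    by (simp add: QH_norm_def)
  have W: "p \<in> W \<longleftrightarrow> ?L \<and> ?Q \<and> (\<forall>\<epsilon>>0. \<exists>\<phi>\<in>X. ?N \<phi> < \<epsilon>)"
    by (cases p) (simp add: QH12_0_def QH_closure_def)
  have "(\<forall>\<epsilon>>0. \<exists>\<phi>\<in>X. ?N \<phi> < \<epsilon>) \<longleftrightarrow> ?E"
  proof
    assume "\<forall>\<epsilon>>0. \<exists>\<phi>\<in>X. ?N \<phi> < \<epsilon>"
    then have "\<forall>n. \<exists>\<phi>. \<phi> \<in> X \<and> ?N \<phi> < 1 / (real n + 1)" unfolding Bex_def by simp
    from choice[OF this] obtain \<phi> where "\<forall>n. \<phi> n \<in> X \<and> ?N (\<phi> n) < 1 / (real n + 1)" by (rule exE)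
    then have \<phi>: "\<And>n. \<phi> n \<in> X" "\<And>n. ?N (\<phi> n) < 1 / (real n + 1)" by simp_all
    have \<phi>le: "vnorm (\<lambda>x. fst p x - \<phi> n x) \<le> 1 / (real n + 1)"
      "gnorm (\<lambda>x. snd p x - grad (\<phi> n) x) \<le> 1 / (real n + 1)" for n
      using \<phi>(2)[of n] QL2_norm_nonneg[of "\<lambda>x. snd p x - grad (\<phi> n) x"]
        Lp_norm_nonneg[of "\<lambda>x. fst p x - \<phi> n x"] unfolding N by linarith+
    have lim: "(\<lambda>n. 1 / (real n + 1)) \<longlonglongrightarrow> 0"
      using LIMSEQ_inverse_real_of_nat by (simp add: inverse_eq_divide add.commute)
    have "(\<lambda>n. vnorm (\<lambda>x. fst p x - \<phi> n x)) \<longlonglongrightarrow> 0"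
    proof (rule tendsto_sandwich[OF _ _ tendsto_const lim])
      show "\<forall>\<^sub>F n in sequentially. vnorm (\<lambda>x. fst p x - \<phi> n x) \<le> 1 / (real n + 1)"
        by (intro always_eventually allI \<phi>le)
    qed simp
    moreover have "(\<lambda>n. gnorm (\<lambda>x. snd p x - grad (\<phi> n) x)) \<longlonglongrightarrow> 0"
    proof (rule tendsto_sandwich[OF _ _ tendsto_const lim])
      show "\<forall>\<^sub>F n in sequentially. gnorm (\<lambda>x. snd p x - grad (\<phi> n) x) \<le> 1 / (real n + 1)"
        by (intro always_eventually allI \<phi>le)
    qed simp
    ultimately show ?E using \<phi>(1) by blast
  next
    assume ?E
    then obtain \<phi> where \<phi>: "\<And>n. \<phi> n \<in> X"
      "(\<lambda>n. vnorm (\<lambda>x. fst p x - \<phi> n x)) \<longlonglongrightarrow> 0"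
      "(\<lambda>n. gnorm (\<lambda>x. snd p x - grad (\<phi> n) x)) \<longlonglongrightarrow> 0" by blast
    have "(\<lambda>n. ?N (\<phi> n)) \<longlonglongrightarrow> 0 + 0" unfolding N by (intro tendsto_add \<phi>)
    then have "\<exists>n. ?N (\<phi> n) < \<epsilon>" if "0 < \<epsilon>" for \<epsilon>
      using order_tendstoD(2)[of "\<lambda>n. ?N (\<phi> n)" 0 sequentially \<epsilon>] that eventually_happens by fastforce
    then show "\<forall>\<epsilon>>0. \<exists>\<phi>\<in>X. ?N \<phi> < \<epsilon>" using \<phi>(1) by blast
  qed
  then show ?thesis using W by blast
qed

lemma W_D:
  assumes "p \<in> W"
  shows "fst p \<in> L2v" "snd p \<in> L2Q"
    "fst p \<in> borel_measurable M" "snd p \<in> borel_measurable M"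
  using assms by (auto simp: W_iff Lp_space_real_iff QL2_space_iff)

lemma X_pair_in_W: "\<phi> \<in> X \<Longrightarrow> (\<phi>, grad \<phi>) \<in> W"
  unfolding W_iff
  by (auto simp: X_D Lp_norm_real_eq QL2_norm_eq Qlen_def[abs_def] L2norm_def intro!: exI[of _ "\<lambda>n. \<phi>"])

lemma Lp_norm_diff_le:
  fixes f g h :: "real^'n \<Rightarrow> real"
  assumes "f \<in> L2v" "g \<in> L2v" "h \<in> L2v"
  shows "vnorm (\<lambda>x. f x - h x) \<le> vnorm (\<lambda>x. f x - g x) + vnorm (\<lambda>x. g x - h x)"
proof -
  have d: "(\<lambda>x. f x - g x) \<in> L2v" "(\<lambda>x. g x - h x) \<in> L2v"
    by (rule Lp_diff[OF assms(1,2)], rule Lp_diff[OF assms(2,3)])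
  show ?thesis using Lp_linear(2)[OF d, of "\<lambda>x. f x - h x" 1 1] by simp
qed

lemma QL2_norm_diff_le:
  assumes "f \<in> L2Q" "g \<in> L2Q" "h \<in> L2Q"
  shows "gnorm (\<lambda>x. f x - h x) \<le> gnorm (\<lambda>x. f x - g x) + gnorm (\<lambda>x. g x - h x)"
proof -
  have d: "(\<lambda>x. f x - g x) \<in> L2Q" "(\<lambda>x. g x - h x) \<in> L2Q"
    by (rule QL2_diff[OF assms(1,2)], rule QL2_diff[OF assms(2,3)])
  show ?thesis using QL2_linear(2)[OF d, of "\<lambda>x. f x - h x" 1 1] by simp
qed

lemma W_linear:
  assumes p: "p \<in> W" and q: "q \<in> W"
  shows "(\<lambda>x. a * fst p x + b * fst q x, \<lambda>x. a *\<^sub>R snd p x + b *\<^sub>R snd q x) \<in> W"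
proof -
  obtain \<phi> where \<phi>: "\<And>n. \<phi> n \<in> X" "(\<lambda>n. vnorm (\<lambda>x. fst p x - \<phi> n x)) \<longlonglongrightarrow> 0"
      "(\<lambda>n. gnorm (\<lambda>x. snd p x - grad (\<phi> n) x)) \<longlonglongrightarrow> 0" using p W_iff by blast
  obtain \<psi> where \<psi>: "\<And>n. \<psi> n \<in> X" "(\<lambda>n. vnorm (\<lambda>x. fst q x - \<psi> n x)) \<longlonglongrightarrow> 0"
      "(\<lambda>n. gnorm (\<lambda>x. snd q x - grad (\<psi> n) x)) \<longlonglongrightarrow> 0" using q W_iff by blast
  define \<theta> where "\<theta> = (\<lambda>n x. a * \<phi> n x + b * \<psi> n x)"
  have \<theta>X: "\<theta> n \<in> X" for n unfolding \<theta>_def by (rule X_linear[OF \<phi>(1) \<psi>(1)])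
  have dL: "(\<lambda>x. fst p x - \<phi> n x) \<in> L2v" "(\<lambda>x. fst q x - \<psi> n x) \<in> L2v" for n
    by (rule Lp_diff[OF W_D(1)[OF p] X_D(2)[OF \<phi>(1)]], rule Lp_diff[OF W_D(1)[OF q] X_D(2)[OF \<psi>(1)]])
  have dQ: "(\<lambda>x. snd p x - grad (\<phi> n) x) \<in> L2Q" "(\<lambda>x. snd q x - grad (\<psi> n) x) \<in> L2Q" for n
    by (rule QL2_diff[OF W_D(2)[OF p] X_D(3)[OF \<phi>(1)]], rule QL2_diff[OF W_D(2)[OF q] X_D(3)[OF \<psi>(1)]])
  have "(\<lambda>n. \<bar>a\<bar> * vnorm (\<lambda>x. fst p x - \<phi> n x) + \<bar>b\<bar> * vnorm (\<lambda>x. fst q x - \<psi> n x)) \<longlonglongrightarrow> \<bar>a\<bar> * 0 + \<bar>b\<bar> * 0"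
    by (intro tendsto_intros \<phi> \<psi>)
  then have l1: "(\<lambda>n. \<bar>a\<bar> * vnorm (\<lambda>x. fst p x - \<phi> n x) + \<bar>b\<bar> * vnorm (\<lambda>x. fst q x - \<psi> n x)) \<longlonglongrightarrow> 0" by simp
  have limL: "(\<lambda>n. vnorm (\<lambda>x. (a * fst p x + b * fst q x) - \<theta> n x)) \<longlonglongrightarrow> 0"
  proof (rule tendsto_sandwich[OF _ _ tendsto_const l1])
    show "\<forall>\<^sub>F n in sequentially. vnorm (\<lambda>x. (a * fst p x + b * fst q x) - \<theta> n x) \<le>
       \<bar>a\<bar> * vnorm (\<lambda>x. fst p x - \<phi> n x) + \<bar>b\<bar> * vnorm (\<lambda>x. fst q x - \<psi> n x)"
      by (intro always_eventually allI Lp_linear(2) dL) (simp add: \<theta>_def algebra_simps)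
  qed simp
  have "(\<lambda>n. \<bar>a\<bar> * gnorm (\<lambda>x. snd p x - grad (\<phi> n) x) + \<bar>b\<bar> * gnorm (\<lambda>x. snd q x - grad (\<psi> n) x)) \<longlonglongrightarrow> \<bar>a\<bar> * 0 + \<bar>b\<bar> * 0"
    by (intro tendsto_intros \<phi> \<psi>)
  then have l2: "(\<lambda>n. \<bar>a\<bar> * gnorm (\<lambda>x. snd p x - grad (\<phi> n) x) + \<bar>b\<bar> * gnorm (\<lambda>x. snd q x - grad (\<psi> n) x)) \<longlonglongrightarrow> 0" by simp
  have limQ: "(\<lambda>n. gnorm (\<lambda>x. (a *\<^sub>R snd p x + b *\<^sub>R snd q x) - grad (\<theta> n) x)) \<longlonglongrightarrow> 0"
  proof (rule tendsto_sandwich[OF _ _ tendsto_const l2])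
    show "\<forall>\<^sub>F n in sequentially. gnorm (\<lambda>x. (a *\<^sub>R snd p x + b *\<^sub>R snd q x) - grad (\<theta> n) x) \<le>
       \<bar>a\<bar> * gnorm (\<lambda>x. snd p x - grad (\<phi> n) x) + \<bar>b\<bar> * gnorm (\<lambda>x. snd q x - grad (\<psi> n) x)"
    proof (intro always_eventually allI)
      fix n
      have "AE x in M. (a *\<^sub>R snd p x + b *\<^sub>R snd q x) - grad (\<theta> n) x =
          a *\<^sub>R (snd p x - grad (\<phi> n) x) + b *\<^sub>R (snd q x - grad (\<psi> n) x)"
        using grad_linear_AE[OF \<phi>(1) \<psi>(1), of a n b n] unfolding \<theta>_def
        by eventually_elim (simp add: algebra_simps)
      then show "gnorm (\<lambda>x. (a *\<^sub>R snd p x + b *\<^sub>R snd q x) - grad (\<theta> n) x) \<le>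
       \<bar>a\<bar> * gnorm (\<lambda>x. snd p x - grad (\<phi> n) x) + \<bar>b\<bar> * gnorm (\<lambda>x. snd q x - grad (\<psi> n) x)"
        by (rule QL2_linear(2)[OF dQ])
    qed
  qed simp
  have "(\<lambda>x. a * fst p x + b * fst q x) \<in> L2v"
    by (rule Lp_linear(1)[OF W_D(1)[OF p] W_D(1)[OF q], where a=a and b=b]) simp
  moreover have "(\<lambda>x. a *\<^sub>R snd p x + b *\<^sub>R snd q x) \<in> L2Q"
    by (rule QL2_linear(1)[OF W_D(2)[OF p] W_D(2)[OF q], where a=a and b=b]) simp
  ultimately show ?thesis unfolding W_iff using \<theta>X limL limQ by auto
qed

lemma subspace_W: "subspace W"
proof (rule subspaceI)
  have "(\<lambda>x. 0 * 0 + 0 * 0, \<lambda>x. 0 *\<^sub>R grad (\<lambda>x. 0) x + 0 *\<^sub>R grad (\<lambda>x. 0) x) \<in> W"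
    using W_linear[OF X_pair_in_W[OF zero_in_X] X_pair_in_W[OF zero_in_X], of 0 0] by simp
  then show "0 \<in> W" by (simp add: zero_prod_def zero_fun_def)
  show "p + q \<in> W" if "p \<in> W" "q \<in> W" for p q
    using W_linear[OF that, of 1 1] by (simp add: plus_prod_def plus_fun_def)
  show "c *\<^sub>R p \<in> W" if "p \<in> W" for c p
    using W_linear[OF that that, of c 0] by (simp add: scaleR_prod_def scaleR_fun_def)
qed

text \<open>The integral with the factor \<open>h\<close> is finite for pairs in the closure by Fatou's lemma.\<close>

lemma W_multiplier_extend:
  assumes h [measurable]: "h \<in> borel_measurable M" and c: "0 \<le> c"
    and b: "\<And>\<phi>. \<phi> \<in> X \<Longrightarrow> square_integrable M (\<lambda>x. sqrtv x * (h x * \<phi> x))"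
      "\<And>\<phi>. \<phi> \<in> X \<Longrightarrow> L2norm M (\<lambda>x. sqrtv x * (h x * \<phi> x)) \<le> c * gnorm (grad \<phi>)"
    and p: "p \<in> W"
  shows "square_integrable M (\<lambda>x. sqrtv x * (h x * fst p x))"
    "L2norm M (\<lambda>x. sqrtv x * (h x * fst p x)) \<le> c * gnorm (snd p)"
proof -
  obtain \<phi> where \<phi>: "\<And>n. \<phi> n \<in> X" "(\<lambda>n. vnorm (\<lambda>x. fst p x - \<phi> n x)) \<longlonglongrightarrow> 0"
      "(\<lambda>n. gnorm (\<lambda>x. snd p x - grad (\<phi> n) x)) \<longlonglongrightarrow> 0" using p W_iff by blast
  note [measurable] = W_D(3)[OF p]
  have dL: "(\<lambda>x. \<phi> n x - fst p x) \<in> L2v" for n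
    by (rule Lp_diff[OF X_D(2)[OF \<phi>(1)] W_D(1)[OF p]])
  have sym: "vnorm (\<lambda>x. fst p x - \<phi> n x) = L2norm M (\<lambda>x. sqrtv x * (\<phi> n x - fst p x))" for n
    unfolding Lp_norm_real_eq by (simp add: L2norm_def power_mult_distrib power2_commute)
  have le: "L2norm M (\<lambda>x. sqrtv x * h x * \<phi> n x)
        \<le> c * (gnorm (snd p) + gnorm (\<lambda>x. snd p x - grad (\<phi> n) x))" for n
  proof -
    have d: "(\<lambda>x. snd p x - grad (\<phi> n) x) \<in> L2Q"
      by (rule QL2_diff[OF W_D(2)[OF p] X_D(3)[OF \<phi>(1)]])
    have "gnorm (grad (\<phi> n)) \<le> gnorm (snd p) + gnorm (\<lambda>x. snd p x - grad (\<phi> n) x)"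
      using QL2_linear(2)[OF W_D(2)[OF p] d, of "grad (\<phi> n)" 1 "-1"] by simp
    then have "c * gnorm (grad (\<phi> n)) \<le> c * (gnorm (snd p) + gnorm (\<lambda>x. snd p x - grad (\<phi> n) x))"
      using c by (rule mult_left_mono)
    then show ?thesis using b(2)[OF \<phi>(1), of n] by (simp add: mult.assoc)
  qed
  have "(\<lambda>n. c * (gnorm (snd p) + gnorm (\<lambda>x. snd p x - grad (\<phi> n) x))) \<longlonglongrightarrow> c * (gnorm (snd p) + 0)"
    by (intro tendsto_intros \<phi>)
  then have lim: "(\<lambda>n. c * (gnorm (snd p) + gnorm (\<lambda>x. snd p x - grad (\<phi> n) x))) \<longlonglongrightarrow> c * gnorm (snd p)"
    by simp
  have "square_integrable M (\<lambda>x. (sqrtv x * h x) * fst p x) \<and> L2norm M (\<lambda>x. (sqrtv x * h x) * fst p x) \<le> c * gnorm (snd p)"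
  proof (intro conjI)
    note L = L2_limit_bound[where v=sqrtv and M=M and u=\<phi> and u'="fst p" and w="\<lambda>x. sqrtv x * h x", OF sqrtv_measurable sqrtv_pos _ _ _ le _ lim]
    have 1: "square_integrable M (\<lambda>x. sqrtv x * (\<phi> n x - fst p x))" for n using dL by (simp add: Lp_space_real_iff)
    have 2: "(\<lambda>n. L2norm M (\<lambda>x. sqrtv x * (\<phi> n x - fst p x))) \<longlonglongrightarrow> 0" using \<phi>(2) by (simp add: sym)
    have 3: "square_integrable M (\<lambda>x. sqrtv x * h x * \<phi> n x)" for n using b(1)[OF \<phi>(1), of n] by (simp add: mult.assoc)
    have 4: "(\<lambda>x. sqrtv x * h x * fst p x) \<in> borel_measurable M" by measurable
    show "square_integrable M (\<lambda>x. (sqrtv x * h x) * fst p x)" by (rule L(1)[OF 1 2 3 4])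
    show "L2norm M (\<lambda>x. (sqrtv x * h x) * fst p x) \<le> c * gnorm (snd p)" by (rule L(2)[OF 1 2 3 4])
  qed
  then show "square_integrable M (\<lambda>x. sqrtv x * (h x * fst p x))"
    "L2norm M (\<lambda>x. sqrtv x * (h x * fst p x)) \<le> c * gnorm (snd p)" by (simp_all add: mult.assoc)
qed

lemma W_Lp_bound: "p \<in> W \<Longrightarrow> vnorm (fst p) \<le> S2 * gnorm (snd p)"
  using W_multiplier_extend(2)[of "\<lambda>x. 1" S2 p] S2 X_Lp_bound X_D(2)
  by (simp add: Lp_norm_real_eq Lp_space_real_iff)

definition energy :: "(real^'n \<Rightarrow> real) \<times> (real^'n \<Rightarrow> real^'n) \<Rightarrow> (real^'n \<Rightarrow> real) \<times> (real^'n \<Rightarrow> real^'n) \<Rightarrow> real" where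
  "energy p q = (LINT x|M. (Q x *v snd p x) \<bullet> snd q x)"

lemma Q_form_integrable:
  assumes "g \<in> L2Q" "h \<in> L2Q"
  shows "integrable M (\<lambda>x. (Q x *v g x) \<bullet> h x)"
proof -
  have gh: "square_integrable M (Qlen g)" "square_integrable M (Qlen h)"
    "g \<in> borel_measurable M" "h \<in> borel_measurable M" using assms by (simp_all add: QL2_space_iff)
  show ?thesis
  proof (rule Bochner_Integration.integrable_bound[OF square_integrable_mult(1)[OF gh(1,2)] Q_form_measurable[OF gh(3,4)]])
    show "AE x in M. norm ((Q x *v g x) \<bullet> h x) \<le> norm (Qlen g x * Qlen h x)"
    proof (rule AE_I2)
      fix x assume "x \<in> space M"
      then have "(Q x *v g x) \<bullet> h x = (matrix_sqrt (Q x) *v g x) \<bullet> (matrix_sqrt (Q x) *v h x)"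
        by (simp add: matrix_sqrt_inner[OF Q_psd] space_M)
      then show "norm ((Q x *v g x) \<bullet> h x) \<le> norm (Qlen g x * Qlen h x)"
        by (simp add: Qlen_def Cauchy_Schwarz_ineq2)
    qed
  qed
qed

lemma energy_self: "energy p p = (gnorm (snd p))\<^sup>2"
  unfolding energy_def QL2_norm_eq L2norm_power2
  by (rule Bochner_Integration.integral_cong) (simp_all add: space_M Qlen_power2)

lemma QL2_norm_power2_integral: "(gnorm g)\<^sup>2 = (LINT x|M. (norm (matrix_sqrt (Q x) *v g x))\<^sup>2)"
  by (simp add: QL2_norm_eq L2norm_power2 Qlen_def)

text \<open>The gradients converge in \<open>QL\<^sup>2\<close> and, by the Sobolev inequality, the functions converge in
\<open>L\<^sup>2(v)\<close>. The limit is in the closure of the Lipschitz pairs by a diagonal choice.\<close>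

lemma W_complete:
  assumes P: "\<And>n. P n \<in> W"
    and C: "\<And>e. 0 < e \<Longrightarrow> \<exists>N. \<forall>m\<ge>N. \<forall>n\<ge>N. energy (P m - P n) (P m - P n) < e"
  shows "\<exists>p\<in>W. (\<lambda>n. energy (P n - p) (P n - p)) \<longlonglongrightarrow> 0"
proof -
  have snd_diff: "snd (p - q) = (\<lambda>x. snd p x - snd q x)" "fst (p - q) = (\<lambda>x. fst p x - fst q x)"
    for p q :: "(real^'n \<Rightarrow> real) \<times> (real^'n \<Rightarrow> real^'n)"
    by (simp_all add: fun_diff_def)
  have dW: "P m - P n \<in> W" for m n using P subspace_diff[OF subspace_W] by blast
  have en: "energy (p - q) (p - q) = (LINT x|M. (norm (matrix_sqrt (Q x) *v (snd p x - snd q x)))\<^sup>2)" for p q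
    unfolding energy_self QL2_norm_power2_integral by (simp add: snd_diff)
  have "\<exists>g. g \<in> borel_measurable M \<and> square_integrable M (\<lambda>x. norm (matrix_sqrt (Q x) *v g x)) \<and>
             (\<lambda>n. LINT x|M. (norm (matrix_sqrt (Q x) *v (snd (P n) x - g x)))\<^sup>2) \<longlonglongrightarrow> 0"
  proof (rule weighted_L2_complete)
    show "AE x in M. \<forall>y. matrix_sqrt (Q x) *v y = 0 \<longrightarrow> y = 0"
    proof -
      have "AE x in M. invertible (Q x)" using matrix_function by (simp add: matrix_function_def)
      then show ?thesis using AE_space
        by eventually_elim (use matrix_sqrt_injective[OF Q_psd] in \<open>auto simp: space_M\<close>)
    qed
    show "(\<lambda>x. norm (matrix_sqrt (Q x) *v g x)) \<in> borel_measurable M" if "g \<in> borel_measurable M" for g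
      using Qlen_measurable[OF that] by (simp add: Qlen_def[abs_def])
    show "snd (P n) \<in> borel_measurable M" for n by (rule W_D(4)[OF P])
    show "square_integrable M (\<lambda>x. norm (matrix_sqrt (Q x) *v snd (P n) x))" for n
      using W_D(2)[OF P] by (simp add: QL2_space_iff Qlen_def[abs_def])
    show "\<exists>N. \<forall>m\<ge>N. \<forall>n\<ge>N. (LINT x|M. (norm (matrix_sqrt (Q x) *v (snd (P m) x - snd (P n) x)))\<^sup>2) < e"
      if "0 < e" for e using C[OF that] unfolding en .
  qed simp
  then obtain g where g: "g \<in> borel_measurable M" "square_integrable M (Qlen g)"
    "(\<lambda>n. LINT x|M. (norm (matrix_sqrt (Q x) *v (snd (P n) x - g x)))\<^sup>2) \<longlonglongrightarrow> 0"
    unfolding Qlen_def[abs_def] by blast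
  have gQ: "g \<in> L2Q" using g by (simp add: QL2_space_iff)
  have "\<exists>u. u \<in> borel_measurable M \<and> square_integrable M (\<lambda>x. norm (sqrtv x *\<^sub>R u x)) \<and>
             (\<lambda>n. LINT x|M. (norm (sqrtv x *\<^sub>R (fst (P n) x - u x)))\<^sup>2) \<longlonglongrightarrow> 0"
  proof (rule weighted_L2_complete)
    show "linear ((*\<^sub>R) (sqrtv x) :: real \<Rightarrow> real)" for x by (rule linear_scale_self)
    show "AE x in M. \<forall>y::real. sqrtv x *\<^sub>R y = 0 \<longrightarrow> y = 0"
      using sqrtv_pos by eventually_elim auto
    show "(\<lambda>x. norm (sqrtv x *\<^sub>R u x)) \<in> borel_measurable M" if "u \<in> borel_measurable M" for u :: "real^'n \<Rightarrow> real"
      using that by measurable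
    show "fst (P n) \<in> borel_measurable M" for n by (rule W_D(3)[OF P])
    show "square_integrable M (\<lambda>x. norm (sqrtv x *\<^sub>R fst (P n) x))" for n
      using W_D(1)[OF P[of n]] by (auto simp: Lp_space_real_iff square_integrable_def)
    show "\<exists>N. \<forall>m\<ge>N. \<forall>n\<ge>N. (LINT x|M. (norm (sqrtv x *\<^sub>R (fst (P m) x - fst (P n) x)))\<^sup>2) < e" if e: "0 < e" for e
    proof -
      have p: "0 < S2\<^sup>2 + 1" by (simp add: add_nonneg_pos)
      have "0 < e / (S2\<^sup>2 + 1)" using e p by simp
      then obtain N where N: "\<And>m n. N \<le> m \<Longrightarrow> N \<le> n \<Longrightarrow> energy (P m - P n) (P m - P n) < e / (S2\<^sup>2 + 1)"
        using C by blast
      have "(LINT x|M. (norm (sqrtv x *\<^sub>R (fst (P m) x - fst (P n) x)))\<^sup>2) < e" if "N \<le> m" "N \<le> n" for m n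
      proof -
        have "(LINT x|M. (norm (sqrtv x *\<^sub>R (fst (P m) x - fst (P n) x)))\<^sup>2) = (vnorm (fst (P m - P n)))\<^sup>2"
          unfolding Lp_norm_real_eq L2norm_power2 by (simp add: snd_diff)
        also have "\<dots> \<le> (S2 * gnorm (snd (P m - P n)))\<^sup>2"
          using W_Lp_bound[OF dW] by (intro power_mono) auto
        also have "\<dots> = S2\<^sup>2 * energy (P m - P n) (P m - P n)"
          by (simp add: power_mult_distrib energy_self)
        also have "\<dots> \<le> (S2\<^sup>2 + 1) * energy (P m - P n) (P m - P n)"
          by (intro mult_right_mono) (auto simp: energy_self)
        also have "\<dots> < (S2\<^sup>2 + 1) * (e / (S2\<^sup>2 + 1))"
          using N[OF that] p by (intro mult_strict_left_mono) auto
        also have "\<dots> = e" using p by simp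
        finally show ?thesis .
      qed
      then show ?thesis by blast
    qed
  qed
  then obtain u where u: "u \<in> borel_measurable M" "square_integrable M (\<lambda>x. norm (sqrtv x *\<^sub>R u x))"
    "(\<lambda>n. LINT x|M. (norm (sqrtv x *\<^sub>R (fst (P n) x - u x)))\<^sup>2) \<longlonglongrightarrow> 0" by blast
  have uL: "u \<in> L2v" using u by (auto simp: Lp_space_real_iff square_integrable_def)
  have limg: "(\<lambda>n. gnorm (\<lambda>x. snd (P n) x - g x)) \<longlonglongrightarrow> 0"
    using tendsto_real_sqrt[OF g(3)] by (simp add: QL2_norm_def)
  have limu: "(\<lambda>n. vnorm (\<lambda>x. fst (P n) x - u x)) \<longlonglongrightarrow> 0"
    using tendsto_real_sqrt[OF u(3)] by (simp add: Lp_norm_real_eq L2norm_def)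
  have ex: "\<exists>\<phi>. \<phi> \<in> X \<and> vnorm (\<lambda>x. fst (P n) x - \<phi> x) < 1 / (real n + 1) \<and>
                  gnorm (\<lambda>x. snd (P n) x - grad \<phi> x) < 1 / (real n + 1)" for n
  proof -
    have n0: "0 < 1 / (real n + 1)" by simp
    obtain \<phi> where \<phi>: "\<And>k. \<phi> k \<in> X" "(\<lambda>k. vnorm (\<lambda>x. fst (P n) x - \<phi> k x)) \<longlonglongrightarrow> 0"
      "(\<lambda>k. gnorm (\<lambda>x. snd (P n) x - grad (\<phi> k) x)) \<longlonglongrightarrow> 0" using P[of n] W_iff by blast
    have "\<forall>\<^sub>F k in sequentially. vnorm (\<lambda>x. fst (P n) x - \<phi> k x) < 1 / (real n + 1) \<and>
            gnorm (\<lambda>x. snd (P n) x - grad (\<phi> k) x) < 1 / (real n + 1)"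
      using order_tendstoD(2)[OF \<phi>(2) n0] order_tendstoD(2)[OF \<phi>(3) n0] by eventually_elim simp
    then obtain k where "vnorm (\<lambda>x. fst (P n) x - \<phi> k x) < 1 / (real n + 1) \<and>
            gnorm (\<lambda>x. snd (P n) x - grad (\<phi> k) x) < 1 / (real n + 1)"
      using eventually_happens by fastforce
    then show ?thesis using \<phi>(1) by blast
  qed
  have "\<exists>\<phi>. \<forall>n. \<phi> n \<in> X \<and> vnorm (\<lambda>x. fst (P n) x - \<phi> n x) < 1 / (real n + 1) \<and>
                  gnorm (\<lambda>x. snd (P n) x - grad (\<phi> n) x) < 1 / (real n + 1)"
    by (rule choice) (intro allI ex)
  then obtain \<phi> where "\<forall>n. \<phi> n \<in> X \<and> vnorm (\<lambda>x. fst (P n) x - \<phi> n x) < 1 / (real n + 1) \<and>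
                  gnorm (\<lambda>x. snd (P n) x - grad (\<phi> n) x) < 1 / (real n + 1)" by (rule exE)
  then have \<phi>: "\<And>n. \<phi> n \<in> X" "\<And>n. vnorm (\<lambda>x. fst (P n) x - \<phi> n x) < 1 / (real n + 1)"
      "\<And>n. gnorm (\<lambda>x. snd (P n) x - grad (\<phi> n) x) < 1 / (real n + 1)" by simp_all
  have lim0: "(\<lambda>n. 1 / (real n + 1)) \<longlonglongrightarrow> 0"
    using LIMSEQ_inverse_real_of_nat by (simp add: inverse_eq_divide add.commute)
  have "(u, g) \<in> W"
  proof -
    have "(\<lambda>n. vnorm (\<lambda>x. u x - \<phi> n x)) \<longlonglongrightarrow> 0"
    proof (rule tendsto_sandwich[OF _ _ tendsto_const])
      show "(\<lambda>n. vnorm (\<lambda>x. fst (P n) x - u x) + 1 / (real n + 1)) \<longlonglongrightarrow> 0"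
        using tendsto_add[OF limu lim0] by simp
      have "vnorm (\<lambda>x. u x - fst (P n) x) = vnorm (\<lambda>x. fst (P n) x - u x)" for n
        by (simp add: Lp_norm_real_eq L2norm_def power_mult_distrib power2_commute)
      then show "\<forall>\<^sub>F n in sequentially. vnorm (\<lambda>x. u x - \<phi> n x) \<le> vnorm (\<lambda>x. fst (P n) x - u x) + 1 / (real n + 1)"
        using order_trans[OF Lp_norm_diff_le[OF uL W_D(1)[OF P] X_D(2)[OF \<phi>(1)]] add_left_mono[OF less_imp_le[OF \<phi>(2)]]]
        by (intro always_eventually allI) simp
    qed simp
    moreover have "(\<lambda>n. gnorm (\<lambda>x. g x - grad (\<phi> n) x)) \<longlonglongrightarrow> 0"
    proof (rule tendsto_sandwich[OF _ _ tendsto_const])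
      show "(\<lambda>n. gnorm (\<lambda>x. snd (P n) x - g x) + 1 / (real n + 1)) \<longlonglongrightarrow> 0"
        using tendsto_add[OF limg lim0] by simp
      have "gnorm (\<lambda>x. g x - snd (P n) x) = gnorm (\<lambda>x. snd (P n) x - g x)" for n
      proof -
        have "norm (matrix_sqrt (Q x) *v (g x - snd (P n) x)) = norm (matrix_sqrt (Q x) *v (snd (P n) x - g x))" for x
          by (simp add: matrix_vector_mult_diff_distrib norm_minus_commute)
        then show ?thesis by (simp add: QL2_norm_def)
      qed
      then show "\<forall>\<^sub>F n in sequentially. gnorm (\<lambda>x. g x - grad (\<phi> n) x) \<le> gnorm (\<lambda>x. snd (P n) x - g x) + 1 / (real n + 1)"
        using order_trans[OF QL2_norm_diff_le[OF gQ W_D(2)[OF P] X_D(3)[OF \<phi>(1)]] add_left_mono[OF less_imp_le[OF \<phi>(3)]]]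
        by (intro always_eventually allI) simp
    qed simp
    ultimately show ?thesis unfolding W_iff using \<phi>(1) uL gQ by auto
  qed
  then show ?thesis using g(3) by (intro bexI[of _ "(u, g)"]) (simp_all add: en)
qed

sublocale energy: semi_hilbert W energy
proof
  show "subspace W" by (rule subspace_W)
  show "energy (p + q) r = energy p r + energy q r" if "p \<in> W" "q \<in> W" "r \<in> W" for p q r
    using Q_form_integrable[OF W_D(2)[OF that(1)] W_D(2)[OF that(3)]] Q_form_integrable[OF W_D(2)[OF that(2)] W_D(2)[OF that(3)]]
    by (simp add: energy_def matrix_vector_right_distrib inner_add_left)
  show "energy (c *\<^sub>R p) r = c * energy p r" for c p r
    by (simp add: energy_def scaleR_fun_def matrix_vector_mult_scaleR)
  show "energy p q = energy q p" for p q
    unfolding energy_def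
  proof (rule Bochner_Integration.integral_cong)
    fix x assume "x \<in> space M"
    then show "(Q x *v snd p x) \<bullet> snd q x = (Q x *v snd q x) \<bullet> snd p x"
      using psd_matrix_symmetric[OF Q_psd, of x "snd q x" "snd p x"] by (simp add: space_M inner_commute)
  qed simp
  show "0 \<le> energy p p" for p by (simp add: energy_self)
  show "\<exists>p\<in>W. (\<lambda>n. energy (P n - p) (P n - p)) \<longlonglongrightarrow> 0"
    if "\<And>n. P n \<in> W" "\<And>e. 0 < e \<Longrightarrow> \<exists>N. \<forall>m\<ge>N. \<forall>n\<ge>N. energy (P m - P n) (P m - P n) < e" for P
    using W_complete that by blast
qed

lemma energy_nrm: "energy.nrm p = gnorm (snd p)"
  by (simp add: energy.nrm_def energy_self)

end

context weighted_sobolev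
begin

lemma W_subset_QH12: "W \<subseteq> QH12 Q v \<Omega>"
proof -
  have "Lip_0 \<Omega> \<subseteq> Lip_loc \<Omega>"
    unfolding Lip_0_def Lip_loc_def using lipschitz_on_subset by blast
  then have "X \<subseteq> QLip_loc Q v \<Omega>" by (auto simp: QLip_0_def QLip_loc_def)
  then show ?thesis unfolding QH12_0_def QH12_def QH_closure_def by blast
qed

text \<open>The energy norm alone controls a degenerate subunit field on \<open>W\<close>, because it controls the whole
norm of \<open>QH\<^sup>1\<^sup>,\<^sup>2\<close> there.\<close>

lemma subunit_bound:
  assumes "degenerate_subunit Q v \<Omega> V"
  shows "\<exists>c\<ge>0. \<forall>p\<in>W. square_integrable M (\<lambda>x. sqrtv x * (V x \<bullet> snd p x)) \<and>
            L2norm M (\<lambda>x. sqrtv x * (V x \<bullet> snd p x)) \<le> c * gnorm (snd p)"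
proof -
  obtain C where C: "\<And>p. p \<in> QH12 Q v \<Omega> \<Longrightarrow> (\<lambda>x. V x \<bullet> snd p x) \<in> L2v \<and>
        vnorm (\<lambda>x. V x \<bullet> snd p x) \<le> C * QH_norm Q v \<Omega> p"
    using assms unfolding degenerate_subunit_def by fastforce
  show ?thesis
  proof (intro exI[of _ "\<bar>C\<bar> * (S2 + 1)"] conjI ballI)
    show "0 \<le> \<bar>C\<bar> * (S2 + 1)" using S2 by simp
    fix p assume p: "p \<in> W"
    then have Cp: "(\<lambda>x. V x \<bullet> snd p x) \<in> L2v"
        "vnorm (\<lambda>x. V x \<bullet> snd p x) \<le> C * QH_norm Q v \<Omega> p"
      using C W_subset_QH12 by blast+
    show "square_integrable M (\<lambda>x. sqrtv x * (V x \<bullet> snd p x))" using Cp(1) by (simp add: Lp_space_real_iff)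
    have n: "QH_norm Q v \<Omega> p = vnorm (fst p) + gnorm (snd p)" by (simp add: QH_norm_def split_beta)
    have "L2norm M (\<lambda>x. sqrtv x * (V x \<bullet> snd p x)) \<le> C * QH_norm Q v \<Omega> p" using Cp(2) by (simp add: Lp_norm_real_eq)
    also have "\<dots> \<le> \<bar>C\<bar> * QH_norm Q v \<Omega> p" unfolding n by (intro mult_right_mono add_nonneg_nonneg) auto
    also have "\<dots> \<le> \<bar>C\<bar> * ((S2 + 1) * gnorm (snd p))"
      unfolding n using W_Lp_bound[OF p] by (intro mult_left_mono) (auto simp: distrib_right)
    finally show "L2norm M (\<lambda>x. sqrtv x * (V x \<bullet> snd p x)) \<le> \<bar>C\<bar> * (S2 + 1) * gnorm (snd p)"
      by (simp add: mult.assoc)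
  qed
qed

definition field_bound :: "('N::finite \<Rightarrow> real^'n \<Rightarrow> real^'n) \<Rightarrow> real \<Rightarrow> bool" where
  "field_bound R c \<longleftrightarrow> 0 \<le> c \<and> (\<forall>i. \<forall>p\<in>W. square_integrable M (\<lambda>x. sqrtv x * (R i x \<bullet> snd p x)) \<and>
       L2norm M (\<lambda>x. sqrtv x * (R i x \<bullet> snd p x)) \<le> c * gnorm (snd p))"

lemma field_bound_exists:
  fixes R :: "'N::finite \<Rightarrow> real^'n \<Rightarrow> real^'n"
  assumes "\<forall>i. degenerate_subunit Q v \<Omega> (R i)"
  shows "\<exists>c. field_bound R c"
proof -
  have "\<forall>i. \<exists>c. 0 \<le> c \<and> (\<forall>p\<in>W. square_integrable M (\<lambda>x. sqrtv x * (R i x \<bullet> snd p x)) \<and>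
            L2norm M (\<lambda>x. sqrtv x * (R i x \<bullet> snd p x)) \<le> c * gnorm (snd p))"
    using subunit_bound assms by blast
  from choice[OF this] obtain c where c: "\<forall>i. 0 \<le> c i \<and> (\<forall>p\<in>W. square_integrable M (\<lambda>x. sqrtv x * (R i x \<bullet> snd p x)) \<and>
            L2norm M (\<lambda>x. sqrtv x * (R i x \<bullet> snd p x)) \<le> c i * gnorm (snd p))" by (rule exE)
  have "c i \<le> (\<Sum>i\<in>UNIV. c i)" for i using c by (intro member_le_sum) auto
  then have le: "c i * gnorm (snd p) \<le> (\<Sum>i\<in>UNIV. c i) * gnorm (snd p)" for i p
    by (intro mult_right_mono) auto
  have "field_bound R (\<Sum>i\<in>UNIV. c i)"
    unfolding field_bound_def
  proof (intro conjI allI ballI)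
    show "0 \<le> (\<Sum>i\<in>UNIV. c i)" using c by (intro sum_nonneg) auto
    fix i p assume p: "p \<in> W"
    show "square_integrable M (\<lambda>x. sqrtv x * (R i x \<bullet> snd p x))" using c p by blast
    have "L2norm M (\<lambda>x. sqrtv x * (R i x \<bullet> snd p x)) \<le> c i * gnorm (snd p)" using c p by blast
    then show "L2norm M (\<lambda>x. sqrtv x * (R i x \<bullet> snd p x)) \<le> (\<Sum>i\<in>UNIV. c i) * gnorm (snd p)"
      using le by (rule order_trans)
  qed
  then show ?thesis by blast
qed

lemma field_bound_mono: "field_bound R c \<Longrightarrow> c \<le> d \<Longrightarrow> field_bound R d"
  unfolding field_bound_def by (meson QL2_norm_nonneg mult_right_mono order_trans)

text \<open>Split \<open>v\<close> into two factors \<open>sqrtv\<close>, one for the field and one for the coefficient, and apply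
the Cauchy-Schwarz inequality to each component.\<close>

lemma dot_fields_bound:
  fixes H :: "real^'n \<Rightarrow> real^'N::finite"
  assumes H [measurable]: "H \<in> borel_measurable M" and u [measurable]: "u \<in> borel_measurable M"
    and Hu: "square_integrable M (\<lambda>x. sqrtv x * (norm (H x) * u x))"
    and R: "field_bound R c" and p: "p \<in> W"
  shows "integrable M (\<lambda>x. dot_fields H R (snd p) x * u x * v x)"
    "\<bar>LINT x|M. dot_fields H R (snd p) x * u x * v x\<bar>
       \<le> real CARD('N) * c * gnorm (snd p) * L2norm M (\<lambda>x. sqrtv x * (norm (H x) * u x))"
proof -
  let ?a = "\<lambda>i x. sqrtv x * (R i x \<bullet> snd p x)" and ?b = "\<lambda>i x. sqrtv x * (H x $ i * u x)"
  note [measurable] = vec_nth_measurable[OF H]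
  have a: "square_integrable M (?a i)" "L2norm M (?a i) \<le> c * gnorm (snd p)" for i
    using R p by (auto simp: field_bound_def)
  have b: "square_integrable M (?b i)" "L2norm M (?b i) \<le> L2norm M (\<lambda>x. sqrtv x * (norm (H x) * u x))" for i
  proof -
    have m: "?b i \<in> borel_measurable M" by measurable
    have "AE x in M. \<bar>?b i x\<bar> \<le> \<bar>sqrtv x * (norm (H x) * u x)\<bar>"
      by (intro AE_I2) (simp add: abs_mult mult_left_mono mult_right_mono component_le_norm_cart)
    note r = square_integrable_bound[OF Hu m this]
    show "square_integrable M (?b i)" "L2norm M (?b i) \<le> L2norm M (\<lambda>x. sqrtv x * (norm (H x) * u x))"
      using r by auto
  qed
  have eq: "dot_fields H R (snd p) x * u x * v x = (\<Sum>i\<in>UNIV. ?a i x * ?b i x)" if "x \<in> \<Omega>" for x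
  proof -
    have "?a i x * ?b i x = H x $ i * (R i x \<bullet> snd p x) * u x * v x" for i
    proof -
      have "?a i x * ?b i x = (sqrtv x * sqrtv x) * (H x $ i * (R i x \<bullet> snd p x) * u x)"
        by (simp only: mult_ac)
      also have "\<dots> = H x $ i * (R i x \<bullet> snd p x) * u x * v x"
        by (simp only: sqrtv_mult[OF that] mult.commute[of "v x"])
      finally show ?thesis .
    qed
    then show ?thesis by (simp only: dot_fields_def sum_distrib_right)
  qed
  have int: "integrable M (\<lambda>x. \<Sum>i\<in>UNIV. ?a i x * ?b i x)"
    using square_integrable_mult(1)[OF a(1) b(1)] by (intro Bochner_Integration.integrable_sum) auto
  then show "integrable M (\<lambda>x. dot_fields H R (snd p) x * u x * v x)"
    by (rule Bochner_Integration.integrable_cong[THEN iffD1, rotated -1]) (simp_all add: space_M eq)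
  have "(LINT x|M. dot_fields H R (snd p) x * u x * v x) = (LINT x|M. (\<Sum>i\<in>UNIV. ?a i x * ?b i x))"
    by (rule Bochner_Integration.integral_cong) (simp_all add: space_M eq)
  also have "\<dots> = (\<Sum>i\<in>UNIV. (LINT x|M. ?a i x * ?b i x))"
    using square_integrable_mult(1)[OF a(1) b(1)] by (intro Bochner_Integration.integral_sum) auto
  also have "\<bar>\<dots>\<bar> \<le> (\<Sum>i\<in>(UNIV::'N set). c * gnorm (snd p) * L2norm M (\<lambda>x. sqrtv x * (norm (H x) * u x)))"
  proof (rule order_trans[OF sum_abs], rule sum_mono)
    fix i
    have "\<bar>LINT x|M. ?a i x * ?b i x\<bar> \<le> L2norm M (?a i) * L2norm M (?b i)"
      by (rule square_integrable_mult(2)[OF a(1) b(1)])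
    also have "\<dots> \<le> (c * gnorm (snd p)) * L2norm M (\<lambda>x. sqrtv x * (norm (H x) * u x))"
      using a(2) b(2) R by (intro mult_mono) (auto simp: field_bound_def)
    finally show "\<bar>LINT x|M. ?a i x * ?b i x\<bar> \<le> c * gnorm (snd p) * L2norm M (\<lambda>x. sqrtv x * (norm (H x) * u x))" .
  qed
  also have "\<dots> = real CARD('N) * c * gnorm (snd p) * L2norm M (\<lambda>x. sqrtv x * (norm (H x) * u x))"
    by simp
  finally show "\<bar>LINT x|M. dot_fields H R (snd p) x * u x * v x\<bar>
       \<le> real CARD('N) * c * gnorm (snd p) * L2norm M (\<lambda>x. sqrtv x * (norm (H x) * u x))" .
qed

definition admissible_multiplier :: "real \<Rightarrow> (real^'n \<Rightarrow> real) \<Rightarrow> bool" where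
  "admissible_multiplier lam h \<longleftrightarrow> h \<in> borel_measurable M \<and> (\<forall>x. 0 \<le> h x) \<and>
     (\<exists>l>0. (\<integral>\<^sup>+x. ennreal (young_C lam \<sigma> (h x / l) * v x) \<partial>M) \<le> 1)"

text \<open>The first part is the absorption property that the a priori estimate needs; the second, with
\<open>E = \<Omega>\<close>, makes the lower order terms bounded forms on \<open>W\<close>.\<close>

lemma multiplier_small_on_small_sets:
  assumes lam: "0 < lam" "lam < 1" and h: "admissible_multiplier lam h" and \<theta>: "0 < \<theta>"
  shows "\<exists>\<delta>>0. \<forall>\<phi>\<in>X. \<forall>E\<in>sets M. (LINT x|M. indicator E x * v x) \<le> \<delta> \<longrightarrow>
           square_integrable M (\<lambda>x. sqrtv x * (indicator E x * (h x * \<phi> x))) \<and>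
           L2norm M (\<lambda>x. sqrtv x * (indicator E x * (h x * \<phi> x))) \<le> \<theta> * gnorm (grad \<phi>)"
    and "\<exists>c\<ge>0. \<forall>p\<in>W. square_integrable M (\<lambda>x. sqrtv x * (h x * fst p x)) \<and>
           L2norm M (\<lambda>x. sqrtv x * (h x * fst p x)) \<le> c * gnorm (snd p)"
proof -
  obtain l where hm [measurable]: "h \<in> borel_measurable M" and h0: "\<And>x. 0 \<le> h x"
    and l: "0 < l" "(\<integral>\<^sup>+x. ennreal (young_C lam \<sigma> (h x / l) * v x) \<partial>M) \<le> 1"
    using h by (auto simp: admissible_multiplier_def)
  \<comment> \<open>Half of the budget \<open>\<theta>\<^sup>2\<close>, divided by the Sobolev constant; the measure of \<open>E\<close> takes the other half.\<close>
  define \<eta> where "\<eta> = \<theta>\<^sup>2 / (2 * (S2\<^sup>2 + 1))"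
  have p1: "0 < S2\<^sup>2 + 1" by (simp add: add_nonneg_pos)
  have \<eta>: "0 < \<eta>" using \<theta> p1 by (simp add: \<eta>_def)
  obtain C where C: "0 \<le> C" and bound: "\<And>\<phi> N E. \<phi> \<in> borel_measurable M \<Longrightarrow> 0 \<le> N \<Longrightarrow>
            orlicz_norm (young_A \<sigma>) v \<Omega> \<phi> \<le> ennreal N \<Longrightarrow> E \<in> sets M \<Longrightarrow>
            integrable M (\<lambda>x. indicator E x * ((h x)\<^sup>2 * (\<phi> x)\<^sup>2 * v x)) \<and>
            (LINT x|M. indicator E x * ((h x)\<^sup>2 * (\<phi> x)\<^sup>2 * v x))
              \<le> N\<^sup>2 * (\<eta> + C * (LINT x|M. indicator E x * v x))"
    using orlicz_multiplier_bound[OF weight weight_integrable sigma lam hm h0 l \<eta>] by blast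
  have core: "square_integrable M (\<lambda>x. sqrtv x * (indicator E x * (h x * \<phi> x)))"
    "(L2norm M (\<lambda>x. sqrtv x * (indicator E x * (h x * \<phi> x))))\<^sup>2
       \<le> (S2 * gnorm (grad \<phi>))\<^sup>2 * (\<eta> + C * (LINT x|M. indicator E x * v x))"
    if \<phi>: "\<phi> \<in> X" and E [measurable]: "E \<in> sets M" for \<phi> E
  proof -
    note [measurable] = X_D(4)[OF \<phi>]
    have b: "integrable M (\<lambda>x. indicator E x * ((h x)\<^sup>2 * (\<phi> x)\<^sup>2 * v x))"
      "(LINT x|M. indicator E x * ((h x)\<^sup>2 * (\<phi> x)\<^sup>2 * v x)) \<le> (S2 * gnorm (grad \<phi>))\<^sup>2 * (\<eta> + C * (LINT x|M. indicator E x * v x))"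
      using bound[OF X_D(4)[OF \<phi>] _ sobolev[OF \<phi>] E] S2 by auto
    have eq: "(sqrtv x * (indicator E x * (h x * \<phi> x)))\<^sup>2 = indicator E x * ((h x)\<^sup>2 * (\<phi> x)\<^sup>2 * v x)" if "x \<in> \<Omega>" for x
      using sqrtv_power2[OF that] by (auto simp: power_mult_distrib indicator_def)
    have "integrable M (\<lambda>x. (sqrtv x * (indicator E x * (h x * \<phi> x)))\<^sup>2)"
      using b(1) by (rule Bochner_Integration.integrable_cong[THEN iffD2, rotated -1]) (simp_all add: space_M eq)
    moreover have "(\<lambda>x. sqrtv x * (indicator E x * (h x * \<phi> x))) \<in> borel_measurable M" by measurable
    ultimately show "square_integrable M (\<lambda>x. sqrtv x * (indicator E x * (h x * \<phi> x)))"
      unfolding square_integrable_def by blast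
    have "(L2norm M (\<lambda>x. sqrtv x * (indicator E x * (h x * \<phi> x))))\<^sup>2 = (LINT x|M. indicator E x * ((h x)\<^sup>2 * (\<phi> x)\<^sup>2 * v x))"
      unfolding L2norm_power2 by (rule Bochner_Integration.integral_cong) (simp_all add: space_M eq)
    with b(2) show "(L2norm M (\<lambda>x. sqrtv x * (indicator E x * (h x * \<phi> x))))\<^sup>2
       \<le> (S2 * gnorm (grad \<phi>))\<^sup>2 * (\<eta> + C * (LINT x|M. indicator E x * v x))" by simp
  qed
  show "\<exists>\<delta>>0. \<forall>\<phi>\<in>X. \<forall>E\<in>sets M. (LINT x|M. indicator E x * v x) \<le> \<delta> \<longrightarrow>
           square_integrable M (\<lambda>x. sqrtv x * (indicator E x * (h x * \<phi> x))) \<and>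
           L2norm M (\<lambda>x. sqrtv x * (indicator E x * (h x * \<phi> x))) \<le> \<theta> * gnorm (grad \<phi>)"
  proof (intro exI[of _ "\<eta> / (C + 1)"] conjI ballI impI)
    show "0 < \<eta> / (C + 1)" using \<eta> C by simp
    fix \<phi> E assume \<phi>: "\<phi> \<in> X" and E: "E \<in> sets M" and le: "(LINT x|M. indicator E x * v x) \<le> \<eta> / (C + 1)"
    show "square_integrable M (\<lambda>x. sqrtv x * (indicator E x * (h x * \<phi> x)))" by (rule core(1)[OF \<phi> E])
    let ?q = "gnorm (grad \<phi>)"
    have "C * (LINT x|M. indicator E x * v x) \<le> C * (\<eta> / (C + 1))" using le C by (rule mult_left_mono)
    also have "\<dots> \<le> \<eta>" using C \<eta> by (simp add: field_simps)
    finally have "(S2 * ?q)\<^sup>2 * (\<eta> + C * (LINT x|M. indicator E x * v x)) \<le> (S2 * ?q)\<^sup>2 * (2 * \<eta>)"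
      by (intro mult_left_mono) auto
    also have "\<dots> = S2\<^sup>2 / (S2\<^sup>2 + 1) * (\<theta>\<^sup>2 * ?q\<^sup>2)" using p1 by (simp add: \<eta>_def power_mult_distrib field_simps)
    also have "\<dots> \<le> 1 * (\<theta>\<^sup>2 * ?q\<^sup>2)" using p1 by (intro mult_right_mono) (auto simp: divide_le_eq_1)
    finally have "(L2norm M (\<lambda>x. sqrtv x * (indicator E x * (h x * \<phi> x))))\<^sup>2 \<le> (\<theta> * ?q)\<^sup>2"
      using core(2)[OF \<phi> E] by (simp add: power_mult_distrib)
    then show "L2norm M (\<lambda>x. sqrtv x * (indicator E x * (h x * \<phi> x))) \<le> \<theta> * ?q"
      by (rule power2_le_imp_le) (use \<theta> in simp)
  qed
  define V where "V = (LINT x|M. indicator \<Omega> x * v x)"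
  have V: "0 \<le> V" unfolding V_def using v_nonneg by (intro integral_nonneg_AE AE_I2) (simp add: space_M)
  define c where "c = S2 * sqrt (\<eta> + C * V)"
  have c0: "0 \<le> c" using S2 \<eta> C V by (simp add: c_def)
  have \<Omega>M: "\<Omega> \<in> sets M" using sets.top[of M] by (simp add: space_M)
  have X1: "square_integrable M (\<lambda>x. sqrtv x * (h x * \<phi> x))"
    "L2norm M (\<lambda>x. sqrtv x * (h x * \<phi> x)) \<le> c * gnorm (grad \<phi>)" if \<phi>: "\<phi> \<in> X" for \<phi>
  proof -
    note [measurable] = X_D(4)[OF \<phi>]
    have m: "(\<lambda>x. sqrtv x * (h x * \<phi> x)) \<in> borel_measurable M" by measurable
    have "AE x in M. \<bar>sqrtv x * (h x * \<phi> x)\<bar> \<le> \<bar>sqrtv x * (indicator \<Omega> x * (h x * \<phi> x))\<bar>"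
      by (intro AE_I2) (simp add: space_M)
    note r = square_integrable_bound[OF core(1)[OF \<phi> \<Omega>M] m this]
    show "square_integrable M (\<lambda>x. sqrtv x * (h x * \<phi> x))" by (rule r(1))
    have "(L2norm M (\<lambda>x. sqrtv x * (indicator \<Omega> x * (h x * \<phi> x))))\<^sup>2 \<le> (c * gnorm (grad \<phi>))\<^sup>2"
      using core(2)[OF \<phi> \<Omega>M] \<eta> C V by (simp add: c_def V_def power_mult_distrib mult_ac)
    then have "L2norm M (\<lambda>x. sqrtv x * (indicator \<Omega> x * (h x * \<phi> x))) \<le> c * gnorm (grad \<phi>)"
      by (rule power2_le_imp_le) (use c0 in simp)
    with r(2) show "L2norm M (\<lambda>x. sqrtv x * (h x * \<phi> x)) \<le> c * gnorm (grad \<phi>)" by linarith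
  qed
  show "\<exists>c\<ge>0. \<forall>p\<in>W. square_integrable M (\<lambda>x. sqrtv x * (h x * fst p x)) \<and>
           L2norm M (\<lambda>x. sqrtv x * (h x * fst p x)) \<le> c * gnorm (snd p)"
    using c0 W_multiplier_extend[OF hm c0 X1] by blast
qed

lemma W_dense:
  assumes "p \<in> W"
  obtains \<phi> where "\<And>n. \<phi> n \<in> X" "(\<lambda>n. energy.nrm (p - (\<phi> n, grad (\<phi> n)))) \<longlonglongrightarrow> 0"
proof -
  obtain \<phi> where "\<And>n. \<phi> n \<in> X" "(\<lambda>n. gnorm (\<lambda>x. snd p x - grad (\<phi> n) x)) \<longlonglongrightarrow> 0"
    using assms W_iff by blast
  then show ?thesis using that[of \<phi>] by (simp add: energy_nrm fun_diff_def)
qed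

lemma right_bounded_below_of_dense:
  assumes a: "energy.bilinear_on_W a" and K: "0 \<le> K" "\<And>p q. p \<in> W \<Longrightarrow> q \<in> W \<Longrightarrow> \<bar>a p q\<bar> \<le> K * energy.nrm p * energy.nrm q"
    and C: "0 \<le> C" "\<And>w m. w \<in> X \<Longrightarrow> 0 \<le> m \<Longrightarrow> (\<And>q. q \<in> W \<Longrightarrow> \<bar>a q (w, grad w)\<bar> \<le> m * energy.nrm q)
             \<Longrightarrow> gnorm (grad w) \<le> C * m"
  shows "energy.right_bounded_below a C"
  unfolding energy.right_bounded_below_def
proof (intro ballI allI impI)
  fix p m assume p: "p \<in> W" and m: "0 \<le> m" and le: "\<forall>q\<in>W. \<bar>a q p\<bar> \<le> m * energy.nrm q"
  obtain \<phi> where \<phi>: "\<And>n. \<phi> n \<in> X" "(\<lambda>n. energy.nrm (p - (\<phi> n, grad (\<phi> n)))) \<longlonglongrightarrow> 0"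
    using W_dense[OF p] by blast
  define e where "e = (\<lambda>n. energy.nrm (p - (\<phi> n, grad (\<phi> n))))"
  have PW: "(\<phi> n, grad (\<phi> n)) \<in> W" for n by (rule X_pair_in_W[OF \<phi>(1)])
  have dW: "p - (\<phi> n, grad (\<phi> n)) \<in> W" for n by (rule energy.W_diff[OF p PW])
  have e0: "0 \<le> e n" for n unfolding e_def by (rule energy.nrm_nonneg[OF dW])
  have "energy.nrm p \<le> C * (m + K * e n) + e n" for n
  proof -
    have "gnorm (grad (\<phi> n)) \<le> C * (m + K * e n)"
    proof (rule C(2)[OF \<phi>(1)])
      show "0 \<le> m + K * e n" using m K e0 by simp
      fix q assume q: "q \<in> W"
      have "a q (p - (\<phi> n, grad (\<phi> n))) = a q p - a q (\<phi> n, grad (\<phi> n))"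
        by (rule energy.bilinear_on_W_diff(2)[OF a p PW q])
      moreover have "\<bar>a q (p - (\<phi> n, grad (\<phi> n)))\<bar> \<le> K * energy.nrm q * e n"
        unfolding e_def by (rule K(2)[OF q dW])
      moreover have "\<bar>a q p\<bar> \<le> m * energy.nrm q" using le q by blast
      ultimately show "\<bar>a q (\<phi> n, grad (\<phi> n))\<bar> \<le> (m + K * e n) * energy.nrm q"
        by (simp add: algebra_simps)
    qed
    moreover have "energy.nrm p \<le> energy.nrm (\<phi> n, grad (\<phi> n)) + e n"
      unfolding e_def by (rule energy.nrm_triangle_diff[OF p PW])
    ultimately show ?thesis by (simp add: energy_nrm)
  qed
  moreover have "(\<lambda>n. C * (m + K * e n) + e n) \<longlonglongrightarrow> C * (m + K * 0) + 0"
    unfolding e_def by (intro tendsto_intros \<phi>(2))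
  ultimately have "energy.nrm p \<le> C * (m + K * 0) + 0" by (intro LIMSEQ_le_const) auto
  then show "energy.nrm p \<le> C * m" by simp
qed

lemma form_vanishes_of_dense:
  assumes a: "energy.bilinear_on_W a" and K: "0 \<le> K" "\<And>p q. p \<in> W \<Longrightarrow> q \<in> W \<Longrightarrow> \<bar>a p q\<bar> \<le> K * energy.nrm p * energy.nrm q"
    and d: "d \<in> W" and z: "\<And>\<phi>. \<phi> \<in> X \<Longrightarrow> a d (\<phi>, grad \<phi>) = 0" and q: "q \<in> W"
  shows "a d q = 0"
proof -
  obtain \<phi> where \<phi>: "\<And>n. \<phi> n \<in> X" "(\<lambda>n. energy.nrm (q - (\<phi> n, grad (\<phi> n)))) \<longlonglongrightarrow> 0"
    using W_dense[OF q] by blast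
  have PW: "(\<phi> n, grad (\<phi> n)) \<in> W" for n by (rule X_pair_in_W[OF \<phi>(1)])
  have "\<bar>a d q\<bar> \<le> K * energy.nrm d * energy.nrm (q - (\<phi> n, grad (\<phi> n)))" for n
    using K(2)[OF d energy.W_diff[OF q PW]] energy.bilinear_on_W_diff(2)[OF a q PW d] z[OF \<phi>(1)] by simp
  moreover have "(\<lambda>n. K * energy.nrm d * energy.nrm (q - (\<phi> n, grad (\<phi> n)))) \<longlonglongrightarrow> K * energy.nrm d * 0"
    by (intro tendsto_intros \<phi>(2))
  ultimately have "\<bar>a d q\<bar> \<le> K * energy.nrm d * 0" by (intro LIMSEQ_le_const) auto
  then show ?thesis by simp
qed

text \<open>The gradient vanishes as \<open>Q\<close> is invertible almost everywhere, the function by the Sobolev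
inequality.\<close>

lemma W_zero_AE:
  assumes d: "d \<in> W" and z: "energy.nrm d = 0"
  shows "AE x in M. fst d x = 0" "AE x in M. snd d x = 0"
proof -
  have q: "L2norm M (Qlen (snd d)) = 0" using z by (simp add: energy_nrm QL2_norm_eq)
  have "square_integrable M (Qlen (snd d))" using W_D(2)[OF d] by (simp add: QL2_space_iff)
  from L2norm_eq_0_AE[OF this q] have "AE x in M. Qlen (snd d) x = 0" .
  moreover have "AE x in M. invertible (Q x)" using matrix_function by (simp add: matrix_function_def)
  ultimately show "AE x in M. snd d x = 0" using AE_space
    by eventually_elim (use matrix_sqrt_injective[OF Q_psd] in \<open>auto simp: Qlen_def space_M\<close>)
  have "vnorm (fst d) \<le> S2 * 0" using W_Lp_bound[OF d] z by (simp add: energy_nrm)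
  then have "vnorm (fst d) = 0" using Lp_norm_nonneg[of "fst d"] by simp
  then have u: "L2norm M (\<lambda>x. sqrtv x * fst d x) = 0" by (simp add: Lp_norm_real_eq)
  have "square_integrable M (\<lambda>x. sqrtv x * fst d x)" using W_D(1)[OF d] by (simp add: Lp_space_real_iff)
  from L2norm_eq_0_AE[OF this u] show "AE x in M. fst d x = 0"
    using sqrtv_pos by eventually_elim simp
qed

end

section \<open>The a priori estimate for the adjoint problem\<close>

locale dirichlet_problem = weighted_sobolev \<Omega> v Q \<sigma> S2
  for \<Omega> :: "(real^'n) set" and v Q \<sigma> S2 +
  fixes lam :: real and F :: "real^'n \<Rightarrow> real" and G H :: "real^'n \<Rightarrow> real^'N"
    and R S :: "'N \<Rightarrow> real^'n \<Rightarrow> real^'n"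
  assumes lam: "0 < lam" "lam < 1"
    and F_Lp: "F \<in> Lp_space 2 v \<Omega>" and G_Lp: "G \<in> Lp_space 2 v \<Omega>" and H_Lp: "H \<in> Lp_space 2 v \<Omega>"
    and R_subunit: "\<forall>i. degenerate_subunit Q v \<Omega> (R i)"
    and S_subunit: "\<forall>i. degenerate_subunit Q v \<Omega> (S i)"
    and lower_order_nonneg: "\<And>\<phi>. \<phi> \<in> QLip_0 Q v \<Omega> \<Longrightarrow> (\<And>x. x \<in> \<Omega> \<Longrightarrow> 0 \<le> \<phi> x) \<Longrightarrow>
       0 \<le> (LINT x|lebesgue_on \<Omega>. (dot_fields G S (grad \<phi>) x + F x * \<phi> x) * v x)"
    and H_orlicz: "H \<in> orlicz_space (young_C lam \<sigma>) v \<Omega>"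
    and G_orlicz: "G \<in> orlicz_space (young_C lam \<sigma>) v \<Omega>"
    and F_orlicz: "F \<in> orlicz_space (young_D lam \<sigma>) v \<Omega>"
begin

lemma coefficient_measurable [measurable]:
  "F \<in> borel_measurable M" "G \<in> borel_measurable M" "H \<in> borel_measurable M"
  using F_Lp G_Lp H_Lp by (simp_all add: Lp_space_iff)

lemma norm_admissible_multiplier:
  fixes K :: "real^'n \<Rightarrow> real^'N"
  assumes K: "K \<in> orlicz_space (young_C lam \<sigma>) v \<Omega>"
  shows "admissible_multiplier lam (\<lambda>x. norm (K x))"
proof -
  have [measurable]: "K \<in> borel_measurable M" and lt: "orlicz_norm (young_C lam \<sigma>) v \<Omega> K < \<infinity>"
    using K by (auto simp: orlicz_space_def)
  show ?thesis using lt unfolding admissible_multiplier_def orlicz_norm_less_iff by auto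
qed

text \<open>\<open>young_D\<close> is \<open>young_C\<close> evaluated at a square root, so \<open>|F|\<^sup>1\<^sup>/\<^sup>2\<close> is a multiplier of the same kind
as \<open>|H|\<close> and \<open>|G|\<close>, to be applied once to each argument of the form.\<close>

lemma sqrt_admissible_multiplier: "admissible_multiplier lam (\<lambda>x. sqrt \<bar>F x\<bar>)"
proof -
  have lt: "orlicz_norm (young_D lam \<sigma>) v \<Omega> F < \<infinity>" using F_orlicz by (auto simp: orlicz_space_def)
  then obtain l where l: "0 < l" "(\<integral>\<^sup>+x. ennreal (young_D lam \<sigma> (norm (F x) / l) * v x) \<partial>M) \<le> 1"
    unfolding orlicz_norm_less_iff by auto
  have eq: "young_C lam \<sigma> (sqrt \<bar>F x\<bar> / sqrt l) = young_D lam \<sigma> (norm (F x) / l)" for x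
  proof -
    have "sqrt \<bar>F x\<bar> / sqrt l = (\<bar>F x\<bar> / l) powr (1/2)"
      using l(1) by (simp add: powr_half_sqrt real_sqrt_divide)
    then show ?thesis by (simp add: young_C_def young_D_def powr_powr)
  qed
  show ?thesis unfolding admissible_multiplier_def
    using l by (auto simp: eq intro!: exI[of _ "sqrt l"])
qed

definition lower_order_integrand ::
    "(real^'n \<Rightarrow> real) \<times> (real^'n \<Rightarrow> real^'n) \<Rightarrow> (real^'n \<Rightarrow> real) \<times> (real^'n \<Rightarrow> real^'n) \<Rightarrow> real^'n \<Rightarrow> real" where
  "lower_order_integrand p q x =
     dot_fields H R (snd p) x * fst q x * v x + fst p x * dot_fields G S (snd q) x * v x + F x * fst p x * fst q x * v x"

definition lower_order ::
    "(real^'n \<Rightarrow> real) \<times> (real^'n \<Rightarrow> real^'n) \<Rightarrow> (real^'n \<Rightarrow> real) \<times> (real^'n \<Rightarrow> real^'n) \<Rightarrow> real" where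
  "lower_order p q = (LINT x|M. lower_order_integrand p q x)"

lemma field_bounds_exist: "\<exists>c. field_bound R c \<and> field_bound S c"
proof -
  obtain c d where "field_bound R c" "field_bound S d"
    using field_bound_exists[OF R_subunit] field_bound_exists[OF S_subunit] by blast
  then show ?thesis using field_bound_mono[of R c "max c d"] field_bound_mono[of S d "max c d"] by auto
qed

lemma multiplier_bounds_exist:
  "\<exists>c\<ge>0. \<forall>p\<in>W. square_integrable M (\<lambda>x. sqrtv x * (norm (H x) * fst p x)) \<and>
      L2norm M (\<lambda>x. sqrtv x * (norm (H x) * fst p x)) \<le> c * gnorm (snd p)"
  "\<exists>c\<ge>0. \<forall>p\<in>W. square_integrable M (\<lambda>x. sqrtv x * (norm (G x) * fst p x)) \<and>
      L2norm M (\<lambda>x. sqrtv x * (norm (G x) * fst p x)) \<le> c * gnorm (snd p)"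
  "\<exists>c\<ge>0. \<forall>p\<in>W. square_integrable M (\<lambda>x. sqrtv x * (sqrt \<bar>F x\<bar> * fst p x)) \<and>
      L2norm M (\<lambda>x. sqrtv x * (sqrt \<bar>F x\<bar> * fst p x)) \<le> c * gnorm (snd p)"
  using multiplier_small_on_small_sets(2)[OF lam norm_admissible_multiplier[OF H_orlicz] zero_less_one]
    multiplier_small_on_small_sets(2)[OF lam norm_admissible_multiplier[OF G_orlicz] zero_less_one]
    multiplier_small_on_small_sets(2)[OF lam sqrt_admissible_multiplier zero_less_one] by blast+

lemma lower_order_terms:
  "\<exists>K\<ge>0. \<forall>p\<in>W. \<forall>q\<in>W.
     integrable M (\<lambda>x. dot_fields H R (snd p) x * fst q x * v x) \<and>
     integrable M (\<lambda>x. fst p x * dot_fields G S (snd q) x * v x) \<and>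
     integrable M (\<lambda>x. F x * fst p x * fst q x * v x) \<and>
     \<bar>lower_order p q\<bar> \<le> K * energy.nrm p * energy.nrm q"
proof -
  obtain c where c: "field_bound R c" "field_bound S c" using field_bounds_exist by blast
  obtain a where a: "0 \<le> a" "\<And>p. p \<in> W \<Longrightarrow> square_integrable M (\<lambda>x. sqrtv x * (norm (H x) * fst p x))"
      "\<And>p. p \<in> W \<Longrightarrow> L2norm M (\<lambda>x. sqrtv x * (norm (H x) * fst p x)) \<le> a * gnorm (snd p)"
    using multiplier_bounds_exist(1) by blast
  obtain b where b: "0 \<le> b" "\<And>p. p \<in> W \<Longrightarrow> square_integrable M (\<lambda>x. sqrtv x * (norm (G x) * fst p x))"
      "\<And>p. p \<in> W \<Longrightarrow> L2norm M (\<lambda>x. sqrtv x * (norm (G x) * fst p x)) \<le> b * gnorm (snd p)"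
    using multiplier_bounds_exist(2) by blast
  obtain d where d: "0 \<le> d" "\<And>p. p \<in> W \<Longrightarrow> square_integrable M (\<lambda>x. sqrtv x * (sqrt \<bar>F x\<bar> * fst p x))"
      "\<And>p. p \<in> W \<Longrightarrow> L2norm M (\<lambda>x. sqrtv x * (sqrt \<bar>F x\<bar> * fst p x)) \<le> d * gnorm (snd p)"
    using multiplier_bounds_exist(3) by blast
  have c0: "0 \<le> c" using c by (simp add: field_bound_def)
  define n where "n = real CARD('N)"
  have n0: "0 \<le> n" by (simp add: n_def)
  have 1: "integrable M (\<lambda>x. dot_fields H R (snd p) x * fst q x * v x)"
    "\<bar>LINT x|M. dot_fields H R (snd p) x * fst q x * v x\<bar> \<le> n * c * a * energy.nrm p * energy.nrm q"
    if p: "p \<in> W" and q: "q \<in> W" for p q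
  proof -
    note r = dot_fields_bound[OF coefficient_measurable(3) W_D(3)[OF q] a(2)[OF q] c(1) p]
    show "integrable M (\<lambda>x. dot_fields H R (snd p) x * fst q x * v x)" by (rule r(1))
    have "\<bar>LINT x|M. dot_fields H R (snd p) x * fst q x * v x\<bar> \<le> n * c * gnorm (snd p) * (a * gnorm (snd q))"
      using c0 n0 by (intro order_trans[OF r(2)[folded n_def]] mult_left_mono[OF a(3)[OF q]]) simp
    then show "\<bar>LINT x|M. dot_fields H R (snd p) x * fst q x * v x\<bar> \<le> n * c * a * energy.nrm p * energy.nrm q"
      by (simp add: energy_nrm mult_ac)
  qed
  have 2: "integrable M (\<lambda>x. fst p x * dot_fields G S (snd q) x * v x)"
    "\<bar>LINT x|M. fst p x * dot_fields G S (snd q) x * v x\<bar> \<le> n * c * b * energy.nrm p * energy.nrm q"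
    if p: "p \<in> W" and q: "q \<in> W" for p q
  proof -
    have e: "fst p x * dot_fields G S (snd q) x * v x = dot_fields G S (snd q) x * fst p x * v x" for x by simp
    note r = dot_fields_bound[OF coefficient_measurable(2) W_D(3)[OF p] b(2)[OF p] c(2) q]
    show "integrable M (\<lambda>x. fst p x * dot_fields G S (snd q) x * v x)" unfolding e by (rule r(1))
    have "\<bar>LINT x|M. dot_fields G S (snd q) x * fst p x * v x\<bar> \<le> n * c * gnorm (snd q) * (b * gnorm (snd p))"
      using c0 n0 by (intro order_trans[OF r(2)[folded n_def]] mult_left_mono[OF b(3)[OF p]]) simp
    then show "\<bar>LINT x|M. fst p x * dot_fields G S (snd q) x * v x\<bar> \<le> n * c * b * energy.nrm p * energy.nrm q"
      unfolding e by (simp add: energy_nrm mult_ac)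
  qed
  have 3: "integrable M (\<lambda>x. F x * fst p x * fst q x * v x)"
    "\<bar>LINT x|M. F x * fst p x * fst q x * v x\<bar> \<le> d * d * energy.nrm p * energy.nrm q"
    if p: "p \<in> W" and q: "q \<in> W" for p q
  proof -
    note [measurable] = W_D(3)[OF p] W_D(3)[OF q]
    let ?f = "\<lambda>x. sgn (F x) * (sqrtv x * (sqrt \<bar>F x\<bar> * fst p x))" and ?g = "\<lambda>x. sqrtv x * (sqrt \<bar>F x\<bar> * fst q x)"
    have m: "?f \<in> borel_measurable M" by measurable
    have "AE x in M. \<bar>?f x\<bar> \<le> \<bar>sqrtv x * (sqrt \<bar>F x\<bar> * fst p x)\<bar>"
      by (intro AE_I2) (simp add: abs_mult abs_sgn_eq)
    note f = square_integrable_bound[OF d(2)[OF p] m this]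
    have e: "F x * fst p x * fst q x * v x = ?f x * ?g x" if "x \<in> \<Omega>" for x
    proof -
      have "?f x * ?g x = (sgn (F x) * (sqrt \<bar>F x\<bar> * sqrt \<bar>F x\<bar>)) * fst p x * fst q x * (sqrtv x * sqrtv x)"
        by (simp only: mult_ac)
      also have "sgn (F x) * (sqrt \<bar>F x\<bar> * sqrt \<bar>F x\<bar>) = F x" by (simp add: sgn_mult_abs)
      also have "F x * fst p x * fst q x * (sqrtv x * sqrtv x) = F x * fst p x * fst q x * v x"
        by (simp only: sqrtv_mult[OF that])
      finally show ?thesis by (rule sym)
    qed
    note r = square_integrable_mult[OF f(1) d(2)[OF q]]
    show "integrable M (\<lambda>x. F x * fst p x * fst q x * v x)"
      using r(1) by (rule Bochner_Integration.integrable_cong[THEN iffD1, rotated -1]) (simp_all add: space_M e)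
    have eqI: "(LINT x|M. F x * fst p x * fst q x * v x) = (LINT x|M. ?f x * ?g x)"
      by (rule Bochner_Integration.integral_cong) (simp_all add: space_M e)
    have "\<bar>LINT x|M. F x * fst p x * fst q x * v x\<bar> \<le> L2norm M ?f * L2norm M ?g"
      unfolding eqI by (rule r(2))
    then have "\<bar>LINT x|M. F x * fst p x * fst q x * v x\<bar> \<le> (d * gnorm (snd p)) * (d * gnorm (snd q))"
      by (rule order_trans, intro mult_mono order_trans[OF f(2) d(3)[OF p]] d(3)[OF q]) (use d(1) in simp_all)
    then show "\<bar>LINT x|M. F x * fst p x * fst q x * v x\<bar> \<le> d * d * energy.nrm p * energy.nrm q"
      by (simp add: energy_nrm mult_ac)
  qed
  have 4: "\<bar>lower_order p q\<bar> \<le> (n * c * a + n * c * b + d * d) * energy.nrm p * energy.nrm q"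
    if p: "p \<in> W" and q: "q \<in> W" for p q
  proof -
    have "lower_order p q = (LINT x|M. dot_fields H R (snd p) x * fst q x * v x)
        + (LINT x|M. fst p x * dot_fields G S (snd q) x * v x) + (LINT x|M. F x * fst p x * fst q x * v x)"
      unfolding lower_order_def lower_order_integrand_def using 1(1)[OF p q] 2(1)[OF p q] 3(1)[OF p q] by simp
    then show ?thesis using 1(2)[OF p q] 2(2)[OF p q] 3(2)[OF p q] by (simp add: distrib_right)
  qed
  have "0 \<le> n * c * a + n * c * b + d * d" using n0 c0 a(1) b(1) by simp
  then show ?thesis
    by (intro exI[of _ "n * c * a + n * c * b + d * d"] conjI ballI 1(1) 2(1) 3(1) 4)
qed

lemma lower_order_integrable:
  assumes "p \<in> W" "q \<in> W"
  shows "integrable M (\<lambda>x. dot_fields H R (snd p) x * fst q x * v x)"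
    "integrable M (\<lambda>x. fst p x * dot_fields G S (snd q) x * v x)"
    "integrable M (\<lambda>x. F x * fst p x * fst q x * v x)"
    "integrable M (lower_order_integrand p q)"
proof -
  show 1: "integrable M (\<lambda>x. dot_fields H R (snd p) x * fst q x * v x)"
    "integrable M (\<lambda>x. fst p x * dot_fields G S (snd q) x * v x)"
    "integrable M (\<lambda>x. F x * fst p x * fst q x * v x)"
    using lower_order_terms assms by auto
  then show "integrable M (lower_order_integrand p q)"
    unfolding lower_order_integrand_def[abs_def] by simp
qed

lemma lower_order_eq:
  assumes "p \<in> W" "q \<in> W"
  shows "lower_order p q = (LINT x|M. dot_fields H R (snd p) x * fst q x * v x)
        + (LINT x|M. fst p x * dot_fields G S (snd q) x * v x) + (LINT x|M. F x * fst p x * fst q x * v x)"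
  unfolding lower_order_def lower_order_integrand_def using lower_order_integrable(1-3)[OF assms] by simp

lemma dot_fields_linear:
  "dot_fields K V (f + g) x = dot_fields K V f x + dot_fields K V g x"
  "dot_fields K V (c *\<^sub>R f) x = c * dot_fields K V f x"
  by (simp_all add: dot_fields_def scaleR_fun_def inner_add_right distrib_left sum.distrib sum_distrib_left mult.left_commute)

lemma lower_order_bilinear: "energy.bilinear_on_W lower_order"
  unfolding energy.bilinear_on_W_def
proof (intro conjI ballI allI)
  fix p q r assume p: "p \<in> W" and q: "q \<in> W" and r: "r \<in> W"
  have e: "lower_order_integrand (p + q) r x = lower_order_integrand p r x + lower_order_integrand q r x"
    "lower_order_integrand r (p + q) x = lower_order_integrand r p x + lower_order_integrand r q x" for x
    by (simp_all add: lower_order_integrand_def dot_fields_linear algebra_simps)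
  show "lower_order (p + q) r = lower_order p r + lower_order q r"
    unfolding lower_order_def e using lower_order_integrable(4)[OF p r] lower_order_integrable(4)[OF q r] by simp
  show "lower_order r (p + q) = lower_order r p + lower_order r q"
    unfolding lower_order_def e using lower_order_integrable(4)[OF r p] lower_order_integrable(4)[OF r q] by simp
next
  fix c p r
  have e: "lower_order_integrand (c *\<^sub>R p) r x = c * lower_order_integrand p r x"
    "lower_order_integrand r (c *\<^sub>R p) x = c * lower_order_integrand r p x" for x
    by (simp_all add: lower_order_integrand_def dot_fields_linear, simp_all add: scaleR_fun_def algebra_simps)
  show "lower_order (c *\<^sub>R p) r = c * lower_order p r" "lower_order r (c *\<^sub>R p) = c * lower_order r p"
    unfolding lower_order_def e by simp_all
qed

text \<open>Let \<open>\<phi> = \<beta>(w)\<close> and \<open>\<gamma> = w \<beta>(w) \<ge> 0\<close>. By the product rule,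
\<open>\<phi> (G \<bullet> S w) + F \<phi> w = (G \<bullet> S \<gamma> + F \<gamma>) - w (G \<bullet> S \<phi>)\<close>, and the integral of the bracket against
\<open>v\<close> is nonnegative.\<close>

lemma lower_order_test_bound:
  assumes w: "w \<in> X"
    and \<beta>: "\<And>s. DERIV \<beta> s :> \<beta>' s" "continuous_on UNIV \<beta>'" "\<beta> 0 = 0" "\<And>s. 0 \<le> s * \<beta> s"
  shows "(LINT x|M. dot_fields H R (grad (\<lambda>x. \<beta> (w x))) x * w x * v x) -
         (LINT x|M. dot_fields G S (grad (\<lambda>x. \<beta> (w x))) x * w x * v x)
         \<le> lower_order ((\<lambda>x. \<beta> (w x)), grad (\<lambda>x. \<beta> (w x))) (w, grad w)"
    and "integrable M (\<lambda>x. dot_fields G S (grad (\<lambda>x. \<beta> (w x))) x * w x * v x)"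
proof -
  let ?\<phi> = "\<lambda>x. \<beta> (w x)"
  let ?\<gamma> = "\<lambda>x. w x * \<beta> (w x)"
  have contb: "continuous_on UNIV \<beta>" using \<beta>(1) by (meson DERIV_continuous_on has_field_derivative_at_within)
  note \<phi> = X_compose[OF w \<beta>(1-3)]
  have d\<gamma>: "DERIV (\<lambda>s. s * \<beta> s) s :> \<beta> s + s * \<beta>' s" for s
    by (auto intro!: derivative_eq_intros \<beta>(1))
  have c\<gamma>: "continuous_on UNIV (\<lambda>s. \<beta> s + s * \<beta>' s)" by (intro continuous_intros contb \<beta>(2))
  have \<gamma>: "?\<gamma> \<in> X" "AE x in M. grad ?\<gamma> x = (\<beta> (w x) + w x * \<beta>' (w x)) *\<^sub>R grad w x"
    using X_compose[OF w d\<gamma> c\<gamma>] by simp_all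
  have PW: "(w, grad w) \<in> W" "(?\<phi>, grad ?\<phi>) \<in> W" "(?\<gamma>, grad ?\<gamma>) \<in> W"
    using w \<phi>(1) \<gamma>(1) by (auto intro: X_pair_in_W)
  have i1: "integrable M (\<lambda>x. dot_fields H R (grad ?\<phi>) x * w x * v x)"
    using lower_order_integrable(1)[OF PW(2,1)] by simp
  have i2: "integrable M (\<lambda>x. w x * dot_fields G S (grad ?\<phi>) x * v x)"
    using lower_order_integrable(2)[OF PW(1,2)] by simp
  then show i3: "integrable M (\<lambda>x. dot_fields G S (grad ?\<phi>) x * w x * v x)" by (simp add: mult.commute mult.left_commute)
  define I where "I = (\<lambda>x. dot_fields H R (grad ?\<phi>) x * w x * v x - dot_fields G S (grad ?\<phi>) x * w x * v x)"
  have ae: "AE x in M. lower_order_integrand (?\<phi>, grad ?\<phi>) (w, grad w) x - I x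
       = (dot_fields G S (grad ?\<gamma>) x + F x * ?\<gamma> x) * v x"
    using \<phi>(2) \<gamma>(2)
  proof eventually_elim
    case (elim x)
    have "dot_fields G S (grad ?\<phi>) x = \<beta>' (w x) * dot_fields G S (grad w) x"
      "dot_fields G S (grad ?\<gamma>) x = (\<beta> (w x) + w x * \<beta>' (w x)) * dot_fields G S (grad w) x"
      by (simp_all add: dot_fields_def elim sum_distrib_left mult_ac)
    then show ?case by (simp add: lower_order_integrand_def I_def algebra_simps)
  qed
  have iI: "integrable M I" unfolding I_def using i1 i3 by simp
  have iL: "integrable M (lower_order_integrand (?\<phi>, grad ?\<phi>) (w, grad w))"
    by (rule lower_order_integrable(4)[OF PW(2,1)])
  have meas: "(\<lambda>x. (dot_fields G S (grad ?\<gamma>) x + F x * ?\<gamma> x) * v x) \<in> borel_measurable M"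
  proof -
    have "(\<lambda>x. lower_order_integrand (?\<phi>, grad ?\<phi>) (w, grad w) x - I x) \<in> borel_measurable M"
      using iI iL by auto
    then show ?thesis by (rule borel_measurable_AE_lebesgue_on[OF Omega_sets _ ae])
  qed
  have "0 \<le> (LINT x|M. (dot_fields G S (grad ?\<gamma>) x + F x * ?\<gamma> x) * v x)"
    by (rule lower_order_nonneg[OF \<gamma>(1) \<beta>(4)])
  also have "\<dots> = (LINT x|M. lower_order_integrand (?\<phi>, grad ?\<phi>) (w, grad w) x - I x)"
    using ae iI iL meas by (intro integral_cong_AE) (auto elim: eventually_mono)
  also have "\<dots> = lower_order (?\<phi>, grad ?\<phi>) (w, grad w) - (LINT x|M. I x)"
    using iL iI by (simp add: lower_order_def)
  also have "(LINT x|M. I x) = (LINT x|M. dot_fields H R (grad ?\<phi>) x * w x * v x) - (LINT x|M. dot_fields G S (grad ?\<phi>) x * w x * v x)"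
    unfolding I_def using i1 i3 by simp
  finally show "(LINT x|M. dot_fields H R (grad ?\<phi>) x * w x * v x) - (LINT x|M. dot_fields G S (grad ?\<phi>) x * w x * v x)
         \<le> lower_order (?\<phi>, grad ?\<phi>) (w, grad w)" by simp
qed

text \<open>Test with \<open>y = arctan w\<close> and express the result by \<open>z = arsinh w\<close>. Since \<open>arctan' = (arsinh')\<^sup>2\<close>,
the energy of \<open>y\<close> against \<open>w\<close> is that of \<open>z\<close> with itself, and \<open>(R y) w = (R z) r\<close> with
\<open>r = w / (w\<^sup>2 + 1)\<^sup>1\<^sup>/\<^sup>2\<close>. As \<open>|r| \<le> 1\<close>, the lower order terms are at most linear in \<open>|z|\<close>.\<close>

lemma log_estimate:
  assumes c: "field_bound R c" "field_bound S c"
    and w: "w \<in> X" and t: "0 \<le> t" "t \<le> 1"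
    and le: "\<And>q. q \<in> W \<Longrightarrow> \<bar>energy q (w, grad w) + t * lower_order q (w, grad w)\<bar> \<le> energy.nrm q"
  shows "(\<lambda>x. arsinh (w x)) \<in> X"
    "gnorm (grad (\<lambda>x. arsinh (w x)))
       \<le> 1 + real CARD('N) * c * (vnorm H + vnorm G)"
proof -
  let ?y = "\<lambda>x. arctan (w x)" and ?z = "\<lambda>x. arsinh (w x)"
  note [measurable] = X_D(4)[OF w]
  have p1: "0 < 1 + s\<^sup>2" for s :: real by (simp add: add_pos_nonneg)
  have cont1: "continuous_on UNIV (\<lambda>s::real. inverse (1 + s\<^sup>2))"
    using p1 by (intro continuous_intros ballI) (metis less_irrefl)
  have cont2: "continuous_on UNIV (\<lambda>s::real. 1 / sqrt (s\<^sup>2 + 1))"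
    using p1 by (intro continuous_intros ballI) (metis add.commute less_irrefl real_sqrt_eq_zero_cancel_iff)
  note y = X_compose[OF w DERIV_arctan cont1 arctan_zero_zero]
  note z = X_compose[OF w arsinh_real_has_field_derivative cont2 arsinh_0]
  show "?z \<in> X" by (rule z(1))
  have PW: "(w, grad w) \<in> W" "(?y, grad ?y) \<in> W" "(?z, grad ?z) \<in> W"
    using w y(1) z(1) by (auto intro: X_pair_in_W)
  define r where "r = (\<lambda>x. w x / sqrt ((w x)\<^sup>2 + 1))"
  have r1: "\<bar>r x\<bar> \<le> 1" for x
  proof -
    have "\<bar>w x\<bar> \<le> sqrt ((w x)\<^sup>2 + 1)" using real_sqrt_le_mono[of "(w x)\<^sup>2" "(w x)\<^sup>2 + 1"] by simp
    moreover have "0 < (w x)\<^sup>2 + 1" using p1[of "w x"] by simp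
    ultimately show ?thesis by (simp add: r_def abs_divide divide_le_eq_1)
  qed
  have rm [measurable]: "r \<in> borel_measurable M" unfolding r_def by measurable
  have sq: "sqrt (s\<^sup>2 + 1) * sqrt (s\<^sup>2 + 1) = 1 + s\<^sup>2" for s :: real
    using p1[of s] by (simp add: add.commute)
  have inv: "inverse (1 + s\<^sup>2) = 1 / sqrt (s\<^sup>2 + 1) * (1 / sqrt (s\<^sup>2 + 1))" for s :: real
    by (simp only: times_divide_times_eq sq mult_1 inverse_eq_divide)
  have gr: "AE x in M. dot_fields K V (grad ?y) x * w x * v x = dot_fields K V (grad ?z) x * r x * v x"
    for K :: "real^'n \<Rightarrow> real^'N" and V
    using y(2) z(2)
  proof eventually_elim
    case (elim x)
    have "dot_fields K V (grad ?y) x = inverse (1 + (w x)\<^sup>2) * dot_fields K V (grad w) x"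
      "dot_fields K V (grad ?z) x = 1 / sqrt ((w x)\<^sup>2 + 1) * dot_fields K V (grad w) x"
      by (simp_all add: dot_fields_def elim sum_distrib_left mult_ac)
    moreover have "inverse (1 + (w x)\<^sup>2) = 1 / sqrt ((w x)\<^sup>2 + 1) * (1 / sqrt ((w x)\<^sup>2 + 1))"
      by (rule inv)
    ultimately show ?case by (simp add: r_def)
  qed
  have est: "\<bar>LINT x|M. dot_fields K V (grad ?y) x * w x * v x\<bar>
        \<le> real CARD('N) * c * gnorm (grad ?z) * vnorm K"
    if K: "K \<in> L2v" and V: "field_bound V c"
      and i: "integrable M (\<lambda>x. dot_fields K V (grad ?y) x * w x * v x)" for K :: "real^'n \<Rightarrow> real^'N" and V
  proof -
    have Km [measurable]: "K \<in> borel_measurable M" and Ks: "square_integrable M (\<lambda>x. sqrtv x * norm (K x))"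
      using K by (simp_all add: Lp_space_iff)
    have m: "(\<lambda>x. sqrtv x * (norm (K x) * r x)) \<in> borel_measurable M" by measurable
    have "AE x in M. \<bar>sqrtv x * (norm (K x) * r x)\<bar> \<le> \<bar>sqrtv x * norm (K x)\<bar>"
      using r1 by (intro AE_I2) (simp add: abs_mult mult_left_mono mult_left_le)
    note s = square_integrable_bound[OF Ks m this]
    note b = dot_fields_bound[OF Km rm s(1) V PW(3)]
    have "(LINT x|M. dot_fields K V (grad ?y) x * w x * v x) = (LINT x|M. dot_fields K V (grad ?z) x * r x * v x)"
      using gr[of K V] i b(1) by (intro integral_cong_AE) auto
    then have "\<bar>LINT x|M. dot_fields K V (grad ?y) x * w x * v x\<bar>
        \<le> real CARD('N) * c * gnorm (grad ?z) * L2norm M (\<lambda>x. sqrtv x * (norm (K x) * r x))"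
      using b(2) by simp
    also have "\<dots> \<le> real CARD('N) * c * gnorm (grad ?z) * vnorm K"
      using s(2) V by (intro mult_left_mono) (auto simp: Lp_norm_eq field_bound_def)
    finally show ?thesis .
  qed
  have sy: "0 \<le> s * arctan s" for s
    by (cases "0 \<le> s") (auto simp: mult_nonneg_nonneg mult_nonpos_nonpos)
  note test = lower_order_test_bound[OF w DERIV_arctan cont1 arctan_zero_zero sy]
  have iH: "integrable M (\<lambda>x. dot_fields H R (grad ?y) x * w x * v x)"
    using lower_order_integrable(1)[OF PW(2,1)] by simp
  define N where "N = real CARD('N) * c * (vnorm H + vnorm G)"
  define q where "q = gnorm (grad ?z)"
  have q0: "0 \<le> q" by (simp add: q_def)
  have N0: "0 \<le> N" using c(1) by (simp add: N_def field_bound_def)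
  have lower: "- (N * q) \<le> lower_order (?y, grad ?y) (w, grad w)"
    using test(1) est[OF H_Lp c(1) iH] est[OF G_Lp c(2) test(2)] unfolding N_def q_def
    by (simp add: algebra_simps)
  have en: "energy (?y, grad ?y) (w, grad w) = q\<^sup>2"
  proof -
    have "AE x in M. (Q x *v grad ?y x) \<bullet> grad w x = (Q x *v grad ?z x) \<bullet> grad ?z x"
      using y(2) z(2)
    proof eventually_elim
      case (elim x)
      have "inverse (1 + (w x)\<^sup>2) = 1 / sqrt ((w x)\<^sup>2 + 1) * (1 / sqrt ((w x)\<^sup>2 + 1))"
        by (rule inv)
      then show ?case by (simp add: elim matrix_vector_mult_scaleR)
    qed
    then have "energy (?y, grad ?y) (w, grad w) = energy (?z, grad ?z) (?z, grad ?z)"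
      unfolding energy_def using Q_form_measurable X_D(5)[OF w] X_D(5)[OF y(1)] X_D(5)[OF z(1)]
      by (intro integral_cong_AE) auto
    then show ?thesis by (simp add: energy_self q_def)
  qed
  have yz: "energy.nrm (?y, grad ?y) \<le> q"
  proof -
    have "L2norm M (Qlen (grad ?y)) \<le> L2norm M (Qlen (grad ?z))"
    proof (rule square_integrable_bound(2))
      show "square_integrable M (Qlen (grad ?z))" using X_D(3)[OF z(1)] by (simp add: QL2_space_iff)
      show "Qlen (grad ?y) \<in> borel_measurable M" by (rule Qlen_measurable[OF X_D(5)[OF y(1)]])
      show "AE x in M. \<bar>Qlen (grad ?y) x\<bar> \<le> \<bar>Qlen (grad ?z) x\<bar>"
        using y(2) z(2)
      proof eventually_elim
        case (elim x)
        have s1: "1 \<le> sqrt ((w x)\<^sup>2 + 1)" by simp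
        have "inverse (1 + (w x)\<^sup>2) = 1 / sqrt ((w x)\<^sup>2 + 1) * (1 / sqrt ((w x)\<^sup>2 + 1))"
          by (rule inv)
        also have "\<dots> \<le> 1 / sqrt ((w x)\<^sup>2 + 1) * 1"
        proof (rule mult_left_mono)
          have "1 / b \<le> 1" if "1 \<le> b" for b :: real using that by simp
          then show "1 / sqrt ((w x)\<^sup>2 + 1) \<le> 1" using s1 by blast
        qed simp
        finally have "inverse (1 + (w x)\<^sup>2) * Qlen (grad w) x \<le> 1 / sqrt ((w x)\<^sup>2 + 1) * Qlen (grad w) x"
          by (intro mult_right_mono) auto
        moreover have "Qlen (grad ?y) x = inverse (1 + (w x)\<^sup>2) * Qlen (grad w) x"
          unfolding Qlen_def elim matrix_vector_mult_scaleR norm_scaleR using p1[of "w x"] by simp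
        moreover have "Qlen (grad ?z) x = 1 / sqrt ((w x)\<^sup>2 + 1) * Qlen (grad w) x"
          unfolding Qlen_def elim matrix_vector_mult_scaleR norm_scaleR by simp
        ultimately show ?case by simp
      qed
    qed
    then show ?thesis by (simp add: energy_nrm QL2_norm_eq q_def)
  qed
  have "t * (- (N * q)) \<le> t * lower_order (?y, grad ?y) (w, grad w)"
    using lower t(1) by (rule mult_left_mono)
  moreover have "t * (N * q) \<le> 1 * (N * q)" using t N0 q0 by (intro mult_right_mono) auto
  moreover have "q\<^sup>2 + t * lower_order (?y, grad ?y) (w, grad w) \<le> q"
    using le[OF PW(2)] yz unfolding en by simp
  ultimately have "q * q \<le> (1 + N) * q" by (simp add: power2_eq_square algebra_simps)
  then have "q \<le> 1 + N" using q0 N0 by (metis add_nonneg_nonneg mult_le_cancel_right order_le_less zero_le_one)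
  then show "gnorm (grad ?z) \<le> 1 + real CARD('N) * c * (vnorm H + vnorm G)"
    by (simp add: q_def N_def)
qed

end

context dirichlet_problem
begin

text \<open>Chebyshev's inequality, combined with the Sobolev inequality.\<close>

lemma arsinh_large_set_small:
  assumes z: "(\<lambda>x. arsinh (w x)) \<in> X" and A: "0 < A" and E: "E = {x \<in> \<Omega>. A < \<bar>arsinh (w x)\<bar>}"
  shows "E \<in> sets M" "(LINT x|M. indicator E x * v x) \<le> (S2 * gnorm (grad (\<lambda>x. arsinh (w x))) / A)\<^sup>2"
proof -
  let ?z = "\<lambda>x. arsinh (w x)"
  note [measurable] = X_D(4)[OF z]
  have "E = {x \<in> space M. A < \<bar>?z x\<bar>}" by (simp add: E space_M)
  also have "\<dots> \<in> sets M" by measurable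
  finally show Em: "E \<in> sets M" .
  have sq: "square_integrable M (\<lambda>x. sqrtv x * ?z x)" using X_D(2)[OF z] by (simp add: Lp_space_real_iff)
  have i1: "integrable M (\<lambda>x. A\<^sup>2 * (indicator E x * v x))"
    using integrable_real_mult_indicator[OF Em weight_integrable] by (simp add: mult.commute)
  have "A\<^sup>2 * (LINT x|M. indicator E x * v x) = (LINT x|M. A\<^sup>2 * (indicator E x * v x))" by simp
  also have "\<dots> \<le> (LINT x|M. (sqrtv x * ?z x)\<^sup>2)"
  proof (rule integral_mono[OF i1])
    show "integrable M (\<lambda>x. (sqrtv x * ?z x)\<^sup>2)" using sq by (simp add: square_integrable_def)
    fix x assume "x \<in> space M"
    then have x: "x \<in> \<Omega>" by (simp add: space_M)
    show "A\<^sup>2 * (indicator E x * v x) \<le> (sqrtv x * ?z x)\<^sup>2"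
    proof (cases "x \<in> E")
      case True
      then have "A\<^sup>2 \<le> \<bar>?z x\<bar>\<^sup>2" using A by (intro power_mono) (auto simp: E)
      then have "A\<^sup>2 * v x \<le> (?z x)\<^sup>2 * v x" using v_nonneg[OF x] by (intro mult_right_mono) auto
      then show ?thesis using True by (simp add: power_mult_distrib sqrtv_power2[OF x] mult.commute)
    qed simp
  qed
  also have "\<dots> = (vnorm ?z)\<^sup>2" by (simp add: Lp_norm_real_eq L2norm_power2)
  also have "\<dots> \<le> (S2 * gnorm (grad ?z))\<^sup>2" by (rule power_mono[OF X_Lp_bound[OF z]]) simp
  finally show "(LINT x|M. indicator E x * v x) \<le> (S2 * gnorm (grad ?z) / A)\<^sup>2"
    using A by (simp add: power_divide pos_le_divide_eq mult.commute)
qed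

lemma multiplier_split:
  fixes K :: "real^'n \<Rightarrow> real^'N"
  assumes K: "K \<in> L2v" and w: "w \<in> X" and k: "0 \<le> k"
    and E: "E \<in> sets M" "\<And>x. x \<in> \<Omega> - E \<Longrightarrow> \<bar>w x\<bar> \<le> k"
    and s: "square_integrable M (\<lambda>x. sqrtv x * (indicator E x * (norm (K x) * w x)))"
      "L2norm M (\<lambda>x. sqrtv x * (indicator E x * (norm (K x) * w x))) \<le> b"
  shows "L2norm M (\<lambda>x. sqrtv x * (norm (K x) * w x)) \<le> k * vnorm K + b"
proof -
  note [measurable] = X_D(4)[OF w]
  have Km [measurable]: "K \<in> borel_measurable M" and Ks: "square_integrable M (\<lambda>x. sqrtv x * norm (K x))"
    using K by (simp_all add: Lp_space_iff)
  have m: "(\<lambda>x. sqrtv x * (norm (K x) * w x)) \<in> borel_measurable M" by measurable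
  have "AE x in M. \<bar>sqrtv x * (norm (K x) * w x)\<bar> \<le> \<bar>k * (sqrtv x * norm (K x))\<bar> + \<bar>sqrtv x * (indicator E x * (norm (K x) * w x))\<bar>"
  proof (rule AE_I2)
    fix x assume x: "x \<in> space M"
    show "\<bar>sqrtv x * (norm (K x) * w x)\<bar> \<le> \<bar>k * (sqrtv x * norm (K x))\<bar> + \<bar>sqrtv x * (indicator E x * (norm (K x) * w x))\<bar>"
    proof (cases "x \<in> E")
      case True then show ?thesis by simp
    next
      case False
      then have "\<bar>w x\<bar> \<le> k" using E(2) x by (simp add: space_M)
      then have "(\<bar>sqrtv x\<bar> * norm (K x)) * \<bar>w x\<bar> \<le> (\<bar>sqrtv x\<bar> * norm (K x)) * k" by (intro mult_left_mono) auto
      then show ?thesis using False k by (simp add: abs_mult mult_ac)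
    qed
  qed
  from square_integrable_le_add(2)[OF square_integrable_cmult(1)[OF Ks] s(1) m this]
  show ?thesis using s(2) k square_integrable_cmult(2)[OF Ks, of k] by (simp add: Lp_norm_eq)
qed

text \<open>Let \<open>q\<close> be the energy norm of \<open>w\<close>. Testing with \<open>w\<close> gives \<open>q\<^sup>2 \<le> q + n q (k N + 2 \<theta> q)\<close>: the
part \<open>k N\<close> comes from the set where \<open>|w| \<le> k\<close>, and \<open>\<theta> q\<close> from its complement \<open>E\<close>, whose
measure \<open>log_estimate\<close> makes small. The choice of \<open>\<theta>\<close> absorbs the quadratic term on the right.\<close>

lemma unit_a_priori_estimate:
  "\<exists>C\<ge>1. \<forall>t w. 0 \<le> t \<longrightarrow> t \<le> 1 \<longrightarrow> w \<in> X \<longrightarrow>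
     (\<forall>q\<in>W. \<bar>energy q (w, grad w) + t * lower_order q (w, grad w)\<bar> \<le> energy.nrm q) \<longrightarrow>
     gnorm (grad w) \<le> C"
proof -
  obtain c where c: "field_bound R c" "field_bound S c" using field_bounds_exist by blast
  have c0: "0 \<le> c" using c by (simp add: field_bound_def)
  define n where "n = real CARD('N) * c"
  have n0: "0 \<le> n" using c0 by (simp add: n_def)
  define \<theta> where "\<theta> = 1 / (4 * (n + 1))"
  have \<theta>: "0 < \<theta>" using n0 by (simp add: \<theta>_def)
  define N where "N = vnorm H + vnorm G"
  have N0: "0 \<le> N" by (simp add: N_def)
  obtain d1 where d1: "0 < d1" "\<forall>\<phi>\<in>X. \<forall>E\<in>sets M. (LINT x|M. indicator E x * v x) \<le> d1 \<longrightarrow>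
           square_integrable M (\<lambda>x. sqrtv x * (indicator E x * (norm (H x) * \<phi> x))) \<and>
           L2norm M (\<lambda>x. sqrtv x * (indicator E x * (norm (H x) * \<phi> x))) \<le> \<theta> * gnorm (grad \<phi>)"
    using multiplier_small_on_small_sets(1)[OF lam norm_admissible_multiplier[OF H_orlicz] \<theta>] by blast
  obtain d2 where d2: "0 < d2" "\<forall>\<phi>\<in>X. \<forall>E\<in>sets M. (LINT x|M. indicator E x * v x) \<le> d2 \<longrightarrow>
           square_integrable M (\<lambda>x. sqrtv x * (indicator E x * (norm (G x) * \<phi> x))) \<and>
           L2norm M (\<lambda>x. sqrtv x * (indicator E x * (norm (G x) * \<phi> x))) \<le> \<theta> * gnorm (grad \<phi>)"
    using multiplier_small_on_small_sets(1)[OF lam norm_admissible_multiplier[OF G_orlicz] \<theta>] by blast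
  define \<delta> where "\<delta> = min d1 d2"
  have \<delta>: "0 < \<delta>" using d1 d2 by (simp add: \<delta>_def)
  define D where "D = S2 * (1 + n * N)"
  have D0: "0 \<le> D" using S2 n0 N0 by (simp add: D_def)
  \<comment> \<open>By Chebyshev's inequality the set where \<open>|arsinh w| > A\<close> has measure at most \<open>(D / A)\<^sup>2 \<le> \<delta>\<close>.\<close>
  define A where "A = (D + 1) / sqrt \<delta>"
  have A: "0 < A" using D0 \<delta> by (simp add: A_def)
  define k where "k = sinh A"
  have k: "0 \<le> k" using A by (simp add: k_def)
  define C where "C = 2 * (1 + n * (k * N))"
  have C1: "1 \<le> C" using n0 k N0 by (simp add: C_def)
  have "gnorm (grad w) \<le> C"
    if t: "0 \<le> t" "t \<le> 1" and w: "w \<in> X"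
      and le: "\<forall>q\<in>W. \<bar>energy q (w, grad w) + t * lower_order q (w, grad w)\<bar> \<le> energy.nrm q" for t w
  proof -
    have le': "\<bar>energy q (w, grad w) + t * lower_order q (w, grad w)\<bar> \<le> energy.nrm q" if "q \<in> W" for q
      using le that by blast
    let ?z = "\<lambda>x. arsinh (w x)"
    have z: "?z \<in> X" "gnorm (grad ?z) \<le> 1 + real CARD('N) * c * (vnorm H + vnorm G)"
      by (rule log_estimate[OF c w t], erule le')+
    define E where "E = {x \<in> \<Omega>. A < \<bar>?z x\<bar>}"
    note Es = arsinh_large_set_small[OF z(1) A E_def]
    have "S2 * gnorm (grad ?z) \<le> D"
      unfolding D_def using z(2) S2 by (intro mult_left_mono) (auto simp: n_def N_def mult.assoc)
    then have "S2 * gnorm (grad ?z) / A \<le> D / A" using A by (simp add: divide_right_mono)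
    also have "D / A \<le> sqrt \<delta>"
    proof -
      have "D / A = D / (D + 1) * sqrt \<delta>" by (simp add: A_def)
      also have "\<dots> \<le> 1 * sqrt \<delta>" using D0 \<delta> by (intro mult_right_mono) (auto simp: divide_le_eq_1)
      finally show ?thesis by simp
    qed
    finally have "(S2 * gnorm (grad ?z) / A)\<^sup>2 \<le> (sqrt \<delta>)\<^sup>2"
      using S2 A by (intro power_mono) auto
    then have Ev: "(LINT x|M. indicator E x * v x) \<le> \<delta>" using Es(2) \<delta> by simp
    have offE: "\<bar>w x\<bar> \<le> k" if "x \<in> \<Omega> - E" for x
    proof -
      have "\<bar>?z x\<bar> \<le> A" using that unfolding E_def by auto
      then have "sinh \<bar>?z x\<bar> \<le> sinh A" by (simp only: sinh_real_le_iff)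
      then show ?thesis by (simp only: sinh_real_abs sinh_arsinh_real k_def)
    qed
    define q where "q = gnorm (grad w)"
    have q0: "0 \<le> q" by (simp add: q_def)
    have PW: "(w, grad w) \<in> W" by (rule X_pair_in_W[OF w])
    have Hs: "square_integrable M (\<lambda>x. sqrtv x * (indicator E x * (norm (H x) * w x)))"
      "L2norm M (\<lambda>x. sqrtv x * (indicator E x * (norm (H x) * w x))) \<le> \<theta> * q"
      using d1(2) w Es(1) Ev unfolding \<delta>_def q_def by auto
    have Gs: "square_integrable M (\<lambda>x. sqrtv x * (indicator E x * (norm (G x) * w x)))"
      "L2norm M (\<lambda>x. sqrtv x * (indicator E x * (norm (G x) * w x))) \<le> \<theta> * q"
      using d2(2) w Es(1) Ev unfolding \<delta>_def q_def by auto
    have Hk: "L2norm M (\<lambda>x. sqrtv x * (norm (H x) * w x)) \<le> k * vnorm H + \<theta> * q"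
      by (rule multiplier_split[OF H_Lp w k Es(1) _ Hs]) (rule offE)
    have Gk: "L2norm M (\<lambda>x. sqrtv x * (norm (G x) * w x)) \<le> k * vnorm G + \<theta> * q"
      by (rule multiplier_split[OF G_Lp w k Es(1) _ Gs]) (rule offE)
    have sH: "square_integrable M (\<lambda>x. sqrtv x * (norm (H x) * w x))"
      and sG: "square_integrable M (\<lambda>x. sqrtv x * (norm (G x) * w x))"
      using multiplier_bounds_exist(1,2) PW by auto
    note bH = dot_fields_bound(2)[OF coefficient_measurable(3) X_D(4)[OF w] sH c(1) PW]
    note bG = dot_fields_bound(2)[OF coefficient_measurable(2) X_D(4)[OF w] sG c(2) PW]
    have H1: "\<bar>LINT x|M. dot_fields H R (grad w) x * w x * v x\<bar> \<le> n * q * (k * vnorm H + \<theta> * q)"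
    proof (rule order_trans)
      show "\<bar>LINT x|M. dot_fields H R (grad w) x * w x * v x\<bar> \<le> n * q * L2norm M (\<lambda>x. sqrtv x * (norm (H x) * w x))"
        using bH by (simp add: n_def q_def)
    qed (intro mult_left_mono Hk, use n0 q0 in simp)
    have G1: "\<bar>LINT x|M. dot_fields G S (grad w) x * w x * v x\<bar> \<le> n * q * (k * vnorm G + \<theta> * q)"
    proof (rule order_trans)
      show "\<bar>LINT x|M. dot_fields G S (grad w) x * w x * v x\<bar> \<le> n * q * L2norm M (\<lambda>x. sqrtv x * (norm (G x) * w x))"
        using bG by (simp add: n_def q_def)
    qed (intro mult_left_mono Gk, use n0 q0 in simp)
    have "(LINT x|M. dot_fields H R (grad w) x * w x * v x) - (LINT x|M. dot_fields G S (grad w) x * w x * v x)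
        \<le> lower_order (w, grad w) (w, grad w)"
      using lower_order_test_bound(1)[OF w, of "\<lambda>s. s" "\<lambda>s. 1"] by simp
    define P where "P = n * q * (k * N + 2 * \<theta> * q)"
    have P0: "0 \<le> P" using n0 q0 k N0 \<theta> by (simp add: P_def)
    have "- P \<le> lower_order (w, grad w) (w, grad w)"
    proof -
      have "P = n * q * (k * vnorm H + \<theta> * q) + n * q * (k * vnorm G + \<theta> * q)"
        by (simp add: P_def N_def algebra_simps)
      then show ?thesis
        using H1 G1 \<open>_ \<le> lower_order (w, grad w) (w, grad w)\<close> by linarith
    qed
    then have "t * (- P) \<le> t * lower_order (w, grad w) (w, grad w)" using t(1) by (rule mult_left_mono)
    moreover have "t * P \<le> 1 * P" using t P0 by (intro mult_right_mono) auto
    moreover have "q\<^sup>2 + t * lower_order (w, grad w) (w, grad w) \<le> q"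
      using le'[OF PW] by (simp add: energy_self energy_nrm q_def)
    ultimately have "q\<^sup>2 \<le> q + P" by simp
    moreover have "P = n * (k * N) * q + (2 * n * \<theta>) * q\<^sup>2" by (simp add: P_def power2_eq_square algebra_simps)
    moreover have "(2 * n * \<theta>) * q\<^sup>2 \<le> 1/2 * q\<^sup>2"
    proof (rule mult_right_mono)
      show "2 * n * \<theta> \<le> 1/2" using n0 by (simp add: \<theta>_def field_simps)
    qed simp
    ultimately have "q\<^sup>2 \<le> q + n * (k * N) * q + 1/2 * q\<^sup>2" by linarith
    then have "q * q \<le> C * q" by (simp add: C_def power2_eq_square algebra_simps)
    then have "q \<le> C" using q0 C1 by (cases "q = 0") (auto simp: mult_le_cancel_right)
    then show ?thesis by (simp add: q_def)
  qed
  then show ?thesis using C1 by blast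
qed

text \<open>The gradient of \<open>w / m\<close> is the rescaled gradient of \<open>w\<close> only almost everywhere, so the scaling
argument below compares pairs that differ on a null set.\<close>

lemma form_cong_AE:
  assumes p: "p \<in> W" "p' \<in> W" and q: "q \<in> W"
    and ae: "AE x in M. fst p x = fst p' x" "AE x in M. snd p x = snd p' x"
  shows "energy q p + t * lower_order q p = energy q p' + t * lower_order q p'"
proof -
  have "energy q p = energy q p'"
    unfolding energy_def
  proof (rule integral_cong_AE)
    show "(\<lambda>x. (Q x *v snd q x) \<bullet> snd p x) \<in> borel_measurable M" "(\<lambda>x. (Q x *v snd q x) \<bullet> snd p' x) \<in> borel_measurable M"
      using Q_form_measurable W_D(4) p q by auto
    show "AE x in M. (Q x *v snd q x) \<bullet> snd p x = (Q x *v snd q x) \<bullet> snd p' x"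
      using ae(2) by eventually_elim simp
  qed
  moreover have "lower_order q p = lower_order q p'"
    unfolding lower_order_def
  proof (rule integral_cong_AE)
    show "lower_order_integrand q p \<in> borel_measurable M" "lower_order_integrand q p' \<in> borel_measurable M"
      using lower_order_integrable(4) p q by auto
    show "AE x in M. lower_order_integrand q p x = lower_order_integrand q p' x"
      using ae by eventually_elim (simp add: lower_order_integrand_def dot_fields_def)
  qed
  ultimately show ?thesis by simp
qed

lemma perturbed_form_bilinear: "energy.bilinear_on_W (\<lambda>p q. energy p q + t * lower_order p q)"
  unfolding energy.bilinear_on_W_def
  by (intro conjI ballI allI)
    (simp_all only: energy.bilinear_on_W_add[OF lower_order_bilinear] energy.bilinear_on_W_scale[OF lower_order_bilinear]
       energy.ip_add energy.ip_add_right energy.ip_scale energy.ip_scale_right,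
     simp_all add: algebra_simps)

text \<open>For Lipschitz \<open>w\<close> and \<open>m > 0\<close> apply the estimate to \<open>w / m\<close>; for \<open>m = 0\<close> let \<open>m\<close> tend to \<open>0\<close>. Both
sides are continuous in the energy norm, so the estimate extends to \<open>W\<close>.\<close>

lemma a_priori_estimate:
  "\<exists>C\<ge>1. \<forall>t. 0 \<le> t \<longrightarrow> t \<le> 1 \<longrightarrow>
     energy.right_bounded_below (\<lambda>p q. energy p q + t * lower_order p q) C"
proof -
  obtain C where C: "1 \<le> C" "\<forall>t w. 0 \<le> t \<longrightarrow> t \<le> 1 \<longrightarrow> w \<in> X \<longrightarrow>
     (\<forall>q\<in>W. \<bar>energy q (w, grad w) + t * lower_order q (w, grad w)\<bar> \<le> energy.nrm q) \<longrightarrow>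
     gnorm (grad w) \<le> C"
    using unit_a_priori_estimate by blast
  obtain K where K: "0 \<le> K" "\<forall>p\<in>W. \<forall>q\<in>W. \<bar>lower_order p q\<bar> \<le> K * energy.nrm p * energy.nrm q"
    using lower_order_terms by blast
  have "energy.right_bounded_below (\<lambda>p q. energy p q + t * lower_order p q) C" if t: "0 \<le> t" "t \<le> 1" for t
  proof (rule right_bounded_below_of_dense[OF perturbed_form_bilinear])
    show "0 \<le> 1 + K" using K by simp
    show "\<bar>energy p q + t * lower_order p q\<bar> \<le> (1 + K) * energy.nrm p * energy.nrm q" if "p \<in> W" "q \<in> W" for p q
    proof -
      have "\<bar>energy p q + t * lower_order p q\<bar> \<le> \<bar>energy p q\<bar> + \<bar>t * lower_order p q\<bar>" by simp
      also have "\<bar>t * lower_order p q\<bar> \<le> \<bar>lower_order p q\<bar>" using t by (simp add: abs_mult mult_left_le_one_le)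
      finally show ?thesis using energy.cauchy_schwarz[OF that] K(2) that by (simp add: algebra_simps) force
    qed
    show "0 \<le> C" using C by simp
    have pos: "gnorm (grad w) \<le> C * m"
      if w: "w \<in> X" and m: "0 < m" and le: "\<And>q. q \<in> W \<Longrightarrow> \<bar>energy q (w, grad w) + t * lower_order q (w, grad w)\<bar> \<le> m * energy.nrm q" for w m
    proof -
      let ?w = "\<lambda>x. w x / m"
      have d: "DERIV (\<lambda>s. s / m) s :> 1 / m" for s
        by (rule DERIV_cdivide[OF DERIV_ident])
      have w': "?w \<in> X" "AE x in M. grad ?w x = (1 / m) *\<^sub>R grad w x"
        using X_compose[OF w d] by simp_all
      have PW: "(w, grad w) \<in> W" "(?w, grad ?w) \<in> W" using w w'(1) by (auto intro: X_pair_in_W)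
      have PW': "(1 / m) *\<^sub>R (w, grad w) \<in> W" by (rule energy.W_scale[OF PW(1)])
      have "\<bar>energy q (?w, grad ?w) + t * lower_order q (?w, grad ?w)\<bar> \<le> energy.nrm q" if q: "q \<in> W" for q
      proof -
        have "energy q (?w, grad ?w) + t * lower_order q (?w, grad ?w)
            = energy q ((1 / m) *\<^sub>R (w, grad w)) + t * lower_order q ((1 / m) *\<^sub>R (w, grad w))"
          using w'(2) by (intro form_cong_AE[OF PW(2) PW' q]) (auto simp: scaleR_fun_def)
        also have "\<dots> = (1 / m) * (energy q (w, grad w) + t * lower_order q (w, grad w))"
          by (rule energy.bilinear_on_W_scale(2)[OF perturbed_form_bilinear PW(1) q])
        finally have e: "energy q (?w, grad ?w) + t * lower_order q (?w, grad ?w)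
            = (1 / m) * (energy q (w, grad w) + t * lower_order q (w, grad w))" .
        have "\<bar>(1 / m) * (energy q (w, grad w) + t * lower_order q (w, grad w))\<bar>
            = \<bar>energy q (w, grad w) + t * lower_order q (w, grad w)\<bar> / m" using m by (simp add: abs_mult)
        also have "\<dots> \<le> energy.nrm q" using le[OF q] m by (simp add: pos_divide_le_eq mult.commute)
        finally show ?thesis unfolding e .
      qed
      then have "gnorm (grad ?w) \<le> C" using C(2) t w'(1) by blast
      then have "m * gnorm (grad ?w) \<le> m * C" using m by (intro mult_left_mono) simp_all
      moreover have "gnorm (grad w) \<le> \<bar>m\<bar> * gnorm (grad ?w) + \<bar>0\<bar> * gnorm (grad ?w)"
        by (rule QL2_linear(2)[OF X_D(3)[OF w'(1)] X_D(3)[OF w'(1)]], rule eventually_mono[OF w'(2)])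
          (use m in simp)
      then have "gnorm (grad w) \<le> m * gnorm (grad ?w)" using m by simp
      ultimately have "gnorm (grad w) \<le> m * C" by linarith
      then show ?thesis by (simp only: mult.commute)
    qed
    show "gnorm (grad w) \<le> C * m"
      if w: "w \<in> X" and m: "0 \<le> m" and le: "\<And>q. q \<in> W \<Longrightarrow> \<bar>energy q (w, grad w) + t * lower_order q (w, grad w)\<bar> \<le> m * energy.nrm q" for w m
    proof (rule field_le_epsilon)
      fix e :: real assume e: "0 < e"
      have "gnorm (grad w) \<le> C * (m + e / C)"
      proof (rule pos[OF w])
        show "0 < m + e / C" using m e C by (simp add: add_nonneg_pos)
        fix q assume q: "q \<in> W"
        have "m * energy.nrm q \<le> (m + e / C) * energy.nrm q"
          using e C energy.nrm_nonneg[OF q] by (intro mult_right_mono) auto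
        then show "\<bar>energy q (w, grad w) + t * lower_order q (w, grad w)\<bar> \<le> (m + e / C) * energy.nrm q"
          using le[OF q] by linarith
      qed
      also have "\<dots> = C * m + e" using C by (simp add: distrib_left)
      finally show "gnorm (grad w) \<le> C * m + e" .
    qed
  qed
  then show ?thesis using C(1) by blast
qed

section \<open>Existence and uniqueness\<close>

theorem weak_solution_exists_unique:
  assumes f: "f \<in> L2v" and g: "g \<in> L2v"
    and T: "\<forall>i. degenerate_subunit Q v \<Omega> (T i)"
  shows "\<exists>p. degenerate_weak_solution \<Omega> v Q H R G S F f g T p"
    and "degenerate_weak_solution \<Omega> v Q H R G S F f g T p \<Longrightarrow>
         degenerate_weak_solution \<Omega> v Q H R G S F f g T q \<Longrightarrow>
         (AE x in M. fst p x = fst q x) \<and> (AE x in M. snd p x = snd q x)"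
proof -
  obtain C where C: "1 \<le> C" "\<forall>t. 0 \<le> t \<longrightarrow> t \<le> 1 \<longrightarrow>
     energy.right_bounded_below (\<lambda>p q. energy p q + t * lower_order p q) C"
    using a_priori_estimate by blast
  obtain K where K: "0 \<le> K" "\<forall>p\<in>W. \<forall>q\<in>W. \<bar>lower_order p q\<bar> \<le> K * energy.nrm p * energy.nrm q"
    using lower_order_terms by blast
  define a where "a = (\<lambda>p q. energy p q + lower_order p q)"
  have abil: "energy.bilinear_on_W a" using perturbed_form_bilinear[of 1] by (simp add: a_def)
  have abd: "\<bar>a p q\<bar> \<le> (1 + K) * energy.nrm p * energy.nrm q" if "p \<in> W" "q \<in> W" for p q
  proof -
    have "\<bar>lower_order p q\<bar> \<le> K * energy.nrm p * energy.nrm q" using K(2) that by blast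
    then show ?thesis using energy.cauchy_schwarz[OF that] unfolding a_def by (simp add: algebra_simps)
  qed
  have aright: "energy.right_bounded_below a C" using C(2)[rule_format, of 1] by (simp add: a_def)
  have aleft: "energy.left_bounded_below a C"
    unfolding a_def by (rule energy.method_of_continuity[OF lower_order_bilinear K(1) _ C(1)]) (use K(2) C(2) in auto)
  have weak_iff: "degenerate_weak_solution \<Omega> v Q H R G S F f g T p \<longleftrightarrow>
      p \<in> W \<and> (\<forall>\<phi>\<in>X. a p (\<phi>, grad \<phi>) = (LINT x|M. f x * \<phi> x * v x) + (LINT x|M. dot_fields g T (grad \<phi>) x * v x))" for p
  proof -
    have "a p (\<phi>, grad \<phi>) = (LINT x|M. (Q x *v snd p x) \<bullet> grad \<phi> x)
        + (LINT x|M. dot_fields H R (snd p) x * \<phi> x * v x)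
        + (LINT x|M. fst p x * dot_fields G S (grad \<phi>) x * v x)
        + (LINT x|M. F x * fst p x * \<phi> x * v x)" if "p \<in> W" "\<phi> \<in> X" for \<phi>
      using lower_order_eq[OF that(1) X_pair_in_W[OF that(2)]] by (simp add: a_def energy_def)
    then show ?thesis unfolding degenerate_weak_solution_def by (cases p) auto
  qed
  define l where "l = (\<lambda>q. (LINT x|M. f x * fst q x * v x) + (LINT x|M. dot_fields g T (snd q) x * v x))"
  obtain c where c: "field_bound T c" using field_bound_exists[OF T] by blast
  have fm: "f \<in> borel_measurable M" and fs: "square_integrable M (\<lambda>x. sqrtv x * f x)" using f by (simp_all add: Lp_space_real_iff)
  have gm: "g \<in> borel_measurable M" and gs: "square_integrable M (\<lambda>x. sqrtv x * norm (g x))" using g by (simp_all add: Lp_space_iff)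
  have lf: "integrable M (\<lambda>x. f x * fst q x * v x)"
    "\<bar>LINT x|M. f x * fst q x * v x\<bar> \<le> vnorm f * S2 * energy.nrm q" if q: "q \<in> W" for q
  proof -
    have qs: "square_integrable M (\<lambda>x. sqrtv x * fst q x)" using W_D(1)[OF q] by (simp add: Lp_space_real_iff)
    have e: "f x * fst q x * v x = (sqrtv x * f x) * (sqrtv x * fst q x)" if "x \<in> \<Omega>" for x
    proof -
      have "(sqrtv x * f x) * (sqrtv x * fst q x) = f x * fst q x * (sqrtv x * sqrtv x)" by (simp only: mult_ac)
      then show ?thesis by (simp only: sqrtv_mult[OF that])
    qed
    note r = square_integrable_mult[OF fs qs]
    show "integrable M (\<lambda>x. f x * fst q x * v x)"
      using r(1) by (rule Bochner_Integration.integrable_cong[THEN iffD1, rotated -1]) (simp_all add: space_M e)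
    have eqI: "(LINT x|M. f x * fst q x * v x) = (LINT x|M. (sqrtv x * f x) * (sqrtv x * fst q x))"
      by (rule Bochner_Integration.integral_cong) (simp_all add: space_M e)
    have "\<bar>LINT x|M. f x * fst q x * v x\<bar> \<le> vnorm f * vnorm (fst q)"
      unfolding eqI Lp_norm_real_eq by (rule r(2))
    also have "\<dots> \<le> vnorm f * (S2 * gnorm (snd q))"
      by (rule mult_left_mono[OF W_Lp_bound[OF q]]) simp
    finally show "\<bar>LINT x|M. f x * fst q x * v x\<bar> \<le> vnorm f * S2 * energy.nrm q"
      by (simp add: energy_nrm mult.assoc)
  qed
  have lg: "integrable M (\<lambda>x. dot_fields g T (snd q) x * v x)"
    "\<bar>LINT x|M. dot_fields g T (snd q) x * v x\<bar> \<le> real CARD('N) * c * vnorm g * energy.nrm q" if q: "q \<in> W" for q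
    using dot_fields_bound[of g "\<lambda>x. 1" T c q] gm gs c q by (simp_all add: Lp_norm_eq energy_nrm mult_ac)
  have l_add: "l (p + q) = l p + l q" if "p \<in> W" "q \<in> W" for p q
  proof -
    have e: "f x * fst (p + q) x * v x = f x * fst p x * v x + f x * fst q x * v x"
      "dot_fields g T (snd (p + q)) x * v x = dot_fields g T (snd p) x * v x + dot_fields g T (snd q) x * v x" for x
      by (simp_all add: dot_fields_linear algebra_simps)
    show ?thesis unfolding l_def e using lf(1)[OF that(1)] lf(1)[OF that(2)] lg(1)[OF that(1)] lg(1)[OF that(2)] by simp
  qed
  have l_scale: "l (s *\<^sub>R q) = s * l q" for s q
  proof -
    have e: "f x * fst (s *\<^sub>R q) x * v x = s * (f x * fst q x * v x)"
      "dot_fields g T (snd (s *\<^sub>R q)) x * v x = s * (dot_fields g T (snd q) x * v x)" for x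
      by (simp_all add: dot_fields_linear, simp add: scaleR_fun_def)
    show ?thesis unfolding l_def e by (simp add: distrib_left)
  qed
  define m where "m = vnorm f * S2 + real CARD('N) * c * vnorm g"
  have m0: "0 \<le> m" using S2 c by (simp add: m_def field_bound_def)
  have l_le: "\<bar>l q\<bar> \<le> m * energy.nrm q" if "q \<in> W" for q
    using lf(2)[OF that] lg(2)[OF that] unfolding l_def m_def distrib_right by linarith
  have "\<exists>u\<in>W. energy.nrm u \<le> C * m \<and> (\<forall>w\<in>W. a u w = l w)"
    using C(1) K(1) by (intro energy.right_bounded_below_imp_solvable[OF abil _ abd _ aright l_add l_scale l_le m0]) auto
  then obtain u where u: "u \<in> W" "\<And>w. w \<in> W \<Longrightarrow> a u w = l w" by blast
  have "degenerate_weak_solution \<Omega> v Q H R G S F f g T u"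
    unfolding weak_iff using u X_pair_in_W by (auto simp: l_def)
  then show "\<exists>p. degenerate_weak_solution \<Omega> v Q H R G S F f g T p" by blast
  assume p: "degenerate_weak_solution \<Omega> v Q H R G S F f g T p"
    and q: "degenerate_weak_solution \<Omega> v Q H R G S F f g T q"
  have pW: "p \<in> W" and qW: "q \<in> W" using p q by (simp_all add: weak_iff)
  have dW: "p - q \<in> W" by (rule energy.W_diff[OF pW qW])
  have z: "a (p - q) (\<phi>, grad \<phi>) = 0" if "\<phi> \<in> X" for \<phi>
    using p q that energy.bilinear_on_W_diff(1)[OF abil pW qW X_pair_in_W[OF that]] by (simp add: weak_iff)
  have K1: "0 \<le> 1 + K" using K by simp
  have "\<forall>y\<in>W. \<bar>a (p - q) y\<bar> \<le> 0 * energy.nrm y"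
    using form_vanishes_of_dense[OF abil K1 abd dW z] by simp
  then have "energy.nrm (p - q) \<le> C * 0"
    using aleft dW unfolding energy.left_bounded_below_def by blast
  then have "energy.nrm (p - q) = 0" using energy.nrm_nonneg[OF dW] by simp
  from W_zero_AE[OF dW this] show "(AE x in M. fst p x = fst q x) \<and> (AE x in M. snd p x = snd q x)"
    by (auto simp: fun_diff_def)
qed

end

theorem theorem3p4:
  fixes \<Omega> :: "(real^'n) set"
    and v :: "real^'n \<Rightarrow> real"
    and Q :: "real^'n \<Rightarrow> real^'n^'n"
    and k \<sigma> lam :: real
    and f F :: "real^'n \<Rightarrow> real"
    and G H g :: "real^'n \<Rightarrow> real^'N"
    and R S T :: "'N \<Rightarrow> real^'n \<Rightarrow> real^'n"
    and \<rho> :: "real^'n \<Rightarrow> real^'n \<Rightarrow> real"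
  assumes Omega: "bounded \<Omega>" "connected \<Omega>" "open \<Omega>"
    and v: "is_weight \<Omega> v" "integrable (lebesgue_on \<Omega>) v"
    and Q: "matrix_function \<Omega> Q"
    and k: "0 < k" "AE x in lebesgue_on \<Omega>. onorm ((*v) (Q x)) \<le> k * v x"
    and fF: "f \<in> Lp_space 2 v \<Omega>" "F \<in> Lp_space 2 v \<Omega>"
    and GHg: "G \<in> Lp_space 2 v \<Omega>" "H \<in> Lp_space 2 v \<Omega>" "g \<in> Lp_space 2 v \<Omega>"
    and RST: "\<forall>i. degenerate_subunit Q v \<Omega> (R i)"
             "\<forall>i. degenerate_subunit Q v \<Omega> (S i)"
             "\<forall>i. degenerate_subunit Q v \<Omega> (T i)"
    and nonneg: "\<forall>\<phi>\<in>QLip_0 Q v \<Omega>. (\<forall>x\<in>\<Omega>. 0 \<le> \<phi> x) \<longrightarrow>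
       0 \<le> (LINT x|lebesgue_on \<Omega>. (dot_fields G S (grad \<phi>) x + F x * \<phi> x) * v x)"
    and sigma: "0 < \<sigma>"
    and Sobolev: "\<exists>S2A\<ge>0. \<forall>\<phi>\<in>QLip_0 Q v \<Omega>.
       orlicz_norm (young_A \<sigma>) v \<Omega> \<phi> \<le>
         ennreal (S2A * sqrt (LINT x|lebesgue_on \<Omega>. (norm (matrix_sqrt (Q x) *v grad \<phi> x))\<^sup>2))"
    and rho: "admissible_quasimetric \<Omega> \<rho>"
    and Poincare: "local_Poincare Q v \<Omega> \<rho>"
    and lam: "0 < lam" "lam < 1"
    and HG: "H \<in> orlicz_space (young_C lam \<sigma>) v \<Omega>" "G \<in> orlicz_space (young_C lam \<sigma>) v \<Omega>"
    and F: "F \<in> orlicz_space (young_D lam \<sigma>) v \<Omega>"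
  shows "(\<exists>u du. degenerate_weak_solution \<Omega> v Q H R G S F f g T (u, du)) \<and>
         (\<forall>u\<^sub>1 du\<^sub>1 u\<^sub>2 du\<^sub>2.
            degenerate_weak_solution \<Omega> v Q H R G S F f g T (u\<^sub>1, du\<^sub>1) \<and>
            degenerate_weak_solution \<Omega> v Q H R G S F f g T (u\<^sub>2, du\<^sub>2) \<longrightarrow>
            (AE x in lebesgue_on \<Omega>. u\<^sub>1 x = u\<^sub>2 x) \<and> (AE x in lebesgue_on \<Omega>. du\<^sub>1 x = du\<^sub>2 x))"
proof -
  obtain S2 where S2: "0 \<le> S2" and sob: "\<forall>\<phi>\<in>QLip_0 Q v \<Omega>. orlicz_norm (young_A \<sigma>) v \<Omega> \<phi> \<le>
         ennreal (S2 * sqrt (LINT x|lebesgue_on \<Omega>. (norm (matrix_sqrt (Q x) *v grad \<phi> x))\<^sup>2))"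
    using Sobolev by blast
  interpret dirichlet_problem \<Omega> v Q \<sigma> S2 lam F G H R S
  proof
    show "orlicz_norm (young_A \<sigma>) v \<Omega> \<phi> \<le> ennreal (S2 * QL2_norm Q \<Omega> (grad \<phi>))"
      if "\<phi> \<in> QLip_0 Q v \<Omega>" for \<phi>
      using sob that by (simp add: QL2_norm_def)
    show "0 \<le> (LINT x|lebesgue_on \<Omega>. (dot_fields G S (grad \<phi>) x + F x * \<phi> x) * v x)"
      if "\<phi> \<in> QLip_0 Q v \<Omega>" "\<And>x. x \<in> \<Omega> \<Longrightarrow> 0 \<le> \<phi> x" for \<phi>
      using nonneg that by blast
  qed (use assms S2 in simp_all)
  show ?thesis
    using weak_solution_exists_unique(1)[OF fF(1) GHg(3) RST(3)]
      weak_solution_exists_unique(2)[OF fF(1) GHg(3) RST(3)] by fastforce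
qed

end
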